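(* The Petersen graph is the unique connected graph on $10$ vertices with cop number $3$; every other connected graph on $10$ vertices has cop number at most $2$.
   Context: Game of cops and robbers on a connected graph $G$: first $k$ cops are placed on vertices (several cops may share a vertex), then the robber is placed on a vertex; then cops and robber alternate moves, the cops moving first. On the cops' turn each cop moves to a neighboring vertex or stays put; on the robber's turn he does likewise. All positions are always known to all players. The cops win if at some finite time a cop occupies the same vertex as the robber. The cop number $c(G)$ is the minimum $k$ such that $k$ cops have a strategy that wins against every robber strategy. The Petersen graph is the 3-regular graph on 10 vertices of girth 5 (e.g. the Kneser graph $KG(5,2)$). *)

theory Defs
  imports "Graph_Theory.Digraph_Component" "Graph_Theory.Digraph_Isomorphism"
begin

text \<open>The Kneser graph $KG(5,2)$.\<close>

definition petersen :: "nat set pair_pre_digraph" where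
  "petersen =
    \<lparr> pverts = {A. A \<subseteq> {..<5} \<and> card A = 2},
      parcs = {(A, B). A \<subseteq> {..<5} \<and> card A = 2 \<and> B \<subseteq> {..<5} \<and> card B = 2 \<and> A \<inter> B = {}} \<rparr>"

text \<open>
  A position \<open>(C, r)\<close> lists the vertices of the cops (repetitions allowed, the \<open>i\<close>-th entry
  belonging to the \<open>i\<close>-th cop) and the vertex of the robber at the end of a round. Round 0 is the
  placement; in each later round the cops move and then the robber moves. A history lists the
  positions of all completed rounds, most recent first.
\<close>

type_synonym 'a history = "('a list \<times> 'a) list"

type_synonym 'a cop_strategy = "'a history \<Rightarrow> 'a list"

text \<open>The robber sees the completed rounds and the cops' choice in the current round.\<close>

type_synonym 'a robber_strategy = "'a history \<Rightarrow> 'a list \<Rightarrow> 'a"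

definition legal_move :: "'a pair_pre_digraph \<Rightarrow> 'a \<Rightarrow> 'a \<Rightarrow> bool" where
  "legal_move G u v \<longleftrightarrow> v = u \<or> (u, v) \<in> parcs G"

fun legal_cops :: "'a pair_pre_digraph \<Rightarrow> nat \<Rightarrow> 'a history \<Rightarrow> 'a list \<Rightarrow> bool" where
  "legal_cops G k [] C' \<longleftrightarrow> length C' = k \<and> set C' \<subseteq> pverts G"
| "legal_cops G k ((C, r) # h) C' \<longleftrightarrow> list_all2 (legal_move G) C C'"

fun legal_robber :: "'a pair_pre_digraph \<Rightarrow> 'a history \<Rightarrow> 'a \<Rightarrow> bool" where
  "legal_robber G [] r' \<longleftrightarrow> r' \<in> pverts G"
| "legal_robber G ((C, r) # h) r' \<longleftrightarrow> legal_move G r r'"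

inductive legal_history :: "'a pair_pre_digraph \<Rightarrow> nat \<Rightarrow> 'a history \<Rightarrow> bool"
  for G :: "'a pair_pre_digraph" and k :: nat where
  legal_history_Nil: "legal_history G k []"
| legal_history_Cons: "legal_history G k h \<Longrightarrow> legal_cops G k h C \<Longrightarrow> legal_robber G h r
    \<Longrightarrow> legal_history G k ((C, r) # h)"

definition legal_cop_strategy :: "'a pair_pre_digraph \<Rightarrow> nat \<Rightarrow> 'a cop_strategy \<Rightarrow> bool" where
  "legal_cop_strategy G k \<sigma> \<longleftrightarrow> (\<forall>h. legal_history G k h \<longrightarrow> legal_cops G k h (\<sigma> h))"

definition legal_robber_strategy :: "'a pair_pre_digraph \<Rightarrow> nat \<Rightarrow> 'a robber_strategy \<Rightarrow> bool" where
  "legal_robber_strategy G k \<rho> \<longleftrightarrow>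
    (\<forall>h C. legal_history G k h \<longrightarrow> legal_cops G k h C \<longrightarrow> legal_robber G h (\<rho> h C))"

primrec play :: "'a cop_strategy \<Rightarrow> 'a robber_strategy \<Rightarrow> nat \<Rightarrow> 'a history" where
  "play \<sigma> \<rho> 0 = []"
| "play \<sigma> \<rho> (Suc n) = (let h = play \<sigma> \<rho> n; C = \<sigma> h in (C, \<rho> h C) # h)"

text \<open>
  Capture is tested after every half-round: \<open>r \<in> set C\<close> once the robber has been placed or has
  moved, and \<open>r \<in> set (\<sigma> ((C, r) # h))\<close> once the cops have made their next move. What the play does
  after a capture is irrelevant.
\<close>

definition cops_win :: "'a cop_strategy \<Rightarrow> 'a robber_strategy \<Rightarrow> bool" where
  "cops_win \<sigma> \<rho> \<longleftrightarrow>
    (\<exists>n C r h. play \<sigma> \<rho> n = (C, r) # h \<and> (r \<in> set C \<or> r \<in> set (\<sigma> ((C, r) # h))))"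

definition winning_cop_strategy :: "'a pair_pre_digraph \<Rightarrow> nat \<Rightarrow> 'a cop_strategy \<Rightarrow> bool" where
  "winning_cop_strategy G k \<sigma> \<longleftrightarrow>
    legal_cop_strategy G k \<sigma> \<and> (\<forall>\<rho>. legal_robber_strategy G k \<rho> \<longrightarrow> cops_win \<sigma> \<rho>)"

definition cop_number :: "'a pair_pre_digraph \<Rightarrow> nat" where
  "cop_number G = (LEAST k. \<exists>\<sigma>. winning_cop_strategy G k \<sigma>)"

end

theory Submission
  imports Defs
begin

text \<open>
  Two cops win on a graph as soon as they win on a partial graph it extends, in the sense that the
  cops use only pairs known to be adjacent while the robber may use all pairs not known to be
  non-adjacent. Deciding the pairs of ten labelled vertices one after the other thus yields a finite
  search tree whose branches end when the partial graph is won by two cops, disconnected, or contains a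
  relabelled copy of a partial graph treated before. The maximum degree is bounded
  by 7, 6, 5, 4, 3 and 2 in turn: excluding a vertex of degree \<open>n\<close> makes every vertex with
  \<open>n - 1\<close> known neighbours saturated. The only branch that survives is the Petersen graph.
  There a robber avoids two cops because a vertex other than those of the cops
  has three neighbours, of which each cop threatens at most one; and three cops on the neighbours
  of a vertex dominate the graph.
\<close>

section \<open>Winning positions and cop numbers\<close>

text \<open>The connected graphs on ten vertices number in the millions, so wins of the cops have to
  be certified for whole families of graphs at once; a partial graph is such a family, bounded below
  by its known edges and above by its possible ones. The argument is indirect: if two cops do not
  win on a graph, no certificate for a partial graph that it extends can pass its check. Assuming in
  addition that the graph is not the Petersen graph, the completely decided Petersen pattern counts
  as refuted from the outset and closes its branch like any earlier pattern. Large degrees come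
  before small ones because a cop on a vertex of degree n leaves the robber only 9 - n vertices out
  of that cop's reach, so little has to be decided; once such vertices are excluded, saturation
  decides many pairs without a case distinction and makes the smaller degrees affordable. Staying
  put is a legal move, so \<open>legal_move\<close> is reflexive: closed neighbourhoods describe the
  options of both players at once, and a robber who walks into a cop needs no rule of his
  own.\<close>

primrec captures_within :: "'a pair_pre_digraph \<Rightarrow> nat \<Rightarrow> 'a list \<Rightarrow> 'a \<Rightarrow> bool" where
  "captures_within G 0 C r \<longleftrightarrow> (\<exists>C'. list_all2 (legal_move G) C C' \<and> r \<in> set C')"
| "captures_within G (Suc n) C r \<longleftrightarrow> captures_within G n C r \<or>
    (\<exists>C'. list_all2 (legal_move G) C C' \<and> (\<forall>r'. legal_move G r r' \<longrightarrow> captures_within G n C' r'))"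

text \<open>It is the cops' turn. The bound counts the cop moves after the first one. A robber who
  steps onto a cop is covered by the base case, as that cop may stay where it is.\<close>

definition cop_win :: "'a pair_pre_digraph \<Rightarrow> 'a list \<Rightarrow> 'a \<Rightarrow> bool" where
  "cop_win G C r \<longleftrightarrow> (\<exists>n. captures_within G n C r)"

lemma captures_within_mono: "captures_within G m C r \<Longrightarrow> m \<le> n \<Longrightarrow> captures_within G n C r"
  by (induction n) (auto simp: le_Suc_eq)

text \<open>Unfolding the recursion down to the level at which the position was won yields a move
  after which the bound has strictly dropped. This decrease is what later forces every play to
  end.\<close>

lemma captures_within_move:
  assumes "captures_within G n C r"
  shows "\<exists>C'. list_all2 (legal_move G) C C' \<and>
    (r \<in> set C' \<or> (\<exists>m<n. \<forall>r'. legal_move G r r' \<longrightarrow> captures_within G m C' r'))"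
  using assms by (induction n) (auto simp: less_Suc_eq)

lemma cop_win_catch:
  "list_all2 (legal_move G) C C' \<Longrightarrow> r \<in> set C' \<Longrightarrow> cop_win G C r"
  unfolding cop_win_def by (metis captures_within.simps(1))

lemma legal_move_refl [simp]: "legal_move G v v"
  by (simp add: legal_move_def)

lemma (in pair_graph) legal_move_sym: "legal_move G u v \<longleftrightarrow> legal_move G v u"
  by (auto simp: legal_move_def dest: arcs_symmetric)

lemma (in pair_graph) legal_move_in_verts: "legal_move G u v \<Longrightarrow> u \<in> pverts G \<Longrightarrow> v \<in> pverts G"
  by (auto simp: legal_move_def dest: in_arcsD2)

lemma (in pair_graph) finite_legal_moves: "finite {v. legal_move G u v}"
proof (rule finite_subset)
  show "{v. legal_move G u v} \<subseteq> insert u (pverts G)"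
    by (auto simp: legal_move_def dest: in_arcsD2)
qed (simp add: pair_finite_verts)

text \<open>The bounds for the individual replies of the robber may differ; since he has only
  finitely many replies, their maximum serves for all of them.\<close>

lemma (in pair_graph) cop_win_step:
  assumes move: "list_all2 (legal_move G) C C'"
    and win: "\<And>r'. legal_move G r r' \<Longrightarrow> cop_win G C' r'"
  shows "cop_win G C r"
proof -
  obtain n where n: "\<And>r'. legal_move G r r' \<Longrightarrow> captures_within G (n r') C' r'"
    using win unfolding cop_win_def by metis
  define N where "N = Max (n ` {r'. legal_move G r r'})"
  have "captures_within G N C' r'" if "legal_move G r r'" for r'
    using n[OF that] by (rule captures_within_mono)
      (auto simp: N_def that finite_legal_moves intro!: Max_ge)
  then have "captures_within G (Suc N) C r"
    using move by auto
  then show ?thesis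
    unfolding cop_win_def by blast
qed

section \<open>From winning positions to strategies, and from safe positions to evasion\<close>

lemma legal_history_play:
  assumes "legal_cop_strategy G k \<sigma>" "legal_robber_strategy G k \<rho>"
  shows "legal_history G k (play \<sigma> \<rho> n)"
proof (induction n)
  case 0
  show ?case by (simp add: legal_history_Nil)
next
  case (Suc n)
  then show ?case
    using assms unfolding legal_cop_strategy_def legal_robber_strategy_def
    by (auto simp: Let_def intro!: legal_history_Cons)
qed

text \<open>A strategy that reads only the latest position suffices: the least bound within which
  capture can be forced drops in every round, so capture comes after finitely many rounds whatever
  the robber does.\<close>

lemma winning_cop_strategyI:
  assumes C0: "length C0 = k" "set C0 \<subseteq> pverts G"
    and win: "\<And>r. r \<in> pverts G \<Longrightarrow> cop_win G C0 r"
  shows "\<exists>\<sigma>. winning_cop_strategy G k \<sigma>"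
proof -
  define good where "good n C r C' \<longleftrightarrow> list_all2 (legal_move G) C C' \<and>
    (r \<in> set C' \<or> (\<exists>m<n. \<forall>r'. legal_move G r r' \<longrightarrow> captures_within G m C' r'))" for n C r C'
  \<comment> \<open>Outside the winning region the cops stay put, which keeps the strategy legal in
    every history. Inside it, the move is chosen for the least bound, so that the bound
    falls.\<close>
  define next_cops where "next_cops C r =
    (if cop_win G C r then SOME C'. good (LEAST n. captures_within G n C r) C r C' else C)" for C r
  define \<sigma> where "\<sigma> h = (case h of [] \<Rightarrow> C0 | (C, r) # _ \<Rightarrow> next_cops C r)" for h
  have good: "good (LEAST n. captures_within G n C r) C r (next_cops C r)" if "cop_win G C r" for C r
  proof -
    obtain n where n: "captures_within G n C r"
      using \<open>cop_win G C r\<close> unfolding cop_win_def by blast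
    have "\<exists>C'. good (LEAST n. captures_within G n C r) C r C'"
      unfolding good_def by (rule captures_within_move) (rule LeastI, rule n)
    then show ?thesis
      using that by (simp add: next_cops_def someI_ex)
  qed
  have "list_all2 (legal_move G) C (next_cops C r)" for C r
  proof (cases "cop_win G C r")
    case True
    then show ?thesis using good[of C r] by (simp add: good_def)
  next
    case False
    then show ?thesis by (simp add: next_cops_def list_all2_refl)
  qed
  then have "legal_cops G k h (\<sigma> h)" for h
    using C0 by (cases h) (auto simp: \<sigma>_def)
  then have legal: "legal_cop_strategy G k \<sigma>"
    by (simp add: legal_cop_strategy_def)
  have "cops_win \<sigma> \<rho>" if \<rho>: "legal_robber_strategy G k \<rho>" for \<rho>
  proof -
    \<comment> \<open>The bound \<open>n\<close> need not be the least one, whereas the move is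
      chosen for the least one; \<open>?n \<le> n\<close> and \<open>m < ?n\<close> together give
      the descent.\<close>
    have "cops_win \<sigma> \<rho>" if "captures_within G n C r" "play \<sigma> \<rho> i = (C, r) # h" for n C r i h
      using that
    proof (induction n arbitrary: C r i h rule: less_induct)
      case (less n)
      let ?n = "LEAST n. captures_within G n C r"
      let ?C = "next_cops C r"
      have le: "?n \<le> n"
        using less.prems(1) by (rule Least_le)
      have \<sigma>: "\<sigma> ((C, r) # h) = ?C"
        by (simp add: \<sigma>_def)
      have "good ?n C r ?C"
        using less.prems(1) by (intro good) (auto simp: cop_win_def)
      then consider "r \<in> set ?C"
        | m where "m < ?n" "\<And>r'. legal_move G r r' \<Longrightarrow> captures_within G m ?C r'"
        unfolding good_def by blast
      then show ?case
      proof cases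
        case 1
        then show ?thesis
          using less.prems(2) unfolding cops_win_def \<sigma>[symmetric] by blast
      next
        case 2
        let ?r = "\<rho> ((C, r) # h) ?C"
        have play: "play \<sigma> \<rho> (Suc i) = (?C, ?r) # (C, r) # h"
          using less.prems(2) \<sigma> by (simp add: Let_def)
        have "legal_history G k ((C, r) # h)"
          using legal_history_play[OF legal \<rho>, of i] less.prems(2) by simp
        then have "legal_robber G ((C, r) # h) ?r"
          using \<rho> legal \<sigma> unfolding legal_robber_strategy_def legal_cop_strategy_def by metis
        then have "captures_within G m ?C ?r"
          using 2 by simp
        then show ?thesis
          using less.IH play 2(1) le by (meson less_le_trans)
      qed
    qed
    note win_from = this
    let ?r = "\<rho> [] C0"
    have "?r \<in> pverts G"
      using \<rho> C0 legal_history_Nil[of G k] unfolding legal_robber_strategy_def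
      by (metis legal_cops.simps(1) legal_robber.simps(1))
    moreover have "play \<sigma> \<rho> (Suc 0) = [(C0, ?r)]"
      by (simp add: \<sigma>_def)
    ultimately show ?thesis
      using win win_from unfolding cop_win_def by blast
  qed
  then show ?thesis
    using legal unfolding winning_cop_strategy_def by blast
qed

text \<open>The invariant is that after each round no cop stands on the robber's vertex or next to
  it. It rules out capture at the end of the round and also by the following cop move, and the
  robber only has to restore it after that move.\<close>

lemma no_winning_cop_strategyI:
  fixes G :: "'a pair_pre_digraph"
  defines "safe C r \<equiv> \<forall>c\<in>set C. \<not> legal_move G c r"
  assumes place: "\<And>C. length C = k \<Longrightarrow> set C \<subseteq> pverts G \<Longrightarrow> \<exists>r\<in>pverts G. safe C r"
    and flee: "\<And>C C' r. length C = k \<Longrightarrow> set C \<subseteq> pverts G \<Longrightarrow> r \<in> pverts G \<Longrightarrow> safe C r \<Longrightarrow>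
      list_all2 (legal_move G) C C' \<Longrightarrow> \<exists>r'. legal_move G r r' \<and> safe C' r'"
    and closed: "\<And>u v. legal_move G u v \<Longrightarrow> u \<in> pverts G \<Longrightarrow> v \<in> pverts G"
  shows "\<not> winning_cop_strategy G k \<sigma>"
proof
  assume "winning_cop_strategy G k \<sigma>"
  then have \<sigma>: "legal_cop_strategy G k \<sigma>"
    and win: "\<And>\<rho>. legal_robber_strategy G k \<rho> \<Longrightarrow> cops_win \<sigma> \<rho>"
    unfolding winning_cop_strategy_def by auto
  \<comment> \<open>Legality is demanded in every legal history, including those in which no safe
    reply is left; there the robber stays put.\<close>
  define \<rho> where "\<rho> h C' = (case h of [] \<Rightarrow> (SOME r. r \<in> pverts G \<and> safe C' r)
    | (C, r) # _ \<Rightarrow> if \<exists>r'. legal_move G r r' \<and> safe C' r'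
        then SOME r'. legal_move G r r' \<and> safe C' r' else r)" for h :: "'a history" and C'
  have init: "\<rho> [] C' \<in> pverts G \<and> safe C' (\<rho> [] C')" if "length C' = k" "set C' \<subseteq> pverts G" for C'
    using someI_ex[OF place[OF that, unfolded Bex_def]] by (simp add: \<rho>_def)
  have step: "legal_move G r (\<rho> ((C, r) # h) C')" for C r h C'
    using someI_ex[of "\<lambda>r'. legal_move G r r' \<and> safe C' r'"] by (auto simp: \<rho>_def)
  have "legal_robber G h (\<rho> h C')" if "legal_cops G k h C'" for h C'
    using that init step by (cases h) auto
  then have \<rho>: "legal_robber_strategy G k \<rho>"
    by (simp add: legal_robber_strategy_def)
  have inv: "length C = k \<and> set C \<subseteq> pverts G \<and> r \<in> pverts G \<and> safe C r"
    if "play \<sigma> \<rho> n = (C, r) # h" for n C r h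
    using that
  proof (induction n arbitrary: C r h)
    case (Suc n)
    let ?h = "play \<sigma> \<rho> n"
    have C: "C = \<sigma> ?h" and r: "r = \<rho> ?h C" and "?h = h"
      using Suc.prems by (auto simp: Let_def)
    have legal: "legal_cops G k ?h C"
      using legal_history_play[OF \<sigma> \<rho>, of n] \<sigma> unfolding C legal_cop_strategy_def by blast
    show ?case
    proof (cases ?h)
      case Nil
      then show ?thesis using legal init r by simp
    next
      case (Cons p h')
      obtain C1 r1 where p: "p = (C1, r1)" by fastforce
      have move: "list_all2 (legal_move G) C1 C"
        using legal Cons p by simp
      have IH: "length C1 = k" "set C1 \<subseteq> pverts G" "r1 \<in> pverts G" "safe C1 r1"
        using Suc.IH Cons p by auto
      have ex: "\<exists>r'. legal_move G r1 r' \<and> safe C r'"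
        using flee IH move by blast
      have "legal_move G r1 r \<and> safe C r"
        using someI_ex[OF ex] ex Cons p by (simp add: r \<rho>_def)
      moreover have "length C = k"
        using IH(1) move by (simp add: list_all2_lengthD)
      moreover have "set C \<subseteq> pverts G"
      proof
        fix c assume "c \<in> set C"
        then obtain i where "i < length C" "c = C ! i" by (auto simp: in_set_conv_nth)
        then have "legal_move G (C1 ! i) c" "C1 ! i \<in> set C1"
          using move by (auto simp: list_all2_conv_all_nth)
        then show "c \<in> pverts G" using closed IH(2) by blast
      qed
      ultimately show ?thesis using IH(3) closed by blast
    qed
  qed simp
  obtain n C r h where play: "play \<sigma> \<rho> n = (C, r) # h"
    and capt: "r \<in> set C \<or> r \<in> set (\<sigma> ((C, r) # h))"
    using win[OF \<rho>] unfolding cops_win_def by blast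
  have "legal_history G k ((C, r) # h)"
    using legal_history_play[OF \<sigma> \<rho>, of n] play by simp
  then have "list_all2 (legal_move G) C (\<sigma> ((C, r) # h))"
    using \<sigma> unfolding legal_cop_strategy_def by fastforce
  \<comment> \<open>Both clauses of \<open>cops_win\<close> violate the same invariant: a cop
    already on the robber's vertex reaches it by staying put, and a cop that arrives there next
    reaches it by its move.\<close>
  then have "\<exists>c\<in>set C. legal_move G c r"
    using capt by (elim disjE) (blast intro: legal_move_refl, metis in_set_conv_nth list_all2_conv_all_nth)
  then show False
    using inv[OF play] by (simp add: safe_def)
qed

section \<open>Partial graphs on ten labelled vertices\<close>

text \<open>A fixed type of ten vertices turns partial graphs into closed terms that can be
  evaluated once and for all; an actual graph enters only through a bijection from the labels to its
  vertices.\<close>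

datatype label = a | b | c | d | e | f | g | h | i | j

definition labels :: "label list" where
  "labels = [a, b, c, d, e, f, g, h, i, j]"

lemma set_labels: "set labels = UNIV"
proof -
  have "x \<in> set labels" for x
    by (cases x) (simp_all add: labels_def)
  then show ?thesis by blast
qed

lemma distinct_labels: "distinct labels"
  by (simp add: labels_def)

lemma length_labels: "length labels = 10"
  by (simp add: labels_def)

instance label :: finite
  by standard (metis List.finite_set set_labels)

lemma card_label: "card (UNIV :: label set) = 10"
  using distinct_card[OF distinct_labels] by (simp add: set_labels length_labels)

lemma all_label: "(\<forall>x. P x) \<longleftrightarrow> list_all P labels"
  by (metis UNIV_I list.pred_set set_labels)

text \<open>A constructor with ten arguments makes reading and writing an entry a single pattern
  match, which keeps the evaluation of the certificates by rewriting short. Nesting it gives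
  matrices and tables with several indices.\<close>

datatype 'x vec = Vec 'x 'x 'x 'x 'x 'x 'x 'x 'x 'x

fun get :: "'x vec \<Rightarrow> label \<Rightarrow> 'x" where
  "get (Vec p _ _ _ _ _ _ _ _ _) a = p"
| "get (Vec _ p _ _ _ _ _ _ _ _) b = p"
| "get (Vec _ _ p _ _ _ _ _ _ _) c = p"
| "get (Vec _ _ _ p _ _ _ _ _ _) d = p"
| "get (Vec _ _ _ _ p _ _ _ _ _) e = p"
| "get (Vec _ _ _ _ _ p _ _ _ _) f = p"
| "get (Vec _ _ _ _ _ _ p _ _ _) g = p"
| "get (Vec _ _ _ _ _ _ _ p _ _) h = p"
| "get (Vec _ _ _ _ _ _ _ _ p _) i = p"
| "get (Vec _ _ _ _ _ _ _ _ _ p) j = p"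

fun upd :: "'x vec \<Rightarrow> label \<Rightarrow> 'x \<Rightarrow> 'x vec" where
  "upd (Vec p0 p1 p2 p3 p4 p5 p6 p7 p8 p9) a y =
    Vec y p1 p2 p3 p4 p5 p6 p7 p8 p9"
| "upd (Vec p0 p1 p2 p3 p4 p5 p6 p7 p8 p9) b y =
    Vec p0 y p2 p3 p4 p5 p6 p7 p8 p9"
| "upd (Vec p0 p1 p2 p3 p4 p5 p6 p7 p8 p9) c y =
    Vec p0 p1 y p3 p4 p5 p6 p7 p8 p9"
| "upd (Vec p0 p1 p2 p3 p4 p5 p6 p7 p8 p9) d y =
    Vec p0 p1 p2 y p4 p5 p6 p7 p8 p9"
| "upd (Vec p0 p1 p2 p3 p4 p5 p6 p7 p8 p9) e y =
    Vec p0 p1 p2 p3 y p5 p6 p7 p8 p9"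
| "upd (Vec p0 p1 p2 p3 p4 p5 p6 p7 p8 p9) f y =
    Vec p0 p1 p2 p3 p4 y p6 p7 p8 p9"
| "upd (Vec p0 p1 p2 p3 p4 p5 p6 p7 p8 p9) g y =
    Vec p0 p1 p2 p3 p4 p5 y p7 p8 p9"
| "upd (Vec p0 p1 p2 p3 p4 p5 p6 p7 p8 p9) h y =
    Vec p0 p1 p2 p3 p4 p5 p6 y p8 p9"
| "upd (Vec p0 p1 p2 p3 p4 p5 p6 p7 p8 p9) i y =
    Vec p0 p1 p2 p3 p4 p5 p6 p7 y p9"
| "upd (Vec p0 p1 p2 p3 p4 p5 p6 p7 p8 p9) j y =
    Vec p0 p1 p2 p3 p4 p5 p6 p7 p8 y"

definition const_vec :: "'x \<Rightarrow> 'x vec" where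
  "const_vec y = Vec y y y y y y y y y y"

fun zip_vec :: "('x \<Rightarrow> 'y \<Rightarrow> 'z) \<Rightarrow> 'x vec \<Rightarrow> 'y vec \<Rightarrow> 'z vec" where
  "zip_vec F (Vec p0 p1 p2 p3 p4 p5 p6 p7 p8 p9)
    (Vec q0 q1 q2 q3 q4 q5 q6 q7 q8 q9) =
    Vec (F p0 q0) (F p1 q1) (F p2 q2) (F p3 q3) (F p4 q4) (F p5 q5) (F p6 q6) (F p7 q7) (F p8 q8) (F p9 q9)"

fun all_vec :: "bool vec \<Rightarrow> bool" where
  "all_vec (Vec p0 p1 p2 p3 p4 p5 p6 p7 p8 p9) \<longleftrightarrow>
    p0 \<and> p1 \<and> p2 \<and> p3 \<and> p4 \<and> p5 \<and> p6 \<and> p7 \<and> p8 \<and> p9"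

fun subset_vec :: "bool vec \<Rightarrow> bool vec \<Rightarrow> bool" where
  "subset_vec (Vec p0 p1 p2 p3 p4 p5 p6 p7 p8 p9)
    (Vec q0 q1 q2 q3 q4 q5 q6 q7 q8 q9) \<longleftrightarrow>
    (p0 \<longrightarrow> q0) \<and> (p1 \<longrightarrow> q1) \<and> (p2 \<longrightarrow> q2) \<and> (p3 \<longrightarrow> q3) \<and> (p4 \<longrightarrow> q4) \<and>
    (p5 \<longrightarrow> q5) \<and> (p6 \<longrightarrow> q6) \<and> (p7 \<longrightarrow> q7) \<and> (p8 \<longrightarrow> q8) \<and> (p9 \<longrightarrow> q9)"

fun union_vec :: "bool vec \<Rightarrow> bool vec \<Rightarrow> bool vec" where
  "union_vec (Vec p0 p1 p2 p3 p4 p5 p6 p7 p8 p9)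
    (Vec q0 q1 q2 q3 q4 q5 q6 q7 q8 q9) =
    Vec (p0 \<or> q0) (p1 \<or> q1) (p2 \<or> q2) (p3 \<or> q3) (p4 \<or> q4)
    (p5 \<or> q5) (p6 \<or> q6) (p7 \<or> q7) (p8 \<or> q8) (p9 \<or> q9)"

lemma get_upd [simp]: "get (upd p x y) z = (if z = x then y else get p z)"
  by (cases p; cases x; cases z; simp)

lemma get_const_vec [simp]: "get (const_vec y) x = y"
  by (cases x) (simp_all add: const_vec_def)

lemma get_zip_vec [simp]: "get (zip_vec F p q) x = F (get p x) (get q x)"
  by (cases p; cases q; cases x; simp)

lemma get_map_vec [simp]: "get (map_vec F p) x = F (get p x)"
  by (cases p; cases x; simp)

lemma all_vec_iff: "all_vec p \<longleftrightarrow> (\<forall>x. get p x)"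
  by (cases p) (simp add: all_label labels_def)

lemma subset_vec_iff: "subset_vec p q \<longleftrightarrow> (\<forall>x. get p x \<longrightarrow> get q x)"
  by (cases p; cases q) (simp add: all_label labels_def)

lemma get_union_vec [simp]: "get (union_vec p q) x \<longleftrightarrow> get p x \<or> get q x"
  by (cases p; cases q; cases x; simp)

definition indicator_vec :: "label list \<Rightarrow> bool vec" where
  "indicator_vec xs = fold (\<lambda>x p. upd p x True) xs (const_vec False)"

lemma get_indicator_vec: "get (indicator_vec xs) x \<longleftrightarrow> x \<in> set xs"
proof -
  have "get (fold (\<lambda>x p. upd p x True) xs p) x \<longleftrightarrow> x \<in> set xs \<or> get p x" for p
    by (induction xs arbitrary: p) auto
  then show ?thesis by (simp add: indicator_vec_def)
qed

definition count_vec :: "bool vec \<Rightarrow> nat" where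
  "count_vec p = length (filter (get p) labels)"

lemma count_vec: "count_vec p = card {x. get p x}"
  using distinct_card[OF distinct_filter[OF distinct_labels, of "get p"]]
  by (simp add: count_vec_def set_labels)

text \<open>
  A partial graph consists of two matrices of closed neighbourhoods: the first one records the
  pairs known to be adjacent, the second one the pairs not known to be non-adjacent.
\<close>

type_synonym matrix = "bool vec vec"
type_synonym partial_graph = "matrix \<times> matrix"

definition entry :: "'x vec vec \<Rightarrow> label \<Rightarrow> label \<Rightarrow> 'x" where
  "entry m x y = get (get m x) y"

definition set_entry :: "label \<Rightarrow> label \<Rightarrow> 'x \<Rightarrow> 'x vec vec \<Rightarrow> 'x vec vec" where
  "set_entry x y z m = upd m x (upd (get m x) y z)"

text \<open>Writing both orders serves two purposes: adjacency is symmetric, and so is the pair of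
  cops. For the latter an entry is itself a vector of robber positions, hence the general entry
  type.\<close>

definition set_entries :: "label \<Rightarrow> label \<Rightarrow> 'x \<Rightarrow> 'x vec vec \<Rightarrow> 'x vec vec" where
  "set_entries x y z m = set_entry x y z (set_entry y x z m)"

lemma entry_set_entries:
  "entry (set_entries x y z m) v w = (if (v, w) = (x, y) \<or> (v, w) = (y, x) then z else entry m v w)"
  by (auto simp: entry_def set_entries_def set_entry_def)

text \<open>When \<open>n\<close> bounds the degrees, a vertex with \<open>n\<close> known neighbours has no others.\<close>

fun saturate :: "nat \<Rightarrow> label \<Rightarrow> partial_graph \<Rightarrow> partial_graph" where
  "saturate n x (s, m) = (if count_vec (get s x) = Suc n
    then (s, upd (zip_vec (\<lambda>p t. upd p x t) m (get s x)) x (get s x)) else (s, m))"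

text \<open>A new edge gives only its two ends a further known neighbour, so only these are tested
  for saturation. The second matrix changes through saturation alone, as an undecided pair already
  holds \<open>True\<close> there.\<close>

fun join :: "nat \<Rightarrow> label \<Rightarrow> label \<Rightarrow> partial_graph \<Rightarrow> partial_graph" where
  "join n x y (s, m) = saturate n x (saturate n y (set_entries x y True s, m))"

fun separate :: "label \<Rightarrow> label \<Rightarrow> partial_graph \<Rightarrow> partial_graph" where
  "separate x y (s, m) = (s, set_entries x y False m)"

declare saturate.simps [simp del] join.simps [simp del] separate.simps [simp del]

text \<open>The neighbourhoods are closed, so the diagonal of the first matrix is known from the
  start.\<close>

definition unknown_graph :: partial_graph where
  "unknown_graph = (
    Vec (upd (const_vec False) a True) (upd (const_vec False) b True) (upd (const_vec False) c True)
    (upd (const_vec False) d True) (upd (const_vec False) e True) (upd (const_vec False) f True) (upd (const_vec False) g True) (upd (const_vec False) h True) (upd (const_vec False) i True) (upd (const_vec False) j True),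
    const_vec (const_vec True))"

text \<open>An entry \<open>(x, ys, zs)\<close> says that \<open>x\<close> is adjacent to all of \<open>ys\<close> and to none of \<open>zs\<close>.\<close>

type_synonym pattern = "(label \<times> label list \<times> label list) list"

text \<open>The degree bound enters through \<open>join\<close>: the same pattern stands for a more
  decided partial graph when the bound is smaller.\<close>

definition graph_of_pattern :: "nat \<Rightarrow> pattern \<Rightarrow> partial_graph" where
  "graph_of_pattern n P =
    fold (\<lambda>(x, ys, zs) K. fold (separate x) zs (fold (join n x) ys K)) P unknown_graph"

text \<open>
  A certificate refutes a partial graph. \<open>Split\<close> distinguishes whether two vertices are adjacent,
  \<open>Cut\<close> names a union of components, \<open>Ref\<close> embeds a pattern refuted earlier, stored in the
  table under a three-digit key, and \<open>Win\<close> lists moves of the two cops after each of which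
  the robber is in a position already known to be lost. In the latter the cops use only edges known
  to be present, whereas the robber may use every edge not known to be absent, so that the
  outcome does not depend on the undecided pairs.
\<close>

datatype certificate =
    Split label label certificate certificate
  | Cut "label list"
  | Ref label label label "label vec"
  | Win "(label \<times> label \<times> label \<times> label) list"

type_synonym table = "pattern vec vec vec"

section \<open>Checking certificates\<close>

definition lost :: "matrix \<Rightarrow> matrix vec \<Rightarrow> label \<Rightarrow> label \<Rightarrow> bool vec" where
  "lost s W x y = union_vec (get s x) (union_vec (get s y) (entry W x y))"

text \<open>Here it is the robber's turn, and his options are overestimated by the second matrix. As
  its rows are meant as closed neighbourhoods, staying put is among the moves that have to lead into
  \<open>p\<close>.\<close>

definition trapped :: "matrix \<Rightarrow> bool vec \<Rightarrow> bool vec" where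
  "trapped m p = map_vec (\<lambda>q. subset_vec q p) m"

text \<open>Backward induction in the order dictated by the certificate: each listed cop move adds
  to \<open>W\<close> the robber vertices from which every reply is already lost. The pair carried
  along is the source of the latest move; at the end of the list it is the initial placement of the
  cops, from which every robber vertex must be lost.\<close>

fun check_win ::
    "matrix \<Rightarrow> matrix \<Rightarrow> matrix vec \<Rightarrow> label \<Rightarrow> label \<Rightarrow> (label \<times> label \<times> label \<times> label) list \<Rightarrow> bool" where
  "check_win s m W x y [] \<longleftrightarrow> all_vec (lost s W x y)"
| "check_win s m W _ _ ((x, y, x', y') # ms) \<longleftrightarrow> entry s x x' \<and> entry s y y' \<and>
    check_win s m
      (set_entries x y (union_vec (entry W x y) (trapped m (lost s W x' y'))) W) x y ms"

text \<open>The vector \<pi> sends the labels of the pattern to labels of the partial graph. Only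
  surjectivity is tested, which on ten labels amounts to being a permutation.\<close>

fun check_embedding :: "partial_graph \<Rightarrow> label vec \<Rightarrow> pattern \<Rightarrow> bool" where
  "check_embedding (s, m) \<pi> P \<longleftrightarrow> all_vec (indicator_vec (map (get \<pi>) labels)) \<and>
    list_all (\<lambda>(x, ys, zs). list_all (\<lambda>y. entry s (get \<pi> x) (get \<pi> y)) ys \<and>
      list_all (\<lambda>z. \<not> entry m (get \<pi> x) (get \<pi> z)) zs) P"

definition check_cut :: "matrix \<Rightarrow> label list \<Rightarrow> bool vec \<Rightarrow> bool" where
  "check_cut m xs p \<longleftrightarrow> xs \<noteq> [] \<and> \<not> all_vec p \<and> list_all (\<lambda>x. subset_vec (get m x) p) xs"

text \<open>For \<open>Win\<close> the table of lost positions starts empty; the two cops on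
  \<open>a\<close> are a placeholder that the first listed move replaces.\<close>

fun check :: "nat \<Rightarrow> table \<Rightarrow> partial_graph \<Rightarrow> certificate \<Rightarrow> bool" where
  "check n T K (Split x y c1 c2) \<longleftrightarrow> check n T (join n x y K) c1 \<and> check n T (separate x y K) c2"
| "check n T K (Cut xs) \<longleftrightarrow> check_cut (snd K) xs (indicator_vec xs)"
| "check n T K (Ref x y z \<pi>) \<longleftrightarrow> check_embedding K \<pi> (entry (get T x) y z)"
| "check n T K (Win ms) \<longleftrightarrow> check_win (fst K) (snd K) (const_vec (const_vec (const_vec False))) a a ms"

type_synonym refutation = "(label \<times> label \<times> label) \<times> pattern \<times> certificate"

text \<open>Keys may be reused: an entry is only ever replaced by another refuted pattern. The list
  for degree bound 2 starts again with the key \<open>(a,a,b)\<close>.\<close>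

fun store :: "refutation \<Rightarrow> table \<Rightarrow> table" where
  "store ((x, y, z), P, _) T = upd T x (set_entry y z P (get T x))"

text \<open>A pattern enters the table only after its own certificate has been checked, which
  excludes circular references.\<close>

fun check_all :: "nat \<Rightarrow> table \<Rightarrow> refutation list \<Rightarrow> bool" where
  "check_all n T [] \<longleftrightarrow> True"
| "check_all n T (((x, y, z), P, cert) # rs) \<longleftrightarrow> check n T (graph_of_pattern n P) cert \<and>
    check_all n (store ((x, y, z), P, cert) T) rs"

section \<open>Soundness of the certificates\<close>

definition labelling :: "'a pair_pre_digraph \<Rightarrow> (label \<Rightarrow> 'a) \<Rightarrow> bool" where
  "labelling G \<phi> \<longleftrightarrow> bij_betw \<phi> UNIV (pverts G)"

definition matches :: "'a pair_pre_digraph \<Rightarrow> (label \<Rightarrow> 'a) \<Rightarrow> pattern \<Rightarrow> bool" where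
  "matches G \<phi> P \<longleftrightarrow> (\<forall>(x, ys, zs) \<in> set P.
    (\<forall>y\<in>set ys. legal_move G (\<phi> x) (\<phi> y)) \<and> (\<forall>z\<in>set zs. \<not> legal_move G (\<phi> x) (\<phi> z)))"

text \<open>Ranging over all labellings makes this invariant under permutations of the labels, which
  is what allows a refuted pattern to be reused in any relabelled position.\<close>

definition refuted :: "'a pair_pre_digraph \<Rightarrow> pattern \<Rightarrow> bool" where
  "refuted G P \<longleftrightarrow> (\<forall>\<phi>. labelling G \<phi> \<longrightarrow> \<not> matches G \<phi> P)"

definition fits :: "'a pair_pre_digraph \<Rightarrow> (label \<Rightarrow> 'a) \<Rightarrow> partial_graph \<Rightarrow> bool" where
  "fits G \<phi> K \<longleftrightarrow> (\<forall>x y. (entry (fst K) x y \<longrightarrow> legal_move G (\<phi> x) (\<phi> y)) \<and>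
    (legal_move G (\<phi> x) (\<phi> y) \<longrightarrow> entry (snd K) x y))"

text \<open>The successor accounts for \<open>v\<close> itself. The quantifier covers the whole
  type; in a pair graph an element outside the vertex set can only stay where it is.\<close>

definition degrees_le :: "'a pair_pre_digraph \<Rightarrow> nat \<Rightarrow> bool" where
  "degrees_le G n \<longleftrightarrow> (\<forall>v. card {w. legal_move G v w} \<le> Suc n)"

text \<open>Keys that were never stored are included, so the initial filling of the table must
  itself be a refuted pattern. This is where the Petersen graph is inserted.\<close>

definition refuted_table :: "'a pair_pre_digraph \<Rightarrow> table \<Rightarrow> bool" where
  "refuted_table G T \<longleftrightarrow> (\<forall>x y z. refuted G (entry (get T x) y z))"

text \<open>The list of non-neighbours is empty on purpose: the pattern is then matched around every
  vertex of degree at least \<open>n\<close>, not only of degree exactly \<open>n\<close>.\<close>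

definition star :: "nat \<Rightarrow> pattern" where
  "star n = [(a, take n (tl labels), [])]"

text \<open>The cops are interchangeable. This justifies recording each lost position for both
  orders of the two cops.\<close>

lemma captures_within_swap:
  "captures_within G n [u, v] r \<Longrightarrow> captures_within G n [v, u] r"
proof (induction n arbitrary: u v r)
  case 0
  then obtain u' v' where "legal_move G u u'" "legal_move G v v'" "r \<in> {u', v'}"
    by (auto simp: list_all2_Cons1)
  then have "list_all2 (legal_move G) [v, u] [v', u'] \<and> r \<in> set [v', u']"
    by auto
  then show ?case unfolding captures_within.simps by blast
next
  case (Suc n)
  show ?case
  proof (cases "captures_within G n [u, v] r")
    case False
    then obtain u' v' where "legal_move G u u'" "legal_move G v v'"
      and "\<And>r'. legal_move G r r' \<Longrightarrow> captures_within G n [u', v'] r'"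
      using Suc.prems by (auto simp: list_all2_Cons1)
    then have "list_all2 (legal_move G) [v, u] [v', u'] \<and>
        (\<forall>r'. legal_move G r r' \<longrightarrow> captures_within G n [v', u'] r')"
      using Suc.IH by simp
    then show ?thesis unfolding captures_within.simps by blast
  qed (use Suc.IH in simp)
qed

lemma cop_win_swap: "cop_win G [u, v] r \<Longrightarrow> cop_win G [v, u] r"
  unfolding cop_win_def using captures_within_swap by metis

text \<open>Any choice of distinct vertices can be named by the first labels and completed
  arbitrarily. It will be applied to a vertex followed by some of its neighbours, and to the empty
  list.\<close>

lemma labelling_exists:
  assumes "finite (pverts G)" "card (pverts G) = 10" "distinct xs" "set xs \<subseteq> pverts G"
  obtains \<phi> where "labelling G \<phi>" "map \<phi> (take (length xs) labels) = xs"
proof -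
  obtain ys where ys: "set ys = pverts G - set xs" "distinct ys"
    using assms(1) finite_distinct_list by (metis finite_Diff)
  define zs where "zs = xs @ ys"
  have zs: "distinct zs" "set zs = pverts G"
    using assms ys by (auto simp: zs_def)
  then have len: "length zs = 10"
    using assms(2) distinct_card by metis
  define \<phi> where "\<phi> x = zs ! (THE i. i < 10 \<and> labels ! i = x)" for x
  have nth: "\<phi> (labels ! i) = zs ! i" if "i < 10" for i
  proof -
    have "(THE k. k < 10 \<and> labels ! k = labels ! i) = i"
      using that distinct_labels length_labels by (intro the_equality) (auto simp: nth_eq_iff_index_eq)
    then show ?thesis by (simp add: \<phi>_def)
  qed
  have map: "map \<phi> labels = zs"
    by (rule nth_equalityI) (auto simp: length_labels len nth)
  then have "\<phi> ` UNIV = pverts G"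
    using zs(2) by (metis list.set_map set_labels)
  moreover have "inj \<phi>"
    using map zs(1) by (metis distinct_map set_labels)
  ultimately have "labelling G \<phi>"
    by (simp add: labelling_def bij_betw_def)
  moreover have "map \<phi> (take (length xs) labels) = xs"
    using map by (simp add: zs_def flip: take_map)
  ultimately show thesis by (rule that)
qed

section \<open>Soundness in a connected graph on which two cops do not win\<close>

locale evasive_graph = pair_graph +
  assumes connected: "Digraph_Component.connected (with_proj G)"
    and evasive: "\<not> winning_cop_strategy G 2 \<sigma>"
begin

context
  fixes \<phi>
  assumes \<phi>: "labelling G \<phi>"
begin

lemma \<phi>_in_verts: "\<phi> x \<in> pverts G"
  using \<phi> by (auto simp: labelling_def bij_betw_def)

lemma \<phi>_surj: "v \<in> pverts G \<Longrightarrow> \<exists>x. v = \<phi> x"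
  using \<phi> by (auto simp: labelling_def bij_betw_def)

lemma \<phi>_inj: "inj \<phi>"
  using \<phi> by (simp add: labelling_def bij_betw_def)

text \<open>The known closed neighbours of the vertex number \<open>Suc n\<close>, and the degree
  bound admits no more; by counting, they are all of its closed neighbours. Row and column of the
  second matrix may therefore be cut down to them.\<close>

lemma fits_saturate:
  assumes "fits G \<phi> K" and deg: "degrees_le G n"
  shows "fits G \<phi> (saturate n x K)"
proof -
  obtain s m where K: "K = (s, m)" by (cases K)
  show ?thesis
  proof (cases "count_vec (get s x) = Suc n")
    case True
    let ?Y = "{y. get (get s x) y}"
    have sub: "\<phi> ` ?Y \<subseteq> {w. legal_move G (\<phi> x) w}"
      using assms(1) by (auto simp: fits_def K entry_def)
    have "card (\<phi> ` ?Y) = Suc n"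
      using True by (simp add: card_image inj_on_subset[OF \<phi>_inj] count_vec)
    then have "\<phi> ` ?Y = {w. legal_move G (\<phi> x) w}"
      using sub deg finite_legal_moves[of "\<phi> x"]
      by (metis card_seteq degrees_le_def)
    then have "legal_move G (\<phi> x) (\<phi> y) \<Longrightarrow> get (get s x) y" for y
      using \<phi>_inj by (metis imageE inj_eq mem_Collect_eq)
    then show ?thesis
      using assms(1) True legal_move_sym by (auto simp: fits_def K saturate.simps entry_def)
  qed (use assms(1) K in \<open>simp add: saturate.simps\<close>)
qed

lemma fits_join:
  assumes "fits G \<phi> K" "legal_move G (\<phi> x) (\<phi> y)" "degrees_le G n"
  shows "fits G \<phi> (join n x y K)"
proof -
  obtain s m where K: "K = (s, m)" by (cases K)
  have "fits G \<phi> (set_entries x y True s, m)"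
    using assms(1,2) legal_move_sym by (auto simp: fits_def K entry_set_entries)
  then show ?thesis
    using assms(3) by (simp add: K join.simps fits_saturate)
qed

lemma fits_separate:
  assumes "fits G \<phi> K" "\<not> legal_move G (\<phi> x) (\<phi> y)"
  shows "fits G \<phi> (separate x y K)"
  using assms legal_move_sym by (cases K) (auto simp: fits_def separate.simps entry_set_entries)

lemma fits_unknown_graph: "fits G \<phi> unknown_graph"
proof -
  have "entry (fst unknown_graph) x y \<longleftrightarrow> x = y" for x y
    by (cases x) (simp_all add: unknown_graph_def entry_def)
  moreover have "entry (snd unknown_graph) x y" for x y
    by (simp add: unknown_graph_def entry_def)
  ultimately show ?thesis by (simp add: fits_def)
qed

lemma fits_graph_of_pattern:
  assumes "matches G \<phi> P" "degrees_le G n"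
  shows "fits G \<phi> (graph_of_pattern n P)"
proof -
  have join: "fits G \<phi> (fold (join n x) ys K)"
    if "fits G \<phi> K" "\<forall>y\<in>set ys. legal_move G (\<phi> x) (\<phi> y)" for K x ys
    using that by (induction ys arbitrary: K) (simp_all add: fits_join assms(2))
  have separate: "fits G \<phi> (fold (separate x) zs K)"
    if "fits G \<phi> K" "\<forall>z\<in>set zs. \<not> legal_move G (\<phi> x) (\<phi> z)" for K x zs
    using that by (induction zs arbitrary: K) (simp_all add: fits_separate)
  have "fits G \<phi> (fold (\<lambda>(x, ys, zs) K. fold (separate x) zs (fold (join n x) ys K)) P K)"
    if "fits G \<phi> K" for K
    using that assms(1)
    by (induction P arbitrary: K)
      (simp_all add: matches_def join separate case_prod_beta)
  then show ?thesis
    using fits_unknown_graph by (simp add: graph_of_pattern_def)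
qed

lemma cop_win_lost:
  assumes "fits G \<phi> (s, m)" "\<And>x y z. get (entry W x y) z \<Longrightarrow> cop_win G [\<phi> x, \<phi> y] (\<phi> z)"
    "get (lost s W x y) z"
  shows "cop_win G [\<phi> x, \<phi> y] (\<phi> z)"
proof -
  consider "legal_move G (\<phi> x) (\<phi> z)" | "legal_move G (\<phi> y) (\<phi> z)" | "get (entry W x y) z"
    using assms(1,3) by (auto simp: lost_def fits_def entry_def)
  then show ?thesis
  proof cases
    case 1
    then show ?thesis by (intro cop_win_catch[where C' = "[\<phi> z, \<phi> y]"]) auto
  next
    case 2
    then show ?thesis by (intro cop_win_catch[where C' = "[\<phi> x, \<phi> z]"]) auto
  next
    case 3
    then show ?thesis by (rule assms(2))
  qed
qed

text \<open>Every position recorded in \<open>W\<close> is a genuine win for the cops in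
  \<open>G\<close>. This invariant survives each listed move, so a successful check would give two
  cops a winning placement, which \<open>evasive\<close> forbids.\<close>

lemma check_win_sound:
  assumes fits: "fits G \<phi> (s, m)"
    and "\<And>x y z. get (entry W x y) z \<Longrightarrow> cop_win G [\<phi> x, \<phi> y] (\<phi> z)"
  shows "\<not> check_win s m W x y ms"
  using assms(2)
proof (induction ms arbitrary: W x y)
  case Nil
  show ?case
  proof
    assume "check_win s m W x y []"
    then have "cop_win G [\<phi> x, \<phi> y] (\<phi> z)" for z
      using cop_win_lost[OF fits] Nil by (metis all_vec_iff check_win.simps(1))
    then have "\<exists>\<sigma>. winning_cop_strategy G 2 \<sigma>"
      using \<phi>_surj by (intro winning_cop_strategyI[where ?C0.0 = "[\<phi> x, \<phi> y]"])
        (auto simp: \<phi>_in_verts)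
    then show False using evasive by blast
  qed
next
  case (Cons mv ms)
  obtain x1 y1 x2 y2 where mv: "mv = (x1, y1, x2, y2)" by (cases mv)
  let ?W = "set_entries x1 y1 (union_vec (entry W x1 y1) (trapped m (lost s W x2 y2))) W"
  show ?case
  proof
    assume check: "check_win s m W x y (mv # ms)"
    have moves: "list_all2 (legal_move G) [\<phi> x1, \<phi> y1] [\<phi> x2, \<phi> y2]"
      using check fits by (auto simp: mv fits_def)
    \<comment> \<open>The cops' move uses a known edge and hence exists in \<open>G\<close>; the
      robber's move in \<open>G\<close> is among the possible ones and hence stays inside the lost
      set.\<close>
    have trapped: "cop_win G [\<phi> x1, \<phi> y1] (\<phi> z)" if "get (trapped m (lost s W x2 y2)) z" for z
    proof (rule cop_win_step[OF moves])
      fix r assume r: "legal_move G (\<phi> z) r"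
      then obtain z' where z': "r = \<phi> z'"
        using \<phi>_surj \<phi>_in_verts legal_move_in_verts by blast
      then have "get (lost s W x2 y2) z'"
        using that fits r by (auto simp: trapped_def subset_vec_iff fits_def entry_def)
      then show "cop_win G [\<phi> x2, \<phi> y2] r"
        unfolding z' using Cons.prems cop_win_lost[OF fits] by blast
    qed
    have "cop_win G [\<phi> v, \<phi> w] (\<phi> z)" if "get (entry ?W v w) z" for v w z
      using that
      by (auto simp: entry_set_entries split: if_splits intro: Cons.prems trapped cop_win_swap)
    then have "\<not> check_win s m ?W x1 y1 ms"
      by (rule Cons.IH)
    then show False
      using check by (simp add: mv)
  qed
qed

text \<open>The set \<open>xs\<close> is closed even under edges that are merely possible, so no
  path of \<open>G\<close> leaves it, although it is neither empty nor everything.\<close>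

lemma check_cut_sound:
  assumes "fits G \<phi> (s, m)"
  shows "\<not> check_cut m xs (indicator_vec xs)"
proof
  assume cut: "check_cut m xs (indicator_vec xs)"
  then have closed: "y \<in> set xs" if "x \<in> set xs" "legal_move G (\<phi> x) (\<phi> y)" for x y
    using that assms
    by (auto simp: check_cut_def list_all_iff subset_vec_iff get_indicator_vec fits_def entry_def)
  obtain x y where x: "x \<in> set xs" and y: "y \<notin> set xs"
    using cut unfolding check_cut_def all_vec_iff get_indicator_vec
    by (metis last_in_set)
  have "(\<phi> x, \<phi> y) \<in> rtrancl_on (pverts G) ((parcs G)\<^sup>s)"
    using connected \<phi>_in_verts by (auto simp: connected_conv)
  then have "\<phi> y \<in> \<phi> ` set xs"
  proof (induction rule: rtrancl_on_induct)
    case (step v w)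
    then obtain z where z: "w = \<phi> z" using \<phi>_surj by blast
    obtain z' where z': "z' \<in> set xs" "v = \<phi> z'" using step by blast
    have "legal_move G v w"
      using step.hyps arcs_symmetric by (auto simp: legal_move_def symcl_def)
    then show ?case using closed z z' by blast
  qed (use x in simp)
  then show False
    using y \<phi>_inj by (auto dest: injD)
qed

end

text \<open>Composing the labelling with the permutation \<pi> gives another labelling of the same
  graph, and this one matches the refuted pattern.\<close>

lemma check_embedding_sound:
  assumes \<phi>: "labelling G \<phi>" and fits: "fits G \<phi> (s, m)" and P: "refuted G P"
  shows "\<not> check_embedding (s, m) \<pi> P"
proof
  assume check: "check_embedding (s, m) \<pi> P"
  then have "x \<in> range (get \<pi>)" for x
    by (auto simp: all_vec_iff get_indicator_vec set_labels)
  then have "surj (get \<pi>)" by blast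
  then have "bij (get \<pi>)"
    by (simp add: bij_def finite_UNIV_surj_inj)
  then have "labelling G (\<phi> \<circ> get \<pi>)"
    using \<phi> unfolding labelling_def by (rule bij_betw_trans)
  moreover have "matches G (\<phi> \<circ> get \<pi>) P"
    using check fits by (fastforce simp: matches_def list_all_iff fits_def)
  ultimately show False
    using P unfolding refuted_def by blast
qed

lemma check_sound:
  assumes "labelling G \<phi>" "degrees_le G n" "refuted_table G T" "fits G \<phi> K"
  shows "\<not> check n T K cert"
  using assms(4)
proof (induction cert arbitrary: K)
  case (Split x y c1 c2)
  then show ?case
    using fits_join[OF assms(1) Split.prems _ assms(2)] fits_separate[OF assms(1) Split.prems]
    by (metis check.simps(1))
next
  case (Cut xs)
  then show ?case using check_cut_sound[OF assms(1)] by (cases K) simp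
next
  case (Ref x y z \<pi>)
  then show ?case
    using check_embedding_sound[OF assms(1)] assms(3) by (cases K) (simp add: refuted_table_def)
next
  case (Win ms)
  have "\<not> check_win (fst K) (snd K) (const_vec (const_vec (const_vec False))) a a ms"
    by (rule check_win_sound[OF assms(1)]) (simp_all add: Win entry_def)
  then show ?case by simp
qed

text \<open>Being refuted is a property of \<open>G\<close> and does not mention the bound
  \<open>n\<close> used to establish it, so the resulting table remains valid at the next, smaller
  bound.\<close>

lemma check_all_sound:
  assumes "degrees_le G n \<and> refuted_table G T" "check_all n T rs"
  shows "refuted_table G (fold store rs T)" and "q \<in> set rs \<Longrightarrow> refuted G (fst (snd q))"
proof -
  have "refuted_table G (fold store rs T) \<and> (\<forall>q\<in>set rs. refuted G (fst (snd q)))"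
    using assms
  proof (induction rs arbitrary: T)
    case (Cons q rs)
    obtain x y z P cert where q: "q = ((x, y, z), P, cert)" by (cases q) auto
    have deg: "degrees_le G n" using Cons.prems by blast
    have "refuted G P"
      using Cons.prems check_sound[OF _ deg] fits_graph_of_pattern[OF _ _ deg]
      unfolding q refuted_def check_all.simps by blast
    moreover from this have "refuted_table G (store q T)"
      using Cons.prems(1) by (auto simp: q refuted_table_def entry_def set_entry_def)
    ultimately show ?case
      using Cons by (simp add: q)
  qed simp
  then show "refuted_table G (fold store rs T)" and "q \<in> set rs \<Longrightarrow> refuted G (fst (snd q))"
    by blast+
qed

text \<open>A vertex violating the bound has at least \<open>Suc n\<close> neighbours; naming it
  \<open>a\<close> and exactly \<open>Suc n\<close> of them by the next labels would produce a
  labelling that matches the star.\<close>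

lemma degrees_leI:
  assumes card: "card (pverts G) = 10" and star: "refuted G (star (Suc n))"
  shows "degrees_le G n"
  unfolding degrees_le_def
proof (rule allI, rule ccontr)
  fix v
  assume "\<not> card {w. legal_move G v w} \<le> Suc n"
  then have gt: "Suc n < card {w. legal_move G v w}" by simp
  \<comment> \<open>An element outside the vertex set has a closed neighbourhood of size one, too
    small to violate any bound.\<close>
  have v: "v \<in> pverts G"
  proof (rule ccontr)
    assume "v \<notin> pverts G"
    then have "{w. legal_move G v w} = {v}"
      by (auto simp: legal_move_def dest: in_arcsD1)
    then show False using gt by simp
  qed
  have "Suc n \<le> card ({w. legal_move G v w} - {v})"
    using gt finite_legal_moves by (simp add: card_Diff_singleton)
  then obtain A where A: "A \<subseteq> {w. legal_move G v w} - {v}" "card A = Suc n" "finite A"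
    using obtain_subset_with_card_n by (metis (no_types))
  obtain ws where ws: "set ws = A" "distinct ws" "length ws = Suc n"
    using A finite_distinct_list distinct_card by metis
  have "distinct (v # ws)" "set (v # ws) \<subseteq> pverts G"
    using ws A v legal_move_in_verts by auto
  then obtain \<phi> where \<phi>: "labelling G \<phi>" and map: "map \<phi> (take (length (v # ws)) labels) = v # ws"
    using labelling_exists[OF pair_finite_verts card] by metis
  have "take (length (v # ws)) labels = a # take (Suc n) (tl labels)"
    by (simp add: ws(3) labels_def)
  then have "\<phi> a = v" "\<phi> ` set (take (Suc n) (tl labels)) = set ws"
    using map by (auto simp flip: list.set_map)
  then have "matches G \<phi> [(a, take (Suc n) (tl labels), [])]"
    using ws A by (fastforce simp: matches_def)
  then show False using star \<phi> by (simp add: refuted_def star_def)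
qed

text \<open>One stage of the descent. The star need only be the last pattern of the list; all other
  patterns are auxiliary to it.\<close>

lemma lower_degree_bound:
  assumes "card (pverts G) = 10" "degrees_le G n \<and> refuted_table G T" "check_all n T rs"
    and "rs \<noteq> [] \<and> fst (snd (last rs)) = star (Suc k)"
  shows "degrees_le G k \<and> refuted_table G (fold store rs T)"
  using check_all_sound[OF assms(2,3)] degrees_leI[OF assms(1)] assms(4) last_in_set by metis

end

section \<open>The Petersen graph\<close>

text \<open>Outer 5-cycle \<open>abcde\<close>, inner 5-cycle \<open>fhjgi\<close>, spokes \<open>af\<close>, \<open>bg\<close>, \<open>ch\<close>, \<open>di\<close>, \<open>ej\<close>.\<close>

fun pair_of_label :: "label \<Rightarrow> nat set" where
  "pair_of_label a = {0, 1}"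
| "pair_of_label b = {2, 3}"
| "pair_of_label c = {0, 4}"
| "pair_of_label d = {1, 2}"
| "pair_of_label e = {3, 4}"
| "pair_of_label f = {2, 4}"
| "pair_of_label g = {1, 4}"
| "pair_of_label h = {1, 3}"
| "pair_of_label i = {0, 3}"
| "pair_of_label j = {0, 2}"

fun closed_nbrs :: "label \<Rightarrow> label list" where
  "closed_nbrs a = [a, b, e, f]"
| "closed_nbrs b = [a, b, c, g]"
| "closed_nbrs c = [b, c, d, h]"
| "closed_nbrs d = [c, d, e, i]"
| "closed_nbrs e = [a, d, e, j]"
| "closed_nbrs f = [a, f, h, i]"
| "closed_nbrs g = [b, g, i, j]"
| "closed_nbrs h = [c, f, h, j]"
| "closed_nbrs i = [d, f, g, i]"
| "closed_nbrs j = [e, g, h, j]"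

definition petersen_labelling :: "'a pair_pre_digraph \<Rightarrow> (label \<Rightarrow> 'a) \<Rightarrow> bool" where
  "petersen_labelling G \<phi> \<longleftrightarrow> labelling G \<phi> \<and>
    (\<forall>x y. legal_move G (\<phi> x) (\<phi> y) \<longleftrightarrow> y \<in> set (closed_nbrs x))"

lemma ex_label: "(\<exists>x. P x) \<longleftrightarrow> list_ex P labels"
  by (metis UNIV_I list_ex_iff set_labels)

text \<open>Two closed neighbourhoods contain at most eight of the ten vertices.\<close>

lemma closed_nbrs_undominated: "\<exists>z. z \<notin> set (closed_nbrs x) \<and> z \<notin> set (closed_nbrs y)"
  unfolding ex_label by (cases x; cases y; simp add: labels_def)

text \<open>Girth 5 is the reason. A cop next to \<open>z\<close> reaches no other neighbour of
  \<open>z\<close>, for lack of triangles; a cop farther away reaches at most one, for lack of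
  4-cycles. Two cops thus leave one of the three neighbours free.\<close>

lemma closed_nbrs_escape:
  assumes "z \<noteq> x" "z \<noteq> y"
  shows "\<exists>w\<in>set (closed_nbrs z). w \<notin> set (closed_nbrs x) \<and> w \<notin> set (closed_nbrs y)"
  using assms by (cases z; cases x; cases y; simp)

text \<open>The labels \<open>b\<close>, \<open>e\<close>, \<open>f\<close> are the neighbours of
  \<open>a\<close>, and no vertex is farther than distance 2 from \<open>a\<close>.\<close>

lemma closed_nbrs_dominating:
  "z \<in> set (closed_nbrs b) \<union> set (closed_nbrs e) \<union> set (closed_nbrs f)"
  by (cases z) simp_all

lemma closed_nbrs_diameter: "\<exists>z\<in>set (closed_nbrs x). y \<in> set (closed_nbrs z)"
  by (cases x; cases y; simp)

text \<open>The bridge between the drawing with two 5-cycles, used for all computations, and the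
  Kneser graph of the statement.\<close>

lemma closed_nbrs_iff_disjoint:
  "y \<in> set (closed_nbrs x) \<longleftrightarrow> y = x \<or> pair_of_label x \<inter> pair_of_label y = {}"
  by (cases x; cases y; simp)

lemma inj_pair_of_label: "inj pair_of_label"
proof (rule injI)
  fix x y assume "pair_of_label x = pair_of_label y"
  then show "x = y" by (cases x; cases y; simp add: doubleton_eq_iff)
qed

section \<open>The Kneser graph as a connected graph on ten vertices\<close>

lemma card_verts_petersen: "card (pverts petersen) = 10"
  using n_subsets[of "{..<5::nat}" 2] by (simp add: petersen_def choose_two)

lemma finite_verts_petersen: "finite (pverts petersen)"
  using card_verts_petersen card.infinite by fastforce

lemma pair_graph_petersen: "pair_graph petersen"
proof
  show "finite (parcs petersen)"
    by (rule finite_subset[of _ "pverts petersen \<times> pverts petersen"])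
      (auto simp: petersen_def finite_verts_petersen[unfolded petersen_def, simplified])
  show "symmetric (with_proj petersen)"
    by (auto simp: symmetric_def sym_def petersen_def)
qed (auto simp: petersen_def finite_verts_petersen[unfolded petersen_def, simplified])

text \<open>Surjectivity comes from counting: ten distinct pairs inside a vertex set of size
  ten.\<close>

lemma petersen_labelling_petersen: "petersen_labelling petersen pair_of_label"
proof -
  have range: "pair_of_label x \<in> pverts petersen" for x
    by (cases x) (simp_all add: petersen_def)
  have "card (range pair_of_label) = card (pverts petersen)"
    using card_image[OF inj_pair_of_label] by (simp add: card_label card_verts_petersen)
  then have "range pair_of_label = pverts petersen"
    using range finite_verts_petersen by (metis card_subset_eq image_subsetI)
  then have "labelling petersen pair_of_label"
    by (simp add: labelling_def bij_betw_def inj_pair_of_label)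
  moreover have "legal_move petersen (pair_of_label x) (pair_of_label y) \<longleftrightarrow> y \<in> set (closed_nbrs x)" for x y
    using range[of x] range[of y] inj_pair_of_label
    by (auto simp: closed_nbrs_iff_disjoint legal_move_def petersen_def dest: injD)
  ultimately show ?thesis by (simp add: petersen_labelling_def)
qed

text \<open>Diameter 2 provides an explicit path through one intermediate vertex between any two
  vertices.\<close>

lemma connected_petersen: "Digraph_Component.connected (with_proj petersen)"
proof -
  have edge: "(u, v) \<in> rtrancl_on (pverts petersen) ((parcs petersen)\<^sup>s)"
    if "u \<in> pverts petersen" "v \<in> pverts petersen" "legal_move petersen u v" for u v
    using that rtrancl_on_into_rtrancl_on[OF rtrancl_on_refl, of u "pverts petersen" v]
    by (auto simp: legal_move_def symcl_def)
  have range: "range pair_of_label = pverts petersen"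
    using petersen_labelling_petersen by (simp add: petersen_labelling_def labelling_def bij_betw_def)
  show ?thesis
    unfolding connected_conv
  proof (intro conjI ballI)
    show "verts (with_proj petersen) \<noteq> {}"
      using card_verts_petersen by auto
  next
    fix u v assume uv: "u \<in> verts (with_proj petersen)" "v \<in> verts (with_proj petersen)"
    obtain x y where xy: "u = pair_of_label x" "v = pair_of_label y"
      using uv range by (metis imageE with_proj_simps(1))
    obtain z where "z \<in> set (closed_nbrs x)" "y \<in> set (closed_nbrs z)"
      using closed_nbrs_diameter by blast
    then have "legal_move petersen u (pair_of_label z)" "legal_move petersen (pair_of_label z) v"
      "pair_of_label z \<in> pverts petersen"
      using petersen_labelling_petersen
      by (auto simp: xy petersen_labelling_def labelling_def bij_betw_def)
    then show "(u, v) \<in> rtrancl_on (verts (with_proj petersen)) ((arcs_ends (with_proj petersen))\<^sup>s)"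
      using edge uv by (auto intro: rtrancl_on_trans)
  qed
qed

section \<open>Isomorphism with the Petersen graph expressed by labellings\<close>

lemma digraph_iso_with_proj_iff:
  assumes "pair_graph G" "pair_graph H"
  shows "digraph_iso (with_proj G) (with_proj H) \<longleftrightarrow>
    (\<exists>F. bij_betw F (pverts G) (pverts H) \<and>
      (\<forall>u\<in>pverts G. \<forall>v\<in>pverts G. (u, v) \<in> parcs G \<longleftrightarrow> (F u, F v) \<in> parcs H))"
    (is "?iso \<longleftrightarrow> (\<exists>F. ?P F)")
proof
  interpret G: pair_graph G by fact
  interpret H: pair_graph H by fact
  {
    assume ?iso
    then obtain k where k: "G.digraph_isomorphism k" and H: "with_proj H = app_iso k (with_proj G)"
      unfolding digraph_iso_def by blast
    have verts: "pverts H = iso_verts k ` pverts G"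
      using arg_cong[OF H, of verts] by simp
    have arcs: "parcs H = iso_arcs k ` parcs G"
      using arg_cong[OF H, of arcs] by simp
    have tail: "fst = iso_tail k"
      using arg_cong[OF H, of tail] by simp
    have head: "snd = iso_head k"
      using arg_cong[OF H, of head] by simp
    have inj: "inj_on (iso_verts k) (pverts G)"
      using k by (simp add: G.digraph_isomorphism_def)
    \<comment> \<open>The equation for \<open>with_proj H\<close> forces the tail and head maps of
      the image to be \<open>fst\<close> and \<open>snd\<close>; compatibility with them leaves the
      arc map no choice but to act by the vertex map on both components.\<close>
    have arc: "iso_arcs k (u, v) = (iso_verts k u, iso_verts k v)" if "(u, v) \<in> parcs G" for u v
      using k that by (auto simp: G.digraph_isomorphism_def prod_eq_iff simp flip: tail head)
    have "(u, v) \<in> parcs G"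
      if uv: "u \<in> pverts G" "v \<in> pverts G" and H_uv: "(iso_verts k u, iso_verts k v) \<in> parcs H" for u v
    proof -
      obtain u' v' where u'v': "(u', v') \<in> parcs G"
        and "(iso_verts k u, iso_verts k v) = (iso_verts k u', iso_verts k v')"
        using H_uv arc unfolding arcs by force
      then have "u = u'" "v = v'"
        using uv inj G.in_arcsD1 G.in_arcsD2 by (auto dest: inj_onD)
      then show ?thesis using u'v' by simp
    qed
    moreover have "(iso_verts k u, iso_verts k v) \<in> parcs H" if "(u, v) \<in> parcs G" for u v
      using arc[OF that] that unfolding arcs by (metis image_eqI)
    ultimately have "?P (iso_verts k)"
      using inj verts by (auto simp: bij_betw_def)
    then show "\<exists>F. ?P F" by blast
  }
  {
    assume "\<exists>F. ?P F"
    then obtain F where bij: "bij_betw F (pverts G) (pverts H)"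
      and F: "\<And>u v. u \<in> pverts G \<Longrightarrow> v \<in> pverts G \<Longrightarrow> (u, v) \<in> parcs G \<longleftrightarrow> (F u, F v) \<in> parcs H"
      by blast
    define k where "k = \<lparr>iso_verts = F, iso_arcs = map_prod F F, iso_head = snd, iso_tail = fst\<rparr>"
    have inj: "inj_on F (pverts G)" and surj: "F ` pverts G = pverts H"
      using bij by (auto simp: bij_betw_def)
    have sub: "parcs G \<subseteq> pverts G \<times> pverts G"
      using G.in_arcsD1 G.in_arcsD2 by auto
    \<comment> \<open>Conversely the vertex map determines the whole isomorphism: arcs are pairs of
      vertices, so injectivity on arcs is inherited.\<close>
    have "inj_on (map_prod F F) (parcs G)"
      using map_prod_inj_on[OF inj inj] sub by (rule inj_on_subset)
    then have "G.digraph_isomorphism k"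
      using inj G.wf_digraph_axioms unfolding G.digraph_isomorphism_def by (simp add: k_def)
    moreover have "parcs H = map_prod F F ` parcs G"
    proof
      show "parcs H \<subseteq> map_prod F F ` parcs G"
      proof
        fix p assume p: "p \<in> parcs H"
        obtain u v where "u \<in> pverts G" "v \<in> pverts G" "p = (F u, F v)"
          using p H.in_arcsD1 H.in_arcsD2 unfolding surj[symmetric] by (cases p) blast
        then show "p \<in> map_prod F F ` parcs G"
          using F p by (metis image_eqI map_prod_simp)
      qed
      show "map_prod F F ` parcs G \<subseteq> parcs H"
        using F sub by auto
    qed
    then have "with_proj H = app_iso k (with_proj G)"
      by (simp add: app_iso_def k_def with_proj_def surj)
    ultimately show ?iso
      unfolding digraph_iso_def by blast
  }
qed

lemma digraph_iso_petersen_iff: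
  assumes "pair_graph G"
  shows "digraph_iso (with_proj G) (with_proj petersen) \<longleftrightarrow> (\<exists>\<phi>. petersen_labelling G \<phi>)"
proof
  interpret G: pair_graph G by fact
  interpret P: pair_graph petersen by (rule pair_graph_petersen)
  let ?\<kappa> = "pair_of_label"
  have \<kappa>: "bij_betw ?\<kappa> UNIV (pverts petersen)"
    "\<And>x y. legal_move petersen (?\<kappa> x) (?\<kappa> y) \<longleftrightarrow> y \<in> set (closed_nbrs x)"
    using petersen_labelling_petersen by (auto simp: petersen_labelling_def labelling_def)
  {
    assume "digraph_iso (with_proj G) (with_proj petersen)"
    then obtain F where bij: "bij_betw F (pverts G) (pverts petersen)"
      and F: "\<And>u v. u \<in> pverts G \<Longrightarrow> v \<in> pverts G \<Longrightarrow>
        (u, v) \<in> parcs G \<longleftrightarrow> (F u, F v) \<in> parcs petersen"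
      unfolding digraph_iso_with_proj_iff[OF assms pair_graph_petersen] by blast
    define \<psi> where "\<psi> = the_inv_into (pverts G) F"
    have \<psi>: "bij_betw \<psi> (pverts petersen) (pverts G)"
      unfolding \<psi>_def using bij by (rule bij_betw_the_inv_into)
    have F\<psi>: "F (\<psi> A) = A" if "A \<in> pverts petersen" for A
      unfolding \<psi>_def using bij that by (simp add: f_the_inv_into_f_bij_betw)
    have in_G: "\<psi> A \<in> pverts G" if "A \<in> pverts petersen" for A
      using \<psi> that by (auto simp: bij_betw_def)
    have "legal_move G (\<psi> A) (\<psi> B) \<longleftrightarrow> legal_move petersen A B"
      if "A \<in> pverts petersen" "B \<in> pverts petersen" for A B
      using that F[OF in_G in_G, of A B] F\<psi> unfolding legal_move_def by metis
    moreover have "?\<kappa> x \<in> pverts petersen" for x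
      using \<kappa>(1) by (auto simp: bij_betw_def)
    ultimately have "petersen_labelling G (\<psi> \<circ> ?\<kappa>)"
      using bij_betw_trans[OF \<kappa>(1) \<psi>] by (simp add: petersen_labelling_def labelling_def \<kappa>(2))
    then show "\<exists>\<phi>. petersen_labelling G \<phi>" by blast
  }
  {
    assume "\<exists>\<phi>. petersen_labelling G \<phi>"
    then obtain \<phi> where bij: "bij_betw \<phi> UNIV (pverts G)"
      and \<phi>: "\<And>x y. legal_move G (\<phi> x) (\<phi> y) \<longleftrightarrow> y \<in> set (closed_nbrs x)"
      by (auto simp: petersen_labelling_def labelling_def)
    define \<psi> where "\<psi> = the_inv_into UNIV \<phi>"
    have \<psi>: "bij_betw \<psi> (pverts G) UNIV"
      unfolding \<psi>_def using bij by (rule bij_betw_the_inv_into)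
    have \<phi>\<psi>: "\<phi> (\<psi> u) = u" if "u \<in> pverts G" for u
      unfolding \<psi>_def using bij that by (simp add: f_the_inv_into_f_bij_betw)
    have "(u, v) \<in> parcs G \<longleftrightarrow> (?\<kappa> (\<psi> u), ?\<kappa> (\<psi> v)) \<in> parcs petersen"
      if uv: "u \<in> pverts G" "v \<in> pverts G" for u v
    proof -
      \<comment> \<open>The relation \<open>legal_move\<close> merges adjacency with equality. Since
        neither graph has loops, matching equality on both sides recovers adjacency from it.\<close>
      have "?\<kappa> (\<psi> u) = ?\<kappa> (\<psi> v) \<longleftrightarrow> u = v"
        using inj_pair_of_label \<phi>\<psi> uv by (metis injD)
      moreover have "legal_move G u v \<longleftrightarrow> legal_move petersen (?\<kappa> (\<psi> u)) (?\<kappa> (\<psi> v))"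
        using \<phi>[of "\<psi> u" "\<psi> v"] \<kappa>(2) \<phi>\<psi> uv by simp
      ultimately show ?thesis
        using G.no_loops' P.no_loops' unfolding legal_move_def by metis
    qed
    then show "digraph_iso (with_proj G) (with_proj petersen)"
      unfolding digraph_iso_with_proj_iff[OF assms pair_graph_petersen]
      using bij_betw_trans[OF \<psi> \<kappa>(1)] by (intro exI[of _ "?\<kappa> \<circ> \<psi>"]) simp
  }
qed

section \<open>The cop number of the Petersen graph\<close>

lemma petersen_labelling_not_winning:
  assumes "pair_graph G" "petersen_labelling G \<phi>" "k \<le> 2"
  shows "\<not> winning_cop_strategy G k \<sigma>"
proof -
  interpret pair_graph G by fact
  have bij: "bij_betw \<phi> UNIV (pverts G)"
    and \<phi>: "\<And>x y. legal_move G (\<phi> x) (\<phi> y) \<longleftrightarrow> y \<in> set (closed_nbrs x)"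
    using assms(2) by (auto simp: petersen_labelling_def labelling_def)
  have in_verts: "\<phi> x \<in> pverts G" for x
    using bij by (auto simp: bij_betw_def)
  have label: "\<exists>x. v = \<phi> x" if "v \<in> pverts G" for v
    using bij that by (auto simp: bij_betw_def)
  \<comment> \<open>All numbers of cops up to two are treated together, as the cop number is a least
    element: a single cop is the case \<open>x = y\<close>, no cop the empty list.\<close>
  have cops: "C = [] \<or> (\<exists>x y. set C = {\<phi> x, \<phi> y})" if C: "length C = k" "set C \<subseteq> pverts G" for C
  proof (cases C)
    case (Cons u D)
    then obtain x where x: "u = \<phi> x" using C(2) label[of u] by auto
    show ?thesis
    proof (cases D)
      case Nil
      then have "set C = {\<phi> x, \<phi> x}" using Cons x by simp
      then show ?thesis by blast
    next
      case Cons': (Cons v D')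
      then have "D' = []" using Cons C(1) assms(3) by (cases D') simp_all
      moreover obtain y where "v = \<phi> y" using C(2) label[of v] Cons Cons' by auto
      ultimately have "set C = {\<phi> x, \<phi> y}" using Cons Cons' x by simp
      then show ?thesis by blast
    qed
  qed simp
  show ?thesis
  proof (rule no_winning_cop_strategyI)
    fix C assume "length C = k" "set C \<subseteq> pverts G"
    then have "C = [] \<or> (\<exists>x y. set C = {\<phi> x, \<phi> y})" by (rule cops)
    then show "\<exists>r\<in>pverts G. \<forall>v\<in>set C. \<not> legal_move G v r"
    proof (elim disjE exE)
      fix x y assume C: "set C = {\<phi> x, \<phi> y}"
      obtain z where "z \<notin> set (closed_nbrs x)" "z \<notin> set (closed_nbrs y)"
        using closed_nbrs_undominated by blast
      then show ?thesis
        using C in_verts by (intro bexI[of _ "\<phi> z"]) (auto simp: \<phi>)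
    qed (use in_verts in auto)
  next
    fix C C' r
    assume C: "length C = k" "set C \<subseteq> pverts G" and r: "r \<in> pverts G"
      and safe: "\<forall>v\<in>set C. \<not> legal_move G v r" and move: "list_all2 (legal_move G) C C'"
    have "\<exists>u\<in>set C. legal_move G u v" if "v \<in> set C'" for v
      using move that by (metis in_set_conv_nth list_all2_conv_all_nth)
    \<comment> \<open>The robber was safe before the cops moved, so none of them has reached his
      vertex; this is what the escape lemma requires.\<close>
    then have C': "set C' \<subseteq> pverts G" "r \<notin> set C'"
      using C(2) safe legal_move_in_verts by blast+
    have "length C' = k"
      using C(1) move by (simp add: list_all2_lengthD)
    obtain z where z: "r = \<phi> z" using r label by blast
    have "C' = [] \<or> (\<exists>x y. set C' = {\<phi> x, \<phi> y})" using C'(1) \<open>length C' = k\<close> cops by blast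
    then show "\<exists>r'. legal_move G r r' \<and> (\<forall>v\<in>set C'. \<not> legal_move G v r')"
    proof (elim disjE exE)
      fix x y assume xy: "set C' = {\<phi> x, \<phi> y}"
      then have "z \<noteq> x" "z \<noteq> y" using C'(2) z by auto
      then obtain w where "w \<in> set (closed_nbrs z)" "w \<notin> set (closed_nbrs x)" "w \<notin> set (closed_nbrs y)"
        using closed_nbrs_escape by blast
      then show ?thesis
        using xy z by (intro exI[of _ "\<phi> w"]) (auto simp: \<phi>)
    qed (auto intro!: exI[of _ r])
  qed (use legal_move_in_verts in blast)
qed

lemma petersen_labelling_cop_number:
  assumes "pair_graph G" "petersen_labelling G \<phi>"
  shows "cop_number G = 3"
  unfolding cop_number_def
proof (rule Least_equality)
  have bij: "bij_betw \<phi> UNIV (pverts G)"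
    and \<phi>: "\<And>x y. legal_move G (\<phi> x) (\<phi> y) \<longleftrightarrow> y \<in> set (closed_nbrs x)"
    using assms(2) by (auto simp: petersen_labelling_def labelling_def)
  \<comment> \<open>The neighbours of \<open>a\<close>; placed there, the cops capture in their
    first move.\<close>
  let ?C = "[\<phi> b, \<phi> e, \<phi> f]"
  have "cop_win G ?C r" if r: "r \<in> pverts G" for r
  proof -
    obtain z where z: "r = \<phi> z" using bij r by (auto simp: bij_betw_def)
    consider "legal_move G (\<phi> b) r" | "legal_move G (\<phi> e) r" | "legal_move G (\<phi> f) r"
      using closed_nbrs_dominating[of z] \<phi> z by blast
    then show ?thesis
    proof cases
      case 1
      then show ?thesis by (intro cop_win_catch[of G ?C "[r, \<phi> e, \<phi> f]"]) auto
    next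
      case 2
      then show ?thesis by (intro cop_win_catch[of G ?C "[\<phi> b, r, \<phi> f]"]) auto
    next
      case 3
      then show ?thesis by (intro cop_win_catch[of G ?C "[\<phi> b, \<phi> e, r]"]) auto
    qed
  qed
  then show "\<exists>\<sigma>. winning_cop_strategy G 3 \<sigma>"
    using bij by (intro winning_cop_strategyI[of ?C]) (auto simp: bij_betw_def)
next
  fix k assume "\<exists>\<sigma>. winning_cop_strategy G k \<sigma>"
  then show "3 \<le> k"
    using petersen_labelling_not_winning[OF assms] by (metis not_less_eq_eq numeral_2_eq_2 numeral_3_eq_3)
qed

text \<open>Every pair is decided, so a match is an isomorphism and not merely an embedding of
  edges.\<close>

definition petersen_pattern :: pattern where
  "petersen_pattern = map (\<lambda>x. (x, closed_nbrs x, filter (\<lambda>y. y \<notin> set (closed_nbrs x)) labels)) labels"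

lemma matches_petersen_pattern:
  "labelling G \<phi> \<Longrightarrow> matches G \<phi> petersen_pattern \<longleftrightarrow> petersen_labelling G \<phi>"
  by (auto simp: matches_def petersen_pattern_def petersen_labelling_def set_labels)

section \<open>The certificates\<close>

text \<open>
  The certificates were found by a computer search that simplified every refuted partial graph to
  a pattern and stored it if it occurred again up to relabelling. The refutations in
  the list numbered \<open>n\<close> assume that all degrees are at most \<open>n\<close>; the last one of them
  lowers this bound.
\<close>

definition petersen_table :: table where
  "petersen_table = const_vec (const_vec (const_vec petersen_pattern))"

section \<open>Refutations for decreasing degree bounds\<close>

definition refutations9 :: "refutation list" where
  "refutations9 = [
  ((a,a,b), [(a,[b,c,d,e,f,g,h,i],[])],Win [(a,j,a,j)])]"

text \<open>With eight neighbours named, only \<open>j\<close> lies outside, so cops on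
  \<open>a\<close> and \<open>j\<close> dominate the graph. The same star excludes degree 9, which
  is why the bound falls from 9 to 7 at once.\<close>

definition table9 :: table where
  "table9 = fold store refutations9 petersen_table"

lemma check_refutations9: "check_all 9 petersen_table refutations9"
  by code_simp

lemma last_refutations9: "refutations9 \<noteq> [] \<and> fst (snd (last refutations9)) = star (Suc 7)"
  by code_simp

text \<open>Outside the closed neighbourhood of a vertex \<open>a\<close> of degree 7 remain
  \<open>i\<close> and \<open>j\<close>. If they are adjacent, cops on \<open>a\<close> and
  \<open>i\<close> dominate; otherwise \<open>i\<close> has a neighbour among those of
  \<open>a\<close>, or is isolated and gives a cut.\<close>

definition refutations7 :: "refutation list" where
  "refutations7 = [
  ((a,a,c), [(a,[b,c,d,e,f,g,h],[]), (b,[j],[]), (f,[i],[]), (i,[],[j])],Win [(a,b,f,a)]),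
  ((a,a,d), [(a,[b,c,d,e,g,h],[]), (f,[i,j],[])],Win [(a,f,a,f)]),
  ((a,a,e), [(a,[b,c,d,e,f,g,h],[]), (f,[i],[]), (i,[],[j])],Split b j (Ref a a c (Vec a b c d e f g
  h i j)) (Split c j (Ref a a c (Vec a c b d e f g h i j)) (Split d j (Ref a a c (Vec a d b c e f g
  h i j)) (Split e j (Ref a a c (Vec a e b c d f g h i j)) (Split g j (Ref a a c (Vec a f b c d g e
  h j i)) (Split h j (Ref a a c (Vec a f b c d h e g j i)) (Split f j (Ref a a d (Vec a b c d e f g
  h i j)) (Cut [a,b,c,d,e,f,g,h,i])))))))),
  ((a,a,f), [(a,[b,c,d,e,f,g,h],[])],Split i j (Win [(a,i,a,i)]) (Split f i (Ref a a e (Vec a b c d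
  e f g h i j)) (Split b i (Ref a a e (Vec a c d e f b g h i j)) (Split c i (Ref a a e (Vec a b d e
  f c g h i j)) (Split d i (Ref a a e (Vec a b c e f d g h i j)) (Split e i (Ref a a e (Vec a b c d
  f e g h i j)) (Split g i (Ref a a e (Vec a b c d e g f h i j)) (Split h i (Ref a a e (Vec a b c d
  e h f g i j)) (Cut [a,b,c,d,e,f,g,h,j])))))))))]"

definition table7 :: table where
  "table7 = fold store refutations7 table9"

lemma check_refutations7: "check_all 7 table9 refutations7"
  by code_simp

lemma last_refutations7: "refutations7 \<noteq> [] \<and> fst (snd (last refutations7)) = star (Suc 6)"
  by code_simp

text \<open>Three vertices remain outside. An edge among them is the pattern under
  \<open>(a,a,j)\<close>; without such an edge, \<open>h\<close> must be attached to a neighbour of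
  \<open>a\<close>, which is the pattern under \<open>(a,b,e)\<close>.\<close>

definition refutations6 :: "refutation list" where
  "refutations6 = [
  ((a,a,g), [(a,[b,c,d,e,f,g],[]), (b,[h],[]), (g,[i],[]), (h,[],[i,j]), (i,[j],[])],Win [(a,g,b,a),
  (a,g,a,i)]),
  ((a,a,h), [(a,[b,c,d,e,f],[]), (g,[h,i],[]), (h,[],[j]), (i,[j],[])],Win [(a,g,a,i)]),
  ((a,a,i), [(a,[b,c,d,e,f,g],[]), (g,[i],[]), (h,[],[i,j]), (i,[j],[])],Split b h (Ref a a g (Vec a
  b c d e f g h i j)) (Split c h (Ref a a g (Vec a c b d e f g h i j)) (Split d h (Ref a a g (Vec a
  d b c e f g h i j)) (Split e h (Ref a a g (Vec a e b c d f g h i j)) (Split f h (Ref a a g (Vec a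
  f b c d e g h i j)) (Split g h (Ref a a h (Vec a b c d e f g h i j)) (Cut
  [a,b,c,d,e,f,g,i,j]))))))),
  ((a,a,j), [(a,[b,c,d,e,f,g],[]), (i,[j],[])],Split h i (Ref a a d (Vec a b c d e i f g h j))
  (Split h j (Ref a a d (Vec a b c d e j f g h i)) (Split g i (Ref a a i (Vec a b c d e f g h i j))
  (Split g j (Ref a a i (Vec a b c d e f g h j i)) (Split b i (Ref a a i (Vec a c d e f g b h i j))
  (Split b j (Ref a a i (Vec a c d e f g b h j i)) (Split c i (Ref a a i (Vec a b d e f g c h i j))
  (Split c j (Ref a a i (Vec a b d e f g c h j i)) (Split d i (Ref a a i (Vec a b c e f g d h i j))
  (Split d j (Ref a a i (Vec a b c e f g d h j i)) (Split e i (Ref a a i (Vec a b c d f g e h i j))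
  (Split e j (Ref a a i (Vec a b c d f g e h j i)) (Split f i (Ref a a i (Vec a b c d e g f h i j))
  (Split f j (Ref a a i (Vec a b c d e g f h j i)) (Cut [a,b,c,d,e,f,g,h]))))))))))))))),
  ((a,b,a), [(a,[b,c,d,e,f,g],[]), (b,[h],[]), (c,[j],[]), (d,[i],[]), (h,[],[i,j]), (i,[],[j])],Win
  [(a,c,b,a), (a,d,c,a)]),
  ((a,b,b), [(a,[b,c,d,e,f,g],[]), (b,[h,i],[]), (c,[j],[]), (h,[],[j]), (i,[],[j])],Win
  [(a,c,b,a)]),
  ((a,b,c), [(a,[b,c,d,e,f,g],[]), (b,[h],[]), (c,[j],[]), (h,[],[i,j]), (i,[],[j])],Split d i (Ref
  a b a (Vec a b c d e f g h i j)) (Split e i (Ref a b a (Vec a b c e d f g h i j)) (Split f i (Ref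
  a b a (Vec a b c f d e g h i j)) (Split g i (Ref a b a (Vec a b c g d e f h i j)) (Split b i (Ref
  a b b (Vec a b c d e f g h i j)) (Split c i (Ref a b b (Vec a c b d e f g i j h)) (Cut
  [a,b,c,d,e,f,g,h,j]))))))),
  ((a,b,d), [(a,[c,d,e,f,g],[]), (b,[h,i,j],[])],Win [(a,b,a,b)]),
  ((a,b,e), [(a,[b,c,d,e,f,g],[]), (b,[h],[]), (h,[],[i,j]), (i,[],[j])],Split c j (Ref a b c (Vec a
  b c d e f g h i j)) (Split c i (Ref a b c (Vec a b c d e f g h j i)) (Split d i (Ref a b c (Vec a
  b d c e f g h j i)) (Split d j (Ref a b c (Vec a b d c e f g h i j)) (Split e i (Ref a b c (Vec a
  b e c d f g h j i)) (Split e j (Ref a b c (Vec a b e c d f g h i j)) (Split f i (Ref a b c (Vec a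
  b f c d e g h j i)) (Split f j (Ref a b c (Vec a b f c d e g h i j)) (Split g i (Ref a b c (Vec a
  b g c d e f h j i)) (Split b i (Split g j (Ref a b c (Vec a b g c d e f h i j)) (Split b j (Ref a
  b d (Vec a b c d e f g h i j)) (Cut [a,b,c,d,e,f,g,h,i]))) (Cut [a,b,c,d,e,f,g,h,j]))))))))))),
  ((a,b,f), [(a,[b,c,d,e,f,g],[])],Split i j (Ref a a j (Vec a b c d e f g h i j)) (Split h i (Ref a
  a j (Vec a b c d e f g j h i)) (Split h j (Ref a a j (Vec a b c d e f g i h j)) (Split b h (Ref a
  b e (Vec a b c d e f g h i j)) (Split c h (Ref a b e (Vec a c b d e f g h i j)) (Split d h (Ref a
  b e (Vec a d b c e f g h i j)) (Split e h (Ref a b e (Vec a e b c d f g h i j)) (Split f h (Ref a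
  b e (Vec a f b c d e g h i j)) (Split g h (Ref a b e (Vec a g b c d e f h i j)) (Cut
  [a,b,c,d,e,f,g,i,j]))))))))))]"

definition table6 :: table where
  "table6 = fold store refutations6 table7"

lemma check_refutations6: "check_all 6 table7 refutations6"
  by code_simp

lemma last_refutations6: "refutations6 \<noteq> [] \<and> fst (snd (last refutations6)) = star (Suc 5)"
  by code_simp

text \<open>Four vertices remain outside. Two disjoint edges among them are treated under
  \<open>(a,c,f)\<close>, one edge under \<open>(a,d,f)\<close>, and no edge within the final
  star.\<close>

definition refutations5 :: "refutation list" where
  "refutations5 = [
  ((a,b,g), [(a,[b,c,d,e,f],[]), (c,[h],[]), (d,[g],[]), (e,[h],[]), (f,[h],[]), (g,[i,j],[]),
  (h,[i,j],[])],Split b g (Split c g (Win [(c,j,a,g), (c,j,a,h), (c,j,h,g)]) (Split b e (Win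
  [(b,f,g,h), (b,f,a,h), (b,f,g,a)]) (Win [(d,f,d,h), (d,f,g,a), (d,f,a,h), (d,f,g,h)]))) (Ref a a h
  (Vec h c e f i j a b d g))),
  ((a,b,h), [(a,[b,c,d,e,f],[]), (b,[],[h]), (c,[h],[]), (d,[g],[]), (e,[],[i]), (f,[],[h]),
  (g,[i,j],[]), (h,[j],[])],Win [(c,g,a,j), (c,g,a,g)]),
  ((a,b,i), [(a,[b,c,d,e,f],[]), (c,[h],[]), (d,[g],[]), (e,[h],[]), (g,[i,j],[]),
  (h,[i,j],[])],Split f h (Ref a b g (Vec a b c d e f g h i j)) (Split b h (Ref a b g (Vec a f b d c
  e g h i j)) (Split c i (Split e i (Split d j (Win [(d,i,j,i), (d,i,a,g)]) (Split c j (Win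
  [(c,i,a,g), (c,i,a,i)]) (Win [(e,g,a,g), (e,g,a,i), (d,i,a,g), (d,i,a,i), (g,i,d,i), (g,i,g,e)])))
  (Ref a b h (Vec a b c d e f g h i j))) (Ref a b h (Vec a b e d c f g h i j))))),
  ((a,b,j), [(a,[b,d,e,f],[]), (b,[],[g]), (c,[h],[]), (d,[g],[]), (e,[],[g]), (f,[],[g]),
  (h,[i,j],[])],Win [(d,h,a,h)]),
  ((a,c,a), [(a,[b,c,d,e,f],[]), (c,[h],[]), (d,[g],[]), (g,[i,j],[]), (h,[i,j],[])],Split b g (Ref
  a b i (Vec a e b c d f h g i j)) (Split f g (Ref a b i (Vec a b d c f e h g i j)) (Split e g (Ref
  a b i (Vec a b d c e f h g i j)) (Ref a b j (Vec a b c d e f g h i j))))),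
  ((a,c,b), [(a,[b,c,d,e,f],[]), (d,[g],[]), (g,[j],[]), (h,[i,j],[])],Split g i (Split c h (Ref a c
  a (Vec a b c d e f g h i j)) (Split b h (Ref a c a (Vec a c b d e f g h i j)) (Split e h (Ref a c
  a (Vec a b d e c f h g i j)) (Split f h (Ref a c a (Vec a b d f c e h g i j)) (Win [(d,g,g,j),
  (d,g,a,g)]))))) (Ref a a h (Vec a b c d e f h i j g))),
  ((a,c,c), [(a,[b,c,d,e,f],[]), (b,[h],[]), (d,[g],[]), (g,[j],[h,i]), (h,[i],[j]), (i,[],[j])],Win
  [(a,d,a,g), (a,b,a,h), (a,b,d,a)]),
  ((a,c,d), [(a,[b,c,e,f],[]), (d,[g,h],[]), (g,[j],[i]), (h,[i],[j]), (i,[],[j])],Win [(a,d,a,g),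
  (a,d,a,h)]),
  ((a,c,e), [(a,[b,c,d,e,f],[]), (d,[g],[]), (g,[j],[]), (h,[i],[])],Split h j (Ref a c b (Vec a b c
  d e f g h i j)) (Split i j (Ref a c b (Vec a b c d e f g i h j)) (Split g h (Ref a a h (Vec a b c
  d e f g j h i)) (Split g i (Ref a a h (Vec a b c d e f g j i h)) (Split b h (Ref a c c (Vec a b c
  d e f g h i j)) (Split b i (Ref a c c (Vec a b c d e f g i h j)) (Split c h (Ref a c c (Vec a c b
  d e f g h i j)) (Split c i (Ref a c c (Vec a c b d e f g i h j)) (Split d h (Ref a c d (Vec a b c
  d e f g h i j)) (Split d i (Ref a c d (Vec a b c d e f g i h j)) (Split e h (Ref a c c (Vec a d b
  e c f h g j i)) (Split e i (Ref a c c (Vec a d b e c f i g j h)) (Split f h (Ref a c c (Vec a d b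
  f c e h g j i)) (Split f i (Ref a c c (Vec a d b f c e i g j h)) (Cut
  [a,b,c,d,e,f,g,j]))))))))))))))),
  ((a,c,f), [(a,[b,c,d,e,f],[]), (g,[j],[]), (h,[i],[])],Split d g (Ref a c e (Vec a b c d e f g h i
  j)) (Split d j (Ref a c e (Vec a b c d e f j h i g)) (Split b g (Ref a c e (Vec a c d b e f g h i
  j)) (Split b j (Ref a c e (Vec a c d b e f j h i g)) (Split b h (Ref a c e (Vec a c d b e f h g j
  i)) (Split b i (Ref a c e (Vec a c d b e f i g j h)) (Split c g (Ref a c e (Vec a b d c e f g h i
  j)) (Split c j (Ref a c e (Vec a b d c e f j h i g)) (Split c h (Ref a c e (Vec a b d c e f h g j
  i)) (Split c i (Ref a c e (Vec a b d c e f i g j h)) (Split d h (Ref a c e (Vec a b c d e f h g j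
  i)) (Split d i (Ref a c e (Vec a b c d e f i g j h)) (Split e g (Ref a c e (Vec a b c e d f g h i
  j)) (Split e j (Ref a c e (Vec a b c e d f j h i g)) (Split e h (Ref a c e (Vec a b c e d f h g j
  i)) (Split e i (Ref a c e (Vec a b c e d f i g j h)) (Split f g (Ref a c e (Vec a b c f d e g h i
  j)) (Split f j (Ref a c e (Vec a b c f d e j h i g)) (Split f h (Ref a c e (Vec a b c f d e h g j
  i)) (Split f i (Ref a c e (Vec a b c f d e i g j h)) (Cut [a,b,c,d,e,f]))))))))))))))))))))),
  ((a,c,g), [(a,[b,c,d,e,f],[]), (b,[h],[]), (c,[i],[]), (g,[i,j],[h]), (h,[],[i,j])],Win
  [(a,c,b,a), (a,i,a,g), (a,c,a,i)]),
  ((a,c,h), [(a,[b,c,d,e,f],[]), (c,[i],[]), (g,[i,j],[h]), (h,[],[i,j])],Split b h (Ref a c g (Vec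
  a b c d e f g h i j)) (Split d h (Ref a c g (Vec a d c b e f g h i j)) (Split e h (Ref a c g (Vec
  a e c b d f g h i j)) (Split f h (Ref a c g (Vec a f c b d e g h i j)) (Split c h (Win [(a,i,a,g),
  (a,i,a,c)]) (Cut [a,b,c,d,e,f,g,i,j])))))),
  ((a,c,i), [(a,[b,c,d,e,f],[]), (b,[h],[]), (f,[g],[]), (g,[i,j],[h]), (h,[],[i,j])],Win
  [(a,f,b,a), (a,f,a,g)]),
  ((a,c,j), [(a,[b,c,d,e],[]), (f,[g,h],[]), (g,[i,j],[]), (h,[],[i,j])],Win [(a,f,a,g)]),
  ((a,d,a), [(a,[b,c,d,e,f],[]), (f,[g],[]), (g,[i,j],[h]), (h,[],[i,j])],Split b h (Ref a c i (Vec
  a b c d e f g h i j)) (Split c h (Ref a c i (Vec a c b d e f g h i j)) (Split d h (Ref a c i (Vec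
  a d b c e f g h i j)) (Split e h (Ref a c i (Vec a e b c d f g h i j)) (Split f h (Ref a c j (Vec
  a b c d e f g h i j)) (Cut [a,b,c,d,e,f,g,i,j])))))),
  ((a,d,b), [(a,[b,c,d,e,f],[]), (g,[i,j],[]), (h,[],[i])],Split h j (Ref a c f (Vec a b c d e f g h
  j i)) (Split g h (Ref a b d (Vec a g b c d e f h i j)) (Split c i (Ref a c h (Vec a b c d e f g h
  i j)) (Split b i (Ref a c h (Vec a c b d e f g h i j)) (Split b j (Ref a c h (Vec a c b d e f g h
  j i)) (Split c j (Ref a c h (Vec a b c d e f g h j i)) (Split d i (Ref a c h (Vec a b d c e f g h
  i j)) (Split d j (Ref a c h (Vec a b d c e f g h j i)) (Split e i (Ref a c h (Vec a b e c d f g h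
  i j)) (Split f i (Ref a c h (Vec a b f c d e g h i j)) (Split e j (Ref a c h (Vec a b e c d f g h
  j i)) (Split f j (Ref a c h (Vec a b f c d e g h j i)) (Split f g (Ref a d a (Vec a b c d e f g h
  i j)) (Split b g (Ref a d a (Vec a c d e f b g h i j)) (Split c g (Ref a d a (Vec a b d e f c g h
  i j)) (Split d g (Ref a d a (Vec a b c e f d g h i j)) (Split e g (Ref a d a (Vec a b c d f e g h
  i j)) (Cut [a,b,c,d,e,f,h])))))))))))))))))),
  ((a,d,c), [(a,[b,c,d,e,f],[]), (b,[h],[]), (c,[g],[]), (d,[i],[]), (g,[j],[h,i]), (h,[],[i,j]),
  (i,[],[j])],Win [(a,c,d,a), (a,c,b,a), (a,c,a,g)]),
  ((a,d,d), [(a,[b,c,d,e,f],[]), (b,[h],[]), (c,[g],[]), (g,[j],[h,i]), (h,[],[i,j]),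
  (i,[],[j])],Split d i (Ref a d c (Vec a b c d e f g h i j)) (Split e i (Ref a d c (Vec a b c e d f
  g h i j)) (Split f i (Ref a d c (Vec a b c f d e g h i j)) (Split b i (Win [(a,c,b,a), (a,c,a,g)])
  (Split c i (Win [(a,c,b,a), (a,c,a,g)]) (Cut [a,b,c,d,e,f,g,h,j])))))),
  ((a,d,e), [(a,[b,c,d,e,f],[]), (c,[g],[]), (g,[j],[h,i]), (h,[],[i,j]), (i,[],[j])],Split b h (Ref
  a d d (Vec a b c d e f g h i j)) (Split b i (Ref a d d (Vec a b c d e f g i h j)) (Split d h (Ref
  a d d (Vec a d c b e f g h i j)) (Split d i (Ref a d d (Vec a d c b e f g i h j)) (Split e h (Ref
  a d d (Vec a e c b d f g h i j)) (Split e i (Ref a d d (Vec a e c b d f g i h j)) (Split f h (Ref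
  a d d (Vec a f c b d e g h i j)) (Split c h (Split f i (Ref a d d (Vec a f c b d e g i h j))
  (Split c i (Ref a c j (Vec a b d e f g c j h i)) (Cut [a,b,c,d,e,f,g,h,j]))) (Cut
  [a,b,c,d,e,f,g,i,j]))))))))),
  ((a,d,f), [(a,[b,c,d,e,f],[]), (g,[j],[])],Split h i (Ref a c f (Vec a b c d e f g h i j)) (Split
  g i (Ref a d b (Vec a b c d e f g h i j)) (Split g h (Ref a d b (Vec a b c d e f g i h j)) (Split
  h j (Ref a d b (Vec a b c d e f j i g h)) (Split i j (Ref a d b (Vec a b c d e f j h g i)) (Split
  c g (Ref a d e (Vec a b c d e f g h i j)) (Split b g (Ref a d e (Vec a c b d e f g h i j)) (Split
  b j (Ref a d e (Vec a c b d e f j h i g)) (Split c j (Ref a d e (Vec a b c d e f j h i g)) (Split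
  d g (Ref a d e (Vec a b d c e f g h i j)) (Split d j (Ref a d e (Vec a b d c e f j h i g)) (Split
  e g (Ref a d e (Vec a b e c d f g h i j)) (Split e j (Ref a d e (Vec a b e c d f j h i g)) (Split
  f g (Ref a d e (Vec a b f c d e g h i j)) (Split f j (Ref a d e (Vec a b f c d e j h i g)) (Cut
  [a,b,c,d,e,f,h,i])))))))))))))))),
  ((a,d,g), [(a,[b,c,d,e,f],[]), (b,[h],[]), (c,[j],[]), (d,[g],[]), (e,[i],[]), (g,[],[h,i,j]),
  (h,[],[i,j]), (i,[],[j])],Win [(a,c,d,a), (a,b,e,a), (a,c,b,a)]),
  ((a,d,h), [(a,[b,c,d,e,f],[]), (c,[h,j],[]), (d,[g],[]), (e,[i],[]), (g,[],[h,i,j]), (h,[],[i]),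
  (i,[],[j])],Win [(a,d,c,a), (a,d,e,a)]),
  ((a,d,i), [(a,[b,c,d,e,f],[]), (c,[j],[]), (d,[g],[]), (e,[i],[]), (g,[],[h,i,j]), (h,[],[i,j]),
  (i,[],[j])],Split b h (Ref a d g (Vec a b c d e f g h i j)) (Split f h (Ref a d g (Vec a c d e f b
  i j h g)) (Split c h (Ref a d h (Vec a b c d e f g h i j)) (Split d h (Ref a d h (Vec a b d c e f
  j g i h)) (Split e h (Ref a d h (Vec a b e c d f j h g i)) (Cut [a,b,c,d,e,f,g,i,j])))))),
  ((a,d,j), [(a,[b,c,d,e,f],[]), (b,[],[j]), (c,[],[j]), (d,[g,h],[]), (e,[i],[]), (f,[],[j]),
  (g,[],[i,j]), (h,[],[i,j]), (i,[],[j])],Split e j (Win [(a,d,e,a)]) (Split d j (Win [(a,e,d,a)])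
  (Cut [a,b,c,d,e,f,g,h,i]))),
  ((a,e,a), [(a,[b,c,d,e,f],[]), (d,[g],[]), (e,[i],[]), (g,[],[h,i,j]), (h,[],[i,j]),
  (i,[],[j])],Split c j (Ref a d i (Vec a b c d e f g h i j)) (Split c h (Ref a d i (Vec a b c d e f
  g j i h)) (Split b h (Ref a d i (Vec a c b d e f g j i h)) (Split b j (Ref a d i (Vec a c b d e f
  g h i j)) (Split f h (Ref a d i (Vec a b d e f c i j h g)) (Split f j (Ref a d i (Vec a b d e f c
  i h j g)) (Split d h (Ref a d j (Vec a b c d e f g h i j)) (Split e h (Ref a d j (Vec a b c e d f
  h i g j)) (Cut [a,b,c,d,e,f,g,i,j]))))))))),
  ((a,e,b), [(a,[b,c,d,e,f],[]), (e,[i],[]), (g,[],[h,i,j]), (h,[],[i,j]), (i,[],[j])],Split d g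
  (Ref a e a (Vec a b c d e f g h i j)) (Split b g (Ref a e a (Vec a c d b e f g h i j)) (Split b h
  (Ref a e a (Vec a c d b e f h g i j)) (Split c g (Ref a e a (Vec a b d c e f g h i j)) (Split c h
  (Ref a e a (Vec a b d c e f h g i j)) (Split d h (Ref a e a (Vec a b c d e f h g i j)) (Split f g
  (Ref a e a (Vec a b c e f d i h g j)) (Split e g (Split b i (Ref a e a (Vec a c d b e f i h g j))
  (Split c i (Ref a e a (Vec a b d c e f i h g j)) (Split d i (Ref a e a (Vec a b c d e f i h g j))
  (Split f i (Ref a e a (Vec a b c e f d g h i j)) (Split f h (Ref a e a (Vec a b c e f d g i h j))
  (Split e h (Win [(a,j,e,j)]) (Cut [a,b,c,d,e,f,g,i,j]))))))) (Cut [a,b,c,d,e,f,h,i,j]))))))))),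
  ((a,e,c), [(a,[b,c,d,e,f],[])],Split g j (Ref a d f (Vec a b c d e f g h i j)) (Split g h (Ref a d
  f (Vec a b c d e f g i j h)) (Split g i (Ref a d f (Vec a b c d e f g h j i)) (Split h i (Ref a d
  f (Vec a b c d e f h g j i)) (Split h j (Ref a d f (Vec a b c d e f h g i j)) (Split i j (Ref a d
  f (Vec a b c d e f i g h j)) (Split e i (Ref a e b (Vec a b c d e f g h i j)) (Split b i (Ref a e
  b (Vec a c d e b f g h i j)) (Split c i (Ref a e b (Vec a b d e c f g h i j)) (Split d i (Ref a e
  b (Vec a b c e d f g h i j)) (Split f i (Ref a e b (Vec a b c d f e g h i j)) (Cut
  [a,b,c,d,e,f,g,h,j]))))))))))))]"

definition table5 :: table where
  "table5 = fold store refutations5 table6"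

lemma check_refutations5: "check_all 5 table6 refutations5"
  by code_simp

lemma last_refutations5: "refutations5 \<noteq> [] \<and> fst (snd (last refutations5)) = star (Suc 4)"
  by code_simp

text \<open>Five vertices remain outside. The pattern \<open>(b,b,a)\<close> has two disjoint edges
  among them and \<open>(b,c,g)\<close> one; after the ten splits that exclude every such edge,
  \<open>(b,d,g)\<close> attaches \<open>h\<close> to a neighbour of \<open>a\<close>.\<close>

definition refutations4 :: "refutation list" where
  "refutations4 = [
  ((a,e,d), [(a,[b,c,d,e],[]), (b,[g,i],[]), (c,[i,j],[]), (d,[g],[]), (e,[g],[]), (f,[i,j],[]),
  (h,[i,j],[])],Win [(g,j,g,c), (g,j,b,j)]),
  ((a,e,e), [(a,[b,c,d,e],[]), (b,[g],[]), (c,[j],[]), (d,[g],[]), (e,[g],[]), (f,[i],[]),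
  (g,[h],[]), (h,[i,j],[])],Split f j (Split c i (Split b i (Ref a e d (Vec a b c d e f g h i j))
  (Split d i (Ref a e d (Vec a d c b e f g h i j)) (Split c e (Win [(f,g,f,e), (g,i,g,c),
  (f,g,i,g)]) (Win [(g,j,g,c), (f,g,j,g), (h,j,g,j), (f,h,j,g), (f,h,f,g), (h,j,g,f), (f,j,f,h),
  (f,j,j,h)])))) (Ref a c d (Vec g b d j e h c f i a))) (Ref a c j (Vec a b c d e i h f g j))),
  ((a,e,f), [(a,[b,c,d,e],[]), (c,[j],[]), (d,[g],[]), (f,[h,i,j],[g]), (g,[],[h,i,j])],Win
  [(a,j,a,f), (a,c,d,a), (a,c,a,j)]),
  ((a,e,g), [(a,[b,c,d,e],[]), (b,[g],[]), (c,[j],[]), (d,[j],[f]), (f,[i,j],[g]), (g,[],[h,i]),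
  (h,[i,j],[])],Win [(a,d,b,a), (a,j,a,d), (a,h,a,j), (c,i,a,h), (a,i,a,h), (c,i,a,i)]),
  ((a,e,h), [(a,[b,c,d,e],[]), (b,[g],[]), (c,[j],[]), (d,[g,j],[]), (f,[i,j],[g]), (g,[],[h,i]),
  (h,[i,j],[])],Split d f (Win [(a,f,a,d), (a,i,a,f), (c,i,a,f), (c,i,a,i)]) (Ref a e g (Vec a b c d
  e f g h i j))),
  ((a,e,i), [(a,[b,c,d,e],[]), (b,[g],[j]), (c,[j],[]), (d,[],[j]), (e,[g],[]), (f,[i,j],[g]),
  (g,[],[h,i,j]), (h,[i,j],[])],Split e j (Ref a e h (Vec a b c e d f g h i j)) (Win [(a,c,e,a),
  (a,i,c,i), (a,j,a,c), (a,h,a,i), (a,j,a,h)])),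
  ((a,e,j), [(a,[b,c,d,e],[]), (c,[j],[]), (d,[g],[]), (f,[i],[j]), (g,[],[h,j]),
  (h,[i,j],[])],Split f g (Ref a c d (Vec a b c i d e f h j g)) (Split g i (Ref a c j (Vec a b c d e
  h i j f g)) (Win [(a,c,d,a), (a,h,a,i), (a,j,a,c), (a,j,a,h)]))),
  ((a,f,a), [(a,[b,c,d,e],[]), (b,[g],[]), (c,[j],[]), (d,[g],[]), (e,[g],[]), (f,[i],[]),
  (h,[i,j],[])],Split g h (Ref a e e (Vec a b c d e f g h i j)) (Split g j (Split f j (Win
  [(a,h,a,j), (a,i,a,h), (c,i,a,h), (c,i,a,i)]) (Ref a c d (Vec a b c h d e i j g f))) (Split f j
  (Split f g (Ref a e e (Vec a b c d e h g f i j)) (Split g i (Ref a c j (Vec g b d e i c j a f h))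
  (Split d j (Ref a e h (Vec a b c d e f g h i j)) (Split b j (Ref a e h (Vec a d c b e f g h i j))
  (Ref a e i (Vec a b c d e f g h i j)))))) (Ref a e j (Vec a b c d e f g h i j))))),
  ((a,f,b), [(a,[b,c,d,e],[]), (f,[h],[]), (g,[h],[]), (h,[i,j],[])],Win [(a,h,a,h)]),
  ((a,f,c), [(a,[b,c,d,e],[]), (b,[f],[]), (c,[],[g]), (d,[g,j],[]), (e,[],[g]), (f,[h,i],[]),
  (h,[i,j],[])],Win [(a,h,d,f)]),
  ((a,f,d), [(a,[b,c,d,e],[]), (b,[],[h]), (c,[],[g]), (d,[g,j],[]), (e,[],[g]), (f,[h,i],[]),
  (h,[i,j],[])],Split b f (Ref a f c (Vec a b c d e f g h i j)) (Split b i (Ref a f c (Vec a b c d e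
  i g h f j)) (Win [(d,h,a,h), (d,j,a,h), (d,j,a,d), (d,h,d,j)]))),
  ((a,f,e), [(a,[b,c,d,e],[]), (b,[g],[]), (c,[],[g]), (d,[],[j]), (e,[],[g]), (f,[g,h,i],[]),
  (h,[i,j],[])],Win [(b,h,a,f), (b,h,a,h)]),
  ((a,f,f), [(a,[b,c,d,e],[]), (b,[g],[]), (c,[j],[g]), (d,[],[j]), (e,[],[g]), (f,[h],[g]),
  (g,[],[h]), (h,[i,j],[])],Split d i (Win [(b,h,a,h), (b,i,a,h), (b,h,b,i)]) (Win [(a,j,a,h),
  (b,j,a,h), (b,h,a,h), (a,j,b,h), (b,j,b,h), (b,c,a,j), (a,c,b,j), (a,c,a,j), (b,c,b,j), (a,b,c,a),
  (a,b,c,b)])),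
  ((a,f,g), [(a,[b,c,d,e],[]), (b,[g],[]), (c,[j],[]), (d,[g],[]), (e,[],[g]), (f,[h,i],[]),
  (h,[i,j],[])],Split g h (Ref a f b (Vec a b c d e f g h i j)) (Split c g (Split g j (Ref a c j
  (Vec a b c d e j h g f i)) (Split f j (Split g i (Ref a c j (Vec a b c d e i f g h j)) (Split b f
  (Ref a e i (Vec a c b e d i g j h f)) (Win [(a,j,a,f), (d,j,a,f), (c,d,j,d), (a,c,a,j), (c,d,j,a),
  (a,c,d,j), (a,d,c,a), (a,d,c,d)]))) (Ref a e j (Vec a d c b e f g h i j)))) (Split b h (Ref a c j
  (Vec h b f i j d a g c e)) (Split d j (Ref a f d (Vec a b c d e f g h i j)) (Split f g (Ref a f e
  (Vec a b c d e f g h i j)) (Ref a f f (Vec a b c d e f g h i j))))))),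
  ((a,f,h), [(a,[b,c,d,e],[]), (b,[e,f,g],[]), (c,[],[g]), (d,[g],[]), (e,[],[g]), (f,[i],[]),
  (h,[i],[]), (i,[j],[])],Win [(d,i,a,i), (d,f,a,i), (d,i,d,f)]),
  ((a,f,i), [(a,[b,c,d,e],[]), (b,[g],[]), (c,[j],[f,g]), (d,[g],[]), (e,[],[g]), (f,[i],[]),
  (g,[],[i]), (h,[i,j],[]), (i,[j],[])],Split b e (Split b f (Ref a f h (Vec a b c d e f g h i j))
  (Split g h (Ref a f e (Vec a d c b e h g i j f)) (Split b j (Ref a f h (Vec a b c d e j g f i h))
  (Ref a f f (Vec a d c b e h g i f j))))) (Win [(d,i,a,i), (d,j,a,i), (g,j,d,i), (g,i,d,i),
  (g,j,g,i), (d,j,g,i), (c,g,j,d), (c,g,j,g)])),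
  ((a,f,j), [(a,[b,c,d,e],[]), (c,[g,j],[]), (f,[i],[g]), (g,[],[h,i]), (h,[i],[]), (i,[j],[])],Win
  [(a,j,a,i), (a,j,a,c)]),
  ((a,g,a), [(a,[b,c,d,e],[]), (b,[j],[]), (c,[j],[]), (d,[g],[]), (e,[j],[]), (f,[i],[]),
  (h,[i,j],[])],Split g h (Ref a f a (Vec a b d c e f j h i g)) (Ref a e j (Vec a c b d e f g h i
  j))),
  ((a,g,b), [(a,[b,c,d,e],[]), (b,[],[j]), (c,[],[g]), (d,[],[j]), (e,[f,j],[]), (f,[i],[]),
  (g,[i],[]), (h,[i],[]), (i,[],[j])],Split c h (Win [(e,h,a,i), (e,i,a,i), (e,i,e,h)]) (Win
  [(e,f,a,i), (e,i,a,i), (a,f,e,i), (e,f,e,i), (a,e,a,f), (a,e,e,f)])),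
  ((a,g,c), [(a,[b,c,d,e],[]), (b,[h],[]), (c,[f],[]), (d,[],[j]), (e,[f],[]), (f,[g,i],[]),
  (g,[],[h]), (h,[i,j],[])],Win [(b,f,h,f), (a,f,b,f), (a,i,b,f), (a,f,a,i)]),
  ((a,g,d), [(a,[b,c,d,e],[]), (b,[],[h,j]), (c,[f],[]), (d,[],[h,j]), (e,[j],[]), (f,[g,i],[]),
  (h,[j],[])],Win [(e,f,a,f), (e,f,j,f)]),
  ((a,g,e), [(a,[b,c,d,e],[]), (b,[],[j]), (c,[],[f]), (d,[],[j]), (e,[f],[]), (f,[i],[g]),
  (g,[h],[]), (h,[i,j],[])],Win [(a,i,a,h), (e,h,a,h), (e,h,a,i)]),
  ((a,g,f), [(a,[b,c,d,e],[]), (b,[g,h],[]), (c,[],[f,g]), (d,[],[j]), (e,[f,j],[]), (f,[g,i],[]),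
  (g,[],[h]), (h,[i,j],[]), (i,[],[j])],Win [(b,e,h,a), (e,h,a,h), (a,f,b,e), (b,f,b,e), (a,i,a,f),
  (b,f,a,i), (e,h,a,i), (e,h,f,b)]),
  ((a,g,g), [(a,[b,c,d,e],[]), (b,[g],[]), (c,[j],[g]), (d,[g],[]), (e,[f,j],[g]), (f,[i],[h]),
  (h,[i,j],[]), (i,[],[j])],Split b j (Ref a g a (Vec a b c d e f g h i j)) (Split d j (Ref a g a
  (Vec a c d b e f g h i j)) (Split g i (Ref a g b (Vec a b c d e f g h i j)) (Split c f (Split b f
  (Ref a g a (Vec a b c d e j g i h f)) (Split d f (Ref a g a (Vec a c d b e j g i h f)) (Split g h
  (Ref a g b (Vec a b e d c j g i h f)) (Split f j (Split c h (Ref a f a (Vec f c e i j d h b g a))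
  (Ref a e g (Vec a b e c d h g f i j))) (Split f g (Split b h (Ref a g c (Vec a b c d e f g h i j))
  (Split d h (Ref a g c (Vec a d c b e f g h i j)) (Ref a g d (Vec a b c d e f g h i j)))) (Ref a e
  j (Vec a d c b e j g i h f))))))) (Split g h (Split f g (Split b f (Ref a f f (Vec a b d e c j f h
  i g)) (Win [(d,i,a,h), (e,i,a,h), (a,i,e,i), (a,i,d,i)])) (Ref a g e (Vec a b c d e f g h i j)))
  (Split f j (Split b f (Ref a e i (Vec a d e c b i g j h f)) (Win [(e,i,a,h), (a,i,e,i), (a,f,a,i),
  (a,j,a,f), (d,j,a,f), (d,e,a,j), (a,e,d,j), (d,e,d,j), (a,e,a,j), (a,d,e,d), (a,d,e,a)])) (Split f
  g (Split b h (Ref a g f (Vec a b c d e f g h i j)) (Split d h (Ref a g f (Vec a d c b e f g h i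
  j)) (Ref a g d (Vec a b e d c f g h i j)))) (Ref a e j (Vec a c e b d j g i h f))))))))),
  ((a,g,h), [(a,[c,d,e],[]), (b,[i],[]), (c,[j],[g]), (d,[g],[j]), (e,[],[g,j]), (f,[i],[]),
  (g,[],[j]), (h,[i],[])],Win [(a,i,d,i), (a,i,c,i)]),
  ((a,g,i), [(a,[b,c,d,e],[]), (b,[g,i],[]), (c,[j],[f,g]), (d,[g],[]), (e,[f],[g,j]), (f,[i],[h]),
  (h,[i,j],[])],Split d i (Ref a e j (Vec i d f b h j g a c e)) (Split g j (Win [(b,h,a,h),
  (b,h,a,i), (d,i,a,i), (d,i,a,h), (g,i,d,i), (b,g,i,d), (b,g,i,g), (b,h,g,i), (a,j,b,g),
  (a,j,b,h)]) (Split d j (Win [(d,i,a,h), (a,i,d,i)]) (Ref a g h (Vec a b c d e f g h i j))))),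
  ((a,g,j), [(a,[b,c,d,e],[]), (b,[g],[]), (c,[j],[]), (d,[g],[]), (e,[f],[g]), (f,[i],[h]),
  (h,[i,j],[]), (i,[],[j])],Split c g (Ref a f a (Vec a b e c d j g i h f)) (Split e j (Ref a g g
  (Vec a b c d e f g h i j)) (Split c f (Ref a g g (Vec a b e d c j g i h f)) (Split b i (Ref a g i
  (Vec a b c d e f g h i j)) (Split b h (Ref a g i (Vec a b e d c j g i h f)) (Split d h (Ref a g i
  (Vec a d e b c j g i h f)) (Split d i (Ref a g i (Vec a d c b e f g h i j)) (Split f g (Win
  [(c,f,j,f), (c,g,j,f), (a,f,c,g), (a,f,c,f)]) (Split f j (Split g h (Ref a g e (Vec a b c d e f g
  h j i)) (Split b c (Win [(c,i,a,i), (a,f,c,i), (a,j,a,f), (d,f,a,f), (d,j,a,f), (d,j,d,f),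
  (a,j,d,f), (c,d,j,d), (c,d,j,a)]) (Win [(c,f,j,f), (a,f,c,f), (d,f,a,f), (f,g,f,d), (e,g,f,d),
  (e,g,f,g)]))) (Win [(a,h,a,i), (a,j,a,h), (b,j,a,h), (b,h,a,h), (a,j,b,h), (b,j,b,h), (a,c,a,j),
  (c,g,j,b), (a,c,b,j), (b,c,b,j), (b,c,a,j), (a,b,c,g), (a,b,c,a), (a,b,c,b)])))))))))),
  ((a,h,a), [(a,[b,c,d,e],[]), (b,[h],[]), (f,[i,j],[g]), (g,[h],[i]), (h,[i,j],[])],Win [(a,j,a,h),
  (b,f,a,j), (a,f,a,j), (b,f,a,f)]),
  ((a,h,b), [(a,[b,c,d,e],[]), (c,[j],[]), (e,[],[f]), (f,[i,j],[g]), (g,[h],[i]),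
  (h,[i,j],[])],Split b h (Ref a h a (Vec a b c d e f g h i j)) (Split d h (Ref a h a (Vec a d b c e
  f g h i j)) (Win [(c,i,a,h), (a,j,a,h), (a,f,a,j), (a,f,c,i)]))),
  ((a,h,c), [(a,[b,c,d,e],[]), (b,[c,g],[]), (c,[j],[]), (d,[g,h],[]), (e,[],[f,g]), (f,[i],[]),
  (g,[],[h]), (h,[i,j],[]), (i,[],[j])],Split d f (Win [(c,d,a,h), (c,i,a,h), (b,f,c,d), (c,i,b,f),
  (a,i,b,f), (a,i,c,i)]) (Split f g (Split c f (Win [(b,h,a,h), (g,j,b,h), (g,h,b,h), (g,h,g,j)])
  (Win [(b,h,g,h), (b,h,a,h)])) (Win [(b,h,c,i), (b,h,a,h)]))),
  ((a,h,d), [(a,[b,c,d,e],[]), (b,[g,i],[]), (c,[i,j],[]), (d,[g],[]), (e,[],[f]), (f,[i],[h]),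
  (g,[j],[]), (h,[i,j],[])],Win [(c,g,i,g), (b,j,i,g), (a,j,c,g), (a,j,b,j)]),
  ((a,h,e), [(a,[b,c,d,e],[]), (b,[g],[]), (c,[j],[]), (d,[g,h],[]), (e,[],[f,g]), (f,[i],[h]),
  (g,[],[h]), (h,[i,j],[]), (i,[],[j])],Split b c (Ref a h c (Vec a b c d e f g h i j)) (Split b h
  (Split c d (Ref a h c (Vec a d c b e f g h i j)) (Split g i (Win [(c,h,a,h), (h,j,h,c), (i,j,h,c),
  (h,i,j,i), (h,i,j,h)]) (Split b f (Win [(b,h,a,h), (c,h,a,h), (f,j,b,h), (b,j,b,h), (i,j,h,c),
  (h,j,h,c), (h,i,j,h), (f,j,b,j), (h,i,j,f), (i,j,f,j), (i,j,i,h)]) (Split f g (Split c f (Ref a c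
  d (Vec h b d c i j a f g e)) (Win [(d,h,a,h), (d,h,g,h), (d,j,d,h), (a,h,d,h), (d,j,a,h)])) (Win
  [(d,h,a,h), (c,h,a,h), (d,j,d,h), (h,j,h,c), (h,j,d,j), (h,i,j,h), (i,j,h,j), (i,j,i,h)])))))
  (Split c i (Split g j (Split b i (Ref a h d (Vec a b c d e f g h i j)) (Win [(c,g,i,g), (c,d,i,g),
  (c,d,a,h), (a,j,d,c), (a,j,c,g)])) (Split f j (Split b e (Split d e (Ref a f a (Vec d a h e g f b
  c j i)) (Split b f (Win [(c,d,a,h), (d,i,a,h), (c,g,c,d), (a,c,d,c), (b,c,a,c), (c,g,c,b),
  (g,i,g,c), (d,i,g,i), (c,d,i,g), (h,i,d,c), (h,i,d,i)]) (Win [(c,d,a,h), (a,c,d,c), (b,c,a,c),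
  (c,g,c,b), (c,d,c,g), (d,i,g,c), (h,i,d,i), (h,i,d,c)]))) (Win [(d,i,a,h), (c,d,a,h), (c,g,c,d),
  (g,i,d,c), (h,i,d,c), (g,i,g,c), (f,g,i,g), (d,i,g,f), (d,f,g,f), (h,i,d,i), (h,i,d,f)])) (Ref a e
  j (Vec a d c b e f g h i j)))) (Split b f (Split c d (Win [(b,h,a,h), (b,j,a,h), (b,j,b,h),
  (b,c,b,j), (g,j,b,j), (b,c,g,j)]) (Win [(b,h,a,h), (b,j,a,h), (b,h,b,j)])) (Split d f (Win
  [(b,h,a,h), (b,j,a,h), (d,h,a,h), (d,j,a,h), (d,h,d,j), (g,h,d,h), (b,h,g,h), (b,j,g,h),
  (b,j,b,h)]) (Split c g (Win [(c,h,c,i), (g,h,c,i), (b,h,a,h), (b,d,a,h), (a,j,c,h), (d,g,h,g),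
  (b,d,g,h), (b,h,g,h), (b,j,g,h), (a,d,c,h), (a,d,b,h), (d,g,h,b), (a,j,b,h), (b,j,b,h), (b,d,b,h),
  (a,b,d,b), (a,c,a,j), (a,c,b,j), (a,b,c,a), (d,g,a,c), (a,d,c,a), (a,b,d,a), (a,b,d,g)]) (Split f
  g (Split g j (Win [(d,j,a,h), (h,j,i,j), (d,j,h,j), (d,h,h,j), (d,h,d,j), (a,h,d,h), (a,j,d,h),
  (a,h,a,j)]) (Win [(c,i,a,f), (a,i,a,f), (a,h,c,i), (a,h,a,i)])) (Win [(a,h,b,h),
  (a,h,c,i)])))))))),
  ((a,h,f), [(a,[b,c,d,e],[]), (b,[],[h,i]), (c,[i],[]), (d,[g],[h]), (e,[],[f,g]), (f,[i,j],[g]),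
  (g,[],[h,j]), (h,[i,j],[])],Win [(c,j,a,h), (a,f,c,j), (a,i,a,f), (a,c,a,i), (c,d,i,a), (a,d,c,a),
  (a,d,c,d)]),
  ((a,h,g), [(a,[b,c,d,e],[]), (b,[g],[]), (c,[j],[]), (d,[g],[]), (f,[i],[]), (h,[i,j],[])],Split e
  g (Ref a f a (Vec a b c d e f g h i j)) (Split f h (Ref a f g (Vec a b c d e f g h i j)) (Split i
  j (Split c f (Ref a f g (Vec a b c d e h g i j f)) (Split g i (Ref a f b (Vec a b c d e f g i h
  j)) (Split f g (Split c g (Ref a c j (Vec a b c d e f i g h j)) (Ref a f i (Vec a b c d e f g h i
  j))) (Split c g (Split g h (Ref a c j (Vec a b c d e h i g f j)) (Ref a f j (Vec a b c d e f g h i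
  j))) (Ref a f i (Vec a b c d e f g h i j)))))) (Split e f (Ref a g j (Vec a b c d e f g h i j))
  (Split g h (Split f g (Split c i (Win [(c,g,a,h)]) (Split b i (Win [(b,g,a,h), (c,g,a,h),
  (a,g,b,g), (a,g,c,g)]) (Win [(b,g,a,h), (d,h,a,h), (c,g,a,h), (a,g,c,g), (b,g,a,g), (d,h,a,g),
  (g,h,b,g), (g,h,d,h)]))) (Split f j (Split g i (Ref a g c (Vec a c b e d g i j h f)) (Ref a h b
  (Vec a b c d e f g h i j))) (Ref a c j (Vec a b c d e i h f g j)))) (Split d h (Ref a h e (Vec a b
  c d e f g h i j)) (Split b h (Ref a h e (Vec a d c b e f g h i j)) (Split c i (Split g j (Split b
  i (Ref a h d (Vec a b c d e f g h i j)) (Win [(c,j,a,h), (c,g,i,g), (c,d,i,g), (a,j,c,g),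
  (c,d,j,a), (c,j,a,j), (a,c,c,j), (a,c,d,c)])) (Split f j (Split f g (Ref a h b (Vec a d c e b h g
  f j i)) (Split b i (Ref a f a (Vec i c b f h e j d a g)) (Ref a h f (Vec a b c d e f g h i j))))
  (Ref a e j (Vec a d c b e f g h i j)))) (Split f g (Split e j (Split b c (Win [(e,g,j,f),
  (c,g,j,f), (c,i,a,h), (a,f,c,i), (e,g,a,f), (c,g,a,f), (b,j,g,c), (a,b,c,g), (g,j,g,e), (a,b,e,g),
  (b,j,g,e), (c,d,j,g), (a,c,b,j), (b,e,g,j), (a,b,e,b), (a,c,d,c), (a,b,c,a)]) (Win [(c,i,a,h),
  (e,g,j,f), (c,g,j,f), (a,f,c,i), (c,g,a,f), (e,g,a,f), (d,j,g,c), (d,j,g,e)])) (Win [(c,f,a,i),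
  (c,i,a,i), (a,f,c,i), (c,f,c,i), (c,g,a,f), (c,g,c,f)])) (Split f j (Split e h (Ref a g j (Vec a b
  c d e h g f i j)) (Split b f (Ref a h e (Vec a d c b e h g f i j)) (Split d f (Ref a h e (Vec a b
  c d e h g f i j)) (Split g i (Split b j (Ref a g e (Vec a b d e c j g i f h)) (Win [(c,d,j,g),
  (c,g,j,g), (a,d,c,g), (a,g,c,g), (c,d,a,g), (a,d,a,g), (a,c,d,c), (a,c,d,a)])) (Split b j (Ref a h
  f (Vec a d c b e h g f j i)) (Ref a h f (Vec a b c d e h g f j i))))))) (Split g j (Split b i (Win
  [(a,h,a,i), (a,b,a,i), (c,i,a,h), (b,j,a,h), (a,g,b,j), (b,c,b,j), (a,b,a,g), (c,i,a,b),
  (b,c,b,a), (c,i,c,b)]) (Win [(a,h,a,i), (a,j,a,h), (d,h,a,h), (a,j,d,h)])) (Ref a e j (Vec a d c b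
  e f g h i j))))))))))))),
  ((a,h,h), [(a,[b,c,d,e],[]), (b,[],[g]), (c,[j],[]), (d,[g],[]), (e,[],[g]), (f,[h,i],[]),
  (h,[i,j],[])],Split c g (Split d h (Ref a c j (Vec h d f i j c a g b e)) (Ref a f d (Vec a d b c e
  f g h i j))) (Ref a b j (Vec a b f d c e g h i j))),
  ((a,h,i), [(a,[b,c,d,e],[]), (b,[],[g]), (c,[j],[g]), (d,[f,g],[]), (e,[f],[g]), (f,[i],[]),
  (h,[i,j],[])],Split f j (Split b d (Win [(a,i,d,h), (a,h,d,h), (e,h,a,h), (e,h,a,i)]) (Win
  [(e,h,a,h), (f,j,d,h), (e,j,a,h), (f,j,e,h), (e,j,f,j), (c,f,j,f), (c,f,j,e)])) (Win [(a,i,d,h),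
  (a,h,d,h), (a,i,a,h)])),
  ((a,h,j), [(a,[b,c,d,e],[]), (b,[],[g]), (c,[j],[g]), (d,[g],[f,j]), (e,[f],[g]), (f,[i],[]),
  (g,[j],[]), (h,[i,j],[])],Split b f (Ref a h g (Vec a b d e c i f j h g)) (Split c f (Ref a h g
  (Vec a c d e b i f j h g)) (Split d i (Win [(f,h,i,j), (e,h,a,h), (h,i,j,i), (c,i,j,i), (a,i,c,i),
  (f,i,i,h), (e,h,a,i), (f,h,e,h), (f,i,e,h), (f,h,f,i)]) (Win [(e,j,a,j), (e,h,a,j), (e,h,a,h),
  (e,j,a,h), (f,j,e,h), (f,j,e,j)])))),
  ((a,i,a), [(a,[b,c,d,e],[]), (b,[i],[g]), (c,[j],[g]), (d,[g],[f,j]), (e,[],[g]), (f,[i,j],[g]),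
  (g,[],[j]), (h,[i,j],[])],Split e i (Ref a c d (Vec i b e a f h c d g j)) (Win [(b,j,a,j),
  (a,h,d,h), (a,h,b,j)])),
  ((a,i,b), [(a,[b,c,d,e],[]), (b,[],[g]), (c,[j],[]), (d,[g],[]), (e,[f],[g]), (f,[i],[]),
  (h,[i,j],[])],Split c g (Ref a h g (Vec a c e d b j g i h f)) (Split d f (Ref a h i (Vec a b c d e
  f g h i j)) (Split d j (Ref a h i (Vec a b e d c j g i h f)) (Split g j (Ref a h j (Vec a b c d e
  f g h i j)) (Split f j (Split f g (Ref a h j (Vec a b e d c j g i h f)) (Split b i (Ref a i a (Vec
  a b c d e f g h i j)) (Split e i (Ref a i a (Vec a e c d b f g h i j)) (Win [(c,j,a,j), (a,h,d,h),
  (c,h,a,j), (c,j,a,h), (c,h,a,h), (h,j,j,c), (h,j,h,c)])))) (Win [(a,i,d,i), (a,i,a,h)])))))),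
  ((a,i,c), [(a,[b,d,e],[]), (b,[],[f,g]), (c,[h],[]), (d,[f,g],[]), (e,[],[f,g]), (h,[i,j],[])],Win
  [(a,h,d,h)]),
  ((a,i,d), [(a,[b,c,d,e],[]), (b,[],[f]), (c,[],[f]), (d,[g],[]), (e,[],[f]), (f,[i],[]),
  (g,[h],[]), (h,[i,j],[])],Split d f (Ref a b j (Vec a b g d c e f h i j)) (Win [(d,h,a,h),
  (g,h,h,i), (d,h,g,h)])),
  ((a,i,e), [(a,[b,c,d,e],[]), (c,[j],[]), (d,[g],[]), (f,[i],[]), (h,[i,j],[])],Split b g (Ref a h
  g (Vec a b c d e f g h i j)) (Split e g (Ref a h g (Vec a d c e b f g h i j)) (Split f h (Ref a h
  h (Vec a b c d e f g h i j)) (Split i j (Split c f (Ref a h h (Vec a b c d e h g i j f)) (Win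
  [(d,i,a,i), (d,j,a,i), (d,i,d,j)])) (Split e f (Ref a i b (Vec a b c d e f g h i j)) (Split b f
  (Ref a i b (Vec a e c d b f g h i j)) (Split d i (Split f g (Split c d (Win [(f,j,f,c), (c,i,a,h),
  (c,i,j,f)]) (Win [(c,i,a,h), (d,j,a,h), (f,j,i,c), (g,h,d,j), (g,h,f,j)])) (Win [(d,j,i,j),
  (a,h,d,j)])) (Split c d (Split f g (Win [(c,i,a,h), (d,h,a,h), (g,j,d,h), (f,j,i,c), (f,j,g,j)])
  (Win [(d,h,a,h), (c,i,d,h)])) (Split d h (Split c f (Win [(c,d,a,h), (c,h,a,h), (d,f,d,c),
  (d,f,h,c)]) (Split g i (Win [(c,h,a,h), (i,j,h,c), (h,j,h,c), (h,i,j,h), (h,i,j,i)]) (Split f g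
  (Win [(d,j,g,h), (d,h,g,h), (a,h,d,h), (a,h,d,j)]) (Win [(c,h,j,d), (c,h,a,h), (i,j,h,c),
  (h,j,h,c), (h,i,j,h), (h,i,j,i)])))) (Split g h (Split c f (Ref a g b (Vec a b d e c j i g h f))
  (Ref a i d (Vec a b c d e f g h i j))) (Split c i (Split f j (Split c g (Win [(c,j,a,h),
  (d,h,a,h), (d,j,a,h), (g,j,c,j), (g,j,d,j), (g,j,d,h)]) (Win [(a,f,d,f), (c,j,a,h), (a,j,d,f),
  (c,j,a,f), (c,j,a,j)])) (Win [(c,d,i,g), (c,i,a,h), (a,c,d,i), (a,c,c,i), (a,c,d,c)])) (Split d f
  (Win [(d,h,a,h), (d,j,a,h), (d,j,d,h)]) (Split f g (Win [(c,i,a,h), (d,h,a,h), (d,j,a,h),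
  (a,f,c,i), (c,g,a,f), (d,j,g,c), (d,h,d,j), (g,h,d,j), (g,h,d,h)]) (Win [(a,h,c,i), (d,j,a,h),
  (d,h,a,h), (d,j,d,h)])))))))))))))),
  ((a,i,f), [(a,[b,c,d,e],[]), (b,[],[j]), (c,[],[j]), (d,[g],[]), (e,[],[j]), (f,[g,i],[]),
  (g,[],[h]), (h,[i,j],[])],Win [(d,i,g,h), (a,f,d,i), (a,i,d,i), (a,f,a,i)]),
  ((a,i,g), [(a,[b,c,d,e],[]), (b,[],[f,j]), (c,[],[f,j]), (d,[g,i],[]), (e,[],[f,j]), (f,[i],[g]),
  (g,[],[h]), (h,[i,j],[])],Win [(d,h,i,h), (a,i,d,h), (d,i,d,h), (a,d,a,i), (a,d,d,i)]),
  ((a,i,h), [(a,[b,c,d,e],[]), (b,[],[j]), (c,[],[j]), (d,[f,g],[]), (e,[],[j]), (f,[i],[]),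
  (g,[],[h,i]), (h,[i,j],[])],Win [(d,i,d,h), (a,i,d,h), (a,f,d,i), (d,f,d,i), (d,f,a,i), (a,f,a,i),
  (a,d,d,f), (a,d,a,f)]),
  ((a,i,i), [(a,[b,c,d,e],[]), (b,[h],[]), (c,[],[j]), (d,[g],[f]), (e,[],[f]), (f,[i],[g]),
  (g,[],[h,i,j]), (h,[i,j],[])],Win [(a,b,d,a), (a,h,a,b), (b,h,a,h), (b,i,a,h), (a,i,a,h),
  (b,i,a,i), (b,h,a,i), (h,i,b,i), (h,i,b,h)]),
  ((a,i,j), [(a,[b,c,d,e],[]), (d,[g],[]), (f,[i],[]), (h,[i,j],[])],Split c j (Ref a i e (Vec a b c
  d e f g h i j)) (Split b f (Ref a i e (Vec a c b d e j g i h f)) (Split b j (Ref a i e (Vec a c b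
  d e f g h i j)) (Split c f (Ref a i e (Vec a b c d e j g i h f)) (Split e f (Ref a i e (Vec a b e
  d c j g i h f)) (Split e j (Ref a i e (Vec a b e d c f g h i j)) (Split g h (Ref a i d (Vec a b c
  d e f g h i j)) (Split f g (Ref a i f (Vec a b c d e f g h i j)) (Split d i (Ref a i g (Vec a b c
  d e f g h i j)) (Split g i (Ref a i d (Vec a b c d e j g i h f)) (Split g j (Ref a i f (Vec a b c
  d e j g i h f)) (Split d f (Ref a i h (Vec a b c d e f g h i j)) (Split d j (Ref a i h (Vec a b c
  d e j g i h f)) (Split d h (Ref a i g (Vec a b c d e j g i h f)) (Split b h (Ref a i i (Vec a b c
  d e f g h i j)) (Split b i (Ref a i i (Vec a b c d e j g i h f)) (Split c h (Ref a i i (Vec a c b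
  d e f g h i j)) (Split c i (Ref a i i (Vec a c b d e j g i h f)) (Split e h (Ref a i i (Vec a e b
  d c f g h i j)) (Split e i (Ref a i i (Vec a e b d c j g i h f)) (Cut
  [a,b,c,d,e,g]))))))))))))))))))))),
  ((a,j,a), [(a,[b,c,d,e],[]), (b,[h],[]), (d,[g],[]), (f,[g,i],[h,j]), (g,[],[h,j]), (h,[j],[i]),
  (i,[],[j])],Win [(a,b,a,h), (a,g,a,f), (a,d,a,g), (a,d,b,a)]),
  ((a,j,b), [(a,[b,c,d,e],[]), (d,[g,h],[]), (f,[g,i],[h,j]), (g,[],[j]), (h,[j],[i]),
  (i,[],[j])],Win [(a,g,a,f), (a,d,a,h), (a,g,a,d)]),
  ((a,j,c), [(a,[b,c,d,e],[]), (d,[g],[]), (f,[g,i],[h,j]), (h,[j],[i]), (i,[],[j])],Split g h (Ref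
  a c d (Vec a b c g d e f h j i)) (Split g j (Ref a c d (Vec a b c g d e f j h i)) (Split b h (Ref
  a j a (Vec a b c d e f g h i j)) (Split b j (Ref a j a (Vec a b c d e f g j i h)) (Split c h (Ref
  a j a (Vec a c b d e f g h i j)) (Split c j (Ref a j a (Vec a c b d e f g j i h)) (Split d h (Ref
  a j b (Vec a b c d e f g h i j)) (Split d j (Ref a j b (Vec a b c d e f g j i h)) (Split e h (Ref
  a j a (Vec a e b d c f g h i j)) (Split e j (Ref a j a (Vec a e b d c f g j i h)) (Cut
  [a,b,c,d,e,f,g,i]))))))))))),
  ((a,j,d), [(a,[b,c,d,e],[]), (b,[f,h],[]), (d,[g],[]), (f,[i],[g,j]), (g,[],[h,i,j]), (h,[j],[i]),
  (i,[],[j])],Win [(a,b,d,a), (a,b,a,f), (a,b,a,h)]),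
  ((a,j,e), [(a,[b,c,d,e],[]), (b,[f],[]), (c,[h],[]), (d,[g],[]), (f,[i],[g,h,j]), (g,[],[h,i,j]),
  (h,[j],[i]), (i,[],[j])],Win [(a,c,d,a), (a,c,a,h), (a,b,a,f), (a,c,b,a)]),
  ((a,j,f), [(a,[b,c,d,e],[]), (b,[f],[]), (d,[g,h],[]), (f,[i],[g,h,j]), (g,[],[i,j]), (h,[j],[i]),
  (i,[],[j])],Win [(a,b,a,f), (a,d,a,h), (a,b,d,a)]),
  ((a,j,g), [(a,[b,c,d,e],[]), (b,[f],[]), (d,[g],[]), (f,[i],[g,h,j]), (g,[],[h,i,j]), (h,[j],[i]),
  (i,[],[j])],Split b h (Ref a j d (Vec a b c d e f g h i j)) (Split b j (Ref a j d (Vec a b c d e f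
  g j i h)) (Split c h (Ref a j e (Vec a b c d e f g h i j)) (Split c j (Ref a j e (Vec a b c d e f
  g j i h)) (Split d h (Ref a j f (Vec a b c d e f g h i j)) (Split d j (Ref a j f (Vec a b c d e f
  g j i h)) (Split e h (Ref a j e (Vec a b e d c f g h i j)) (Split e j (Ref a j e (Vec a b e d c f
  g j i h)) (Cut [a,b,c,d,e,f,g,i]))))))))),
  ((a,j,h), [(a,[b,c,d,e],[]), (b,[],[f,i]), (c,[],[f,i]), (d,[f,g],[]), (e,[],[f,i]),
  (f,[i],[g,h,j]), (g,[],[h,i,j]), (h,[j],[i]), (i,[],[j])],Split b g (Ref a j g (Vec a d c b e f g
  h i j)) (Split c g (Ref a j g (Vec a d b c e f g h i j)) (Split e g (Ref a j g (Vec a d b e c f g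
  h i j)) (Win [(d,j,a,h), (d,j,f,j)])))),
  ((a,j,i), [(a,[b,c,d,e],[]), (d,[g],[]), (f,[i],[]), (h,[j],[])],Split h i (Ref a i j (Vec a b c d
  e f g h i j)) (Split f h (Ref a i j (Vec a b c d e j g f h i)) (Split f j (Ref a i j (Vec a b c d
  e h g f j i)) (Split i j (Ref a i j (Vec a b c d e h g i j f)) (Split f g (Ref a j c (Vec a b c d
  e f g h i j)) (Split g h (Ref a j c (Vec a b c d e h g f j i)) (Split g i (Ref a j c (Vec a b c d
  e i g h f j)) (Split g j (Ref a j c (Vec a b c d e j g f h i)) (Split b f (Ref a j g (Vec a b c d
  e f g h i j)) (Split b i (Ref a j g (Vec a b c d e i g h f j)) (Split c f (Ref a j g (Vec a c b d
  e f g h i j)) (Split c i (Ref a j g (Vec a c b d e i g h f j)) (Split e f (Ref a j g (Vec a e b d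
  c f g h i j)) (Split e i (Ref a j g (Vec a e b d c i g h f j)) (Split d f (Ref a j h (Vec a b c d
  e f g h i j)) (Split d i (Ref a j h (Vec a b c d e i g h f j)) (Cut
  [a,b,c,d,e,g,h,j]))))))))))))))))),
  ((a,j,j), [(a,[b,c,d,e],[]), (b,[f],[]), (c,[],[g,j]), (d,[],[g,j]), (e,[],[g,j]), (f,[i],[]),
  (g,[h],[]), (h,[i,j],[])],Win [(b,h,a,i)]),
  ((b,a,a), [(a,[b,c,d,e],[]), (b,[h],[]), (c,[],[f]), (d,[],[f]), (e,[],[f]), (f,[i],[]),
  (g,[h],[]), (h,[i,j],[])],Win [(b,h,h,i), (b,h,a,h)]),
  ((b,a,b), [(a,[b,c,d,e],[]), (b,[i],[]), (c,[],[f]), (d,[],[f]), (e,[],[f]), (f,[i],[]),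
  (g,[h],[]), (h,[i,j],[])],Win [(b,h,i,h), (b,h,a,h)]),
  ((b,a,c), [(a,[b,c,d,e],[]), (b,[],[g,j]), (c,[],[g,j]), (d,[],[g,j]), (e,[],[g,j]), (f,[i],[]),
  (g,[h],[]), (h,[i,j],[])],Split b f (Ref a j j (Vec a b c d e f g h i j)) (Split c f (Ref a j j
  (Vec a c b d e f g h i j)) (Split d f (Ref a j j (Vec a d b c e f g h i j)) (Split e f (Ref a j j
  (Vec a e b c d f g h i j)) (Split b h (Ref b a a (Vec a b c d e f g h i j)) (Split b i (Ref b a b
  (Vec a b c d e f g h i j)) (Split c h (Ref b a a (Vec a c b d e f g h i j)) (Split c i (Ref b a b
  (Vec a c b d e f g h i j)) (Split d h (Ref b a a (Vec a d b c e f g h i j)) (Split d i (Ref b a b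
  (Vec a d b c e f g h i j)) (Split e i (Ref b a b (Vec a e b c d f g h i j)) (Split e h (Ref b a a
  (Vec a e b c d f g h i j)) (Cut [a,b,c,d,e]))))))))))))),
  ((b,a,d), [(a,[b,c,d,e],[]), (b,[f],[]), (c,[h],[]), (d,[],[g,j]), (e,[],[g,j]), (f,[i],[h]),
  (g,[h],[]), (h,[j],[i])],Win [(c,f,h,f), (b,c,f,h), (a,b,c,f), (a,f,c,f), (a,b,a,f), (b,c,f,a),
  (a,c,b,a), (a,c,b,c)]),
  ((b,a,e), [(a,[b,c,d,e],[]), (b,[],[g,j]), (c,[f,h],[]), (d,[],[g,j]), (e,[],[g,j]), (f,[i],[]),
  (g,[h],[]), (h,[j],[i])],Win [(c,f,h,i), (a,f,c,f), (a,c,c,f), (a,c,a,f)]),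
  ((b,a,f), [(a,[b,c,d,e],[]), (b,[],[j]), (c,[h],[]), (d,[],[j]), (e,[],[j]), (f,[g,i],[]),
  (g,[h],[]), (h,[j],[i])],Win [(c,f,h,f), (a,g,c,f), (a,f,c,f), (a,g,a,f)]),
  ((b,a,g), [(a,[b,c,d,e],[]), (b,[],[g,j]), (c,[h],[]), (d,[],[g,j]), (e,[],[g,j]), (f,[i],[h]),
  (g,[h],[]), (h,[j],[i])],Split b f (Ref b a d (Vec a b c d e f g h i j)) (Split b i (Ref b a d
  (Vec a b c d e i g h f j)) (Split c f (Ref b a e (Vec a b c d e f g h i j)) (Split c i (Ref b a e
  (Vec a b c d e i g h f j)) (Split d f (Ref b a d (Vec a d c b e f g h i j)) (Split d i (Ref b a d
  (Vec a d c b e i g h f j)) (Split e f (Ref b a d (Vec a e c b d f g h i j)) (Split e i (Ref b a d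
  (Vec a e c b d i g h f j)) (Split f g (Ref b a f (Vec a b c d e f g h i j)) (Split g i (Ref b a f
  (Vec a b c d e i g h f j)) (Split f j (Ref b a f (Vec a b c d e f j h i g)) (Split i j (Ref b a f
  (Vec a b c d e i j h f g)) (Cut [a,b,c,d,e,g,h,j]))))))))))))),
  ((b,a,h), [(a,[b,c,d,e],[]), (b,[],[j]), (c,[i],[]), (d,[],[j]), (e,[],[j]), (f,[i],[h,j]),
  (g,[h,i],[]), (h,[j],[])],Win [(a,g,a,i), (a,g,c,h)]),
  ((b,a,i), [(a,[b,c,d,e],[]), (b,[],[g,h,j]), (c,[i],[g,h,j]), (d,[],[g,h,j]), (e,[],[g,h,j]),
  (f,[i],[h]), (g,[h],[]), (h,[j],[i])],Split f g (Ref a j i (Vec a b d c e f i h g j)) (Split f j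
  (Ref a j i (Vec a b d c e f i g j h)) (Split g i (Ref b a h (Vec a b c d e f g h i j)) (Split i j
  (Ref b a h (Vec a b c d e f j h i g)) (Cut [a,b,c,d,e,f,i]))))),
  ((b,a,j), [(a,[b,c,d,e],[]), (b,[],[g]), (c,[],[g]), (d,[],[g]), (e,[],[g]), (f,[i],[]),
  (g,[h],[]), (h,[j],[])],Split b j (Ref a j i (Vec a c d b e f j g i h)) (Split c j (Ref a j i (Vec
  a b d c e f j g i h)) (Split d j (Ref a j i (Vec a b c d e f j g i h)) (Split e j (Ref a j i (Vec
  a b c e d f j g i h)) (Split h i (Ref b a c (Vec a b c d e f g h i j)) (Split f h (Ref b a c (Vec
  a b c d e i g h f j)) (Split c h (Ref b a g (Vec a b c d e f g h i j)) (Split b h (Ref b a g (Vec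
  a c b d e f g h i j)) (Split d h (Ref b a g (Vec a b d c e f g h i j)) (Split e h (Ref b a g (Vec
  a b e c d f g h i j)) (Split c i (Ref b a i (Vec a b c d e f g h i j)) (Split c f (Ref b a i (Vec
  a b c d e i g h f j)) (Split b f (Ref b a i (Vec a c b d e i g h f j)) (Split b i (Ref b a i (Vec
  a c b d e f g h i j)) (Split d f (Ref b a i (Vec a b d c e i g h f j)) (Split d i (Ref b a i (Vec
  a b d c e f g h i j)) (Split e f (Ref b a i (Vec a b e c d i g h f j)) (Split e i (Ref b a i (Vec
  a b e c d f g h i j)) (Cut [a,b,c,d,e]))))))))))))))))))),
  ((b,b,a), [(a,[b,c,d,e],[]), (f,[i],[]), (h,[j],[])],Split d g (Ref a j i (Vec a b c d e f g h i
  j)) (Split b g (Ref a j i (Vec a c d b e f g h i j)) (Split c g (Ref a j i (Vec a b d c e f g h i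
  j)) (Split e g (Ref a j i (Vec a b c e d f g h i j)) (Split g h (Ref b a j (Vec a b c d e f g h i
  j)) (Split f g (Ref b a j (Vec a b c d e h g f j i)) (Split g i (Ref b a j (Vec a b c d e h g i j
  f)) (Split g j (Ref b a j (Vec a b c d e f g j i h)) (Cut [a,b,c,d,e,f,h,i,j]))))))))),
  ((b,b,b), [(a,[b,c,d,e],[]), (e,[f],[]), (f,[i],[g]), (g,[],[h,i,j]), (h,[i],[]),
  (i,[j],[])],Split b g (Ref a e f (Vec a c e b d i g h j f)) (Split c g (Ref a e f (Vec a b e c d i
  g h j f)) (Split d g (Ref a e f (Vec a b e d c i g h j f)) (Split e g (Ref a f j (Vec a b e c d h
  g j i f)) (Cut [a,b,c,d,e,f,h,i,j]))))),
  ((b,b,c), [(a,[b,c,d,e],[]), (b,[i],[]), (c,[],[f,h,j]), (d,[],[f,h,j]), (e,[],[f,h,j]),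
  (f,[i],[]), (h,[i],[]), (i,[j],[])],Win [(b,g,a,g), (b,g,i,g)]),
  ((b,b,d), [(a,[b,c,d,e],[]), (f,[i],[g]), (g,[],[h,j]), (h,[i],[]), (i,[j],[])],Split g i (Ref a f
  b (Vec a b c d e f g i h j)) (Split e f (Ref b b b (Vec a b c d e f g h i j)) (Split b f (Ref b b
  b (Vec a c d e b f g h i j)) (Split b h (Ref b b b (Vec a c d e b h g f i j)) (Split b j (Ref b b
  b (Vec a c d e b j g f i h)) (Split c f (Ref b b b (Vec a b d e c f g h i j)) (Split d f (Ref b b
  b (Vec a b c e d f g h i j)) (Split c h (Ref b b b (Vec a b d e c h g f i j)) (Split c j (Ref b b
  b (Vec a b d e c j g f i h)) (Split d h (Ref b b b (Vec a b c e d h g f i j)) (Split e h (Ref b b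
  b (Vec a b c d e h g f i j)) (Split d j (Ref b b b (Vec a b c e d j g f i h)) (Split e j (Ref b b
  b (Vec a b c d e j g f i h)) (Split b i (Ref b b c (Vec a b c d e f g h i j)) (Split c i (Ref b b
  c (Vec a c b d e f g h i j)) (Split d i (Ref b b c (Vec a d b c e f g h i j)) (Split e i (Ref b b
  c (Vec a e b c d f g h i j)) (Cut [a,b,c,d,e,g])))))))))))))))))),
  ((b,b,e), [(a,[b,c,d,e],[]), (b,[g],[]), (c,[i],[]), (d,[j],[]), (f,[i],[g,j]), (g,[],[h,i,j]),
  (h,[i],[j]), (i,[],[j])],Win [(a,c,a,i), (a,c,d,a), (a,c,b,a)]),
  ((b,b,f), [(a,[b,c,d,e],[]), (c,[i],[]), (d,[j],[]), (f,[i],[g,j]), (g,[],[h,i,j]), (h,[i],[j]),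
  (i,[],[j])],Split b g (Ref b b e (Vec a b c d e f g h i j)) (Split e g (Ref b b e (Vec a d c e b f
  j h i g)) (Split d g (Win [(a,i,d,i), (a,c,d,a), (a,c,d,i), (a,c,a,i)]) (Split c g (Win
  [(a,c,a,i), (a,c,d,a)]) (Cut [a,b,c,d,e,f,h,i,j]))))),
  ((b,b,g), [(a,[b,c,d,e],[]), (c,[i],[]), (f,[i],[g,j]), (g,[],[h,i,j]), (h,[i],[j]),
  (i,[],[j])],Split d j (Ref b b f (Vec a b c d e f g h i j)) (Split d g (Ref b b f (Vec a b c d e f
  j h i g)) (Split b g (Ref b b f (Vec a d c b e f j h i g)) (Split b j (Ref b b f (Vec a d c b e f
  g h i j)) (Split e g (Ref b b f (Vec a b c e d f j h i g)) (Split c g (Split e j (Ref b b f (Vec a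
  b c e d f g h i j)) (Split c j (Ref a i c (Vec c g b i j f h a d e)) (Cut [a,b,c,d,e,f,g,h,i])))
  (Cut [a,b,c,d,e,f,h,i,j]))))))),
  ((b,b,h), [(a,[b,c,d,e],[]), (b,[h],[]), (c,[j],[]), (d,[g],[]), (f,[i],[g,j]), (g,[],[h,i,j]),
  (h,[i],[j]), (i,[],[j])],Win [(a,h,a,i), (a,b,d,a), (a,b,c,a), (a,h,a,b)]),
  ((b,b,i), [(a,[b,c,d,e],[]), (b,[h],[]), (c,[],[i]), (d,[g],[]), (e,[],[i]), (f,[i],[g,j]),
  (g,[],[h,i,j]), (h,[i],[j]), (i,[],[j])],Split c j (Ref b b h (Vec a b c d e f g h i j)) (Split e
  j (Ref b b h (Vec a b d e c f j h i g)) (Split d j (Win [(a,h,a,i), (d,h,a,i), (b,d,h,d),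
  (b,d,h,a), (a,b,d,h), (a,b,a,h), (a,d,b,a), (a,d,b,d)]) (Split b j (Win [(a,i,b,f), (a,b,d,a),
  (a,h,a,i), (a,h,a,b)]) (Cut [a,b,c,d,e,f,g,h,i]))))),
  ((b,b,j), [(a,[b,c,d,e],[]), (b,[h],[]), (c,[],[i]), (d,[],[i]), (e,[],[i]), (f,[i],[g,j]),
  (g,[],[h,i,j]), (h,[i],[j]), (i,[],[j])],Split d g (Ref b b i (Vec a b c d e f g h i j)) (Split d
  j (Ref b b i (Vec a b c d e f j h i g)) (Split c g (Ref b b i (Vec a b d c e f g h i j)) (Split c
  j (Ref b b i (Vec a b d c e f j h i g)) (Split e g (Ref b b i (Vec a b c e d f g h i j)) (Split b
  g (Split e j (Ref b b i (Vec a b c e d f j h i g)) (Split b j (Win [(a,h,a,b), (a,h,a,i)]) (Cut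
  [a,b,c,d,e,f,g,h,i]))) (Cut [a,b,c,d,e,f,h,i,j]))))))),
  ((b,c,a), [(a,[b,c,d,e],[]), (f,[i],[]), (g,[],[h,j]), (h,[i],[j])],Split f g (Ref b b a (Vec a b
  c d e f j h g i)) (Split f j (Ref b b a (Vec a b c d e f g h j i)) (Split i j (Ref b b d (Vec a b
  c d e f g h i j)) (Split g i (Ref b b d (Vec a b c d e f j g i h)) (Split c i (Ref b b g (Vec a b
  c d e f g h i j)) (Split b i (Ref b b g (Vec a c b d e f g h i j)) (Split d i (Ref b b g (Vec a b
  d c e f g h i j)) (Split e i (Ref b b g (Vec a b e c d f g h i j)) (Split b h (Ref b b j (Vec a b
  c d e f g h i j)) (Split b f (Ref b b j (Vec a b c d e h g f i j)) (Split c f (Ref b b j (Vec a c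
  b d e h g f i j)) (Split c h (Ref b b j (Vec a c b d e f g h i j)) (Split d f (Ref b b j (Vec a d
  b c e h g f i j)) (Split e f (Ref b b j (Vec a e b c d h g f i j)) (Split d h (Ref b b j (Vec a d
  b c e f g h i j)) (Split e h (Ref b b j (Vec a e b c d f g h i j)) (Cut
  [a,b,c,d,e,g,j]))))))))))))))))),
  ((b,c,b), [(a,[b,c,d,e],[]), (b,[h,j],[]), (c,[g],[]), (d,[i],[]), (f,[i],[g,h,j]),
  (g,[],[h,i,j]), (h,[],[i]), (i,[],[j])],Win [(a,c,b,a), (a,d,c,a), (a,d,a,i)]),
  ((b,c,c), [(a,[b,c,d,e],[]), (b,[h],[]), (c,[g],[]), (d,[i],[]), (f,[i],[g,h,j]), (g,[],[h,i,j]),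
  (h,[],[i,j]), (i,[],[j])],Split e j (Win [(a,e,b,a), (a,d,c,a), (a,d,e,a), (a,d,a,i)]) (Split b j
  (Ref b c b (Vec a b c d e f g h i j)) (Split c j (Ref b c b (Vec a c b d e f h g i j)) (Split d j
  (Win [(a,b,c,a), (a,d,b,a), (a,d,a,i)]) (Cut [a,b,c,d,e,f,g,h,i]))))),
  ((b,c,d), [(a,[b,c,d,e],[]), (b,[g,h],[]), (c,[],[g,j]), (d,[i],[]), (e,[],[g,j]), (f,[i],[h,j]),
  (g,[],[j]), (h,[],[i,j]), (i,[],[j])],Split d j (Win [(a,b,d,b), (b,i,b,d), (a,i,b,i), (a,d,b,a),
  (a,d,b,i), (a,d,a,i)]) (Split b j (Win [(a,i,b,i), (a,d,b,i), (a,d,b,a), (a,d,a,i)]) (Cut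
  [a,b,c,d,e,f,g,h,i]))),
  ((b,c,e), [(a,[b,c,d,e],[]), (b,[h],[]), (d,[i],[]), (f,[i],[g,h,j]), (g,[],[h,i,j]),
  (h,[],[i,j]), (i,[],[j])],Split c g (Ref b c c (Vec a b c d e f g h i j)) (Split c j (Ref b c c
  (Vec a b c d e f j h i g)) (Split e g (Ref b c c (Vec a b e d c f g h i j)) (Split e j (Ref b c c
  (Vec a b e d c f j h i g)) (Split b g (Ref b c d (Vec a b c d e f g h i j)) (Split d g (Split b j
  (Ref b c d (Vec a b c d e f j h i g)) (Split d j (Win [(a,d,a,i), (a,d,b,a)]) (Cut
  [a,b,c,d,e,f,g,h,i]))) (Cut [a,b,c,d,e,f,h,i,j]))))))),
  ((b,c,f), [(a,[b,c,d,e],[]), (d,[i],[]), (f,[i],[g,h,j]), (g,[],[h,i,j]), (h,[],[i,j]),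
  (i,[],[j])],Split b h (Ref b c e (Vec a b c d e f g h i j)) (Split b g (Ref b c e (Vec a b c d e f
  h g i j)) (Split b j (Ref b c e (Vec a b c d e f g j i h)) (Split c g (Ref b c e (Vec a c b d e f
  h g i j)) (Split c h (Ref b c e (Vec a c b d e f g h i j)) (Split c j (Ref b c e (Vec a c b d e f
  g j i h)) (Split e g (Ref b c e (Vec a e b d c f h g i j)) (Split d g (Split e h (Ref b c e (Vec a
  e b d c f g h i j)) (Split d h (Split e j (Ref b c e (Vec a e b d c f g j i h)) (Cut
  [a,b,c,d,e,f,g,h,i])) (Cut [a,b,c,d,e,f,g,i,j]))) (Cut [a,b,c,d,e,f,h,i,j]))))))))),
  ((b,c,g), [(a,[b,c,d,e],[]), (f,[i],[])],Split h j (Ref b b a (Vec a b c d e f g h i j)) (Split g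
  h (Ref b b a (Vec a b c d e f j g i h)) (Split g j (Ref b b a (Vec a b c d e f h g i j)) (Split h
  i (Ref b c a (Vec a b c d e f g h i j)) (Split f g (Ref b c a (Vec a b c d e i h g f j)) (Split f
  h (Ref b c a (Vec a b c d e i g h f j)) (Split f j (Ref b c a (Vec a b c d e i g j f h)) (Split g
  i (Ref b c a (Vec a b c d e g h f i j)) (Split i j (Ref b c a (Vec a b c d e j g f i h)) (Split d
  i (Ref b c f (Vec a b c d e f g h i j)) (Split b f (Ref b c f (Vec a c d b e i g h f j)) (Split b
  i (Ref b c f (Vec a c d b e f g h i j)) (Split c f (Ref b c f (Vec a b d c e i g h f j)) (Split c
  i (Ref b c f (Vec a b d c e f g h i j)) (Split d f (Ref b c f (Vec a b c d e i g h f j)) (Split e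
  f (Ref b c f (Vec a b c e d i g h f j)) (Split e i (Ref b c f (Vec a b c e d f g h i j)) (Cut
  [a,b,c,d,e,g,h,j])))))))))))))))))),
  ((b,c,h), [(a,[b,c,d,e],[]), (b,[f,h],[]), (c,[i],[]), (d,[j],[]), (e,[g],[]), (f,[],[g,i,j]),
  (g,[],[h,i,j]), (h,[],[i,j]), (i,[],[j])],Win [(a,e,c,a), (a,d,e,a), (a,d,b,a)]),
  ((b,c,i), [(a,[b,c,d,e],[]), (b,[h],[]), (c,[i],[]), (d,[j],[]), (e,[g],[]), (f,[],[g,h,i,j]),
  (g,[],[h,i,j]), (h,[],[i,j]), (i,[],[j])],Split b f (Ref b c h (Vec a b c d e f g h i j)) (Split c
  f (Ref b c h (Vec a c b d e f g i h j)) (Split d f (Ref b c h (Vec a d b c e f g j h i)) (Split e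
  f (Ref b c h (Vec a e b d c f i g h j)) (Cut [a,b,c,d,e,g,h,i,j]))))),
  ((b,c,j), [(a,[b,c,d,e],[]), (b,[h,j],[]), (c,[f,i],[]), (e,[g],[]), (f,[],[g,h,j]),
  (g,[],[h,i,j]), (h,[],[i]), (i,[],[j])],Win [(a,c,b,a), (a,c,e,a)]),
  ((b,d,a), [(a,[c],[j]), (b,[h],[j]), (c,[f,i],[]), (d,[],[j]), (e,[],[j]), (f,[],[j]), (g,[],[j]),
  (h,[],[j]), (i,[],[j])],Split c j (Ref b c g (Vec c a f i j b d e h g)) (Cut [a,b,c,d,e,f,g,h,i])),
  ((b,d,b), [(a,[b,c,d,e],[]), (b,[h],[]), (c,[f,i],[]), (d,[],[j]), (e,[g],[]), (f,[],[g,h,j]),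
  (g,[],[h,i,j]), (h,[],[i,j]), (i,[],[j])],Split b j (Ref b c j (Vec a b c d e f g h i j)) (Split e
  j (Ref b c j (Vec a c e d b g h f j i)) (Ref b d a (Vec a b c d e f g h i j)))),
  ((b,d,c), [(a,[b,c,d,e],[]), (b,[h],[]), (c,[i],[]), (e,[g],[]), (f,[],[g,h,i,j]), (g,[],[h,i,j]),
  (h,[],[i,j]), (i,[],[j])],Split d j (Ref b c i (Vec a b c d e f g h i j)) (Split d f (Ref b c i
  (Vec a b c d e j g h i f)) (Split c f (Ref b d b (Vec a b c d e f g h i j)) (Split b f (Ref b d b
  (Vec a c b d e f g i h j)) (Split e f (Ref b d b (Vec a b e d c f i h g j)) (Cut
  [a,b,c,d,e,g,h,i,j])))))),
  ((b,d,d), [(a,[b,c],[f,g]), (b,[h],[]), (c,[i,j],[]), (d,[],[f,g]), (e,[],[f,g]),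
  (f,[],[g,h,i,j]), (g,[],[h,i,j])],Split b f (Split b g (Ref b c g (Vec b a f g h c d e i j)) (Ref
  b d a (Vec a b c d e i h f j g))) (Ref b d a (Vec a b c d e i g h j f))),
  ((b,d,e), [(a,[b,c],[f,g,j]), (b,[h],[]), (c,[i],[]), (d,[],[f,g,j]), (e,[],[f,g,j]),
  (f,[],[g,h,i,j]), (g,[],[h,i,j]), (h,[],[j]), (i,[],[j])],Split c j (Ref b d d (Vec a b c d e f g
  h i j)) (Split b j (Ref b d d (Vec a c b d e f g i h j)) (Cut [a,b,c,d,e,f,g,h,i]))),
  ((b,d,f), [(a,[b,c,d,e],[]), (b,[h],[]), (c,[i],[]), (f,[],[g,h,i,j]), (g,[],[h,i,j]),
  (h,[],[i,j]), (i,[],[j])],Split e g (Ref b d c (Vec a b c d e f g h i j)) (Split d f (Ref b d c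
  (Vec a b c e d g f h i j)) (Split d g (Ref b d c (Vec a b c e d f g h i j)) (Split d j (Ref b d c
  (Vec a b c e d f j h i g)) (Split e f (Ref b d c (Vec a b c d e g f h i j)) (Split e j (Ref b d c
  (Vec a b c d e f j h i g)) (Ref b d e (Vec a b c d e f g h i j)))))))),
  ((b,d,g), [(a,[b,c,d,e],[]), (b,[h],[]), (f,[],[g,h,i,j]), (g,[],[h,i,j]), (h,[],[i,j]),
  (i,[],[j])],Split c i (Ref b d f (Vec a b c d e f g h i j)) (Split c f (Ref b d f (Vec a b c d e g
  i h f j)) (Split c g (Ref b d f (Vec a b c d e f i h g j)) (Split d f (Ref b d f (Vec a b d c e g
  i h f j)) (Split d g (Ref b d f (Vec a b d c e f i h g j)) (Split d i (Ref b d f (Vec a b d c e f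
  g h i j)) (Split e f (Ref b d f (Vec a b e c d g i h f j)) (Split b f (Split e g (Ref b d f (Vec a
  b e c d h i f g j)) (Split b g (Split e i (Ref b d f (Vec a b e c d g h f i j)) (Cut
  [a,b,c,d,e,f,g,h,j])) (Cut [a,b,c,d,e,f,h,i,j]))) (Cut [a,b,c,d,e,g,h,i,j]))))))))),
  ((b,d,h), [(a,[b,c,d,e],[])],Split f i (Ref b c g (Vec a b c d e f g h i j)) (Split f g (Ref b c g
  (Vec a b c d e f h i g j)) (Split f h (Ref b c g (Vec a b c d e f g i h j)) (Split f j (Ref b c g
  (Vec a b c d e f g h j i)) (Split g h (Ref b c g (Vec a b c d e g f i h j)) (Split g i (Ref b c g
  (Vec a b c d e g f h i j)) (Split g j (Ref b c g (Vec a b c d e g f h j i)) (Split h i (Ref b c g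
  (Vec a b c d e h f g i j)) (Split h j (Ref b c g (Vec a b c d e h f g j i)) (Split i j (Ref b c g
  (Vec a b c d e i f g j h)) (Split b f (Ref b d g (Vec a b c d e g h f i j)) (Split c f (Ref b d g
  (Vec a c b d e g h f i j)) (Split d f (Ref b d g (Vec a d b c e g h f i j)) (Split e f (Ref b d g
  (Vec a e b c d g h f i j)) (Cut [a,b,c,d,e,g,h,i,j])))))))))))))))]"

definition table4 :: table where
  "table4 = fold store refutations4 table5"

lemma check_refutations4: "check_all 4 table5 refutations4"
  by code_simp

lemma last_refutations4: "refutations4 \<noteq> [] \<and> fst (snd (last refutations4)) = star (Suc 3)"
  by code_simp

text \<open>Six vertices remain outside, again sorted by disjoint edges among them: three under
  \<open>(b,j,i)\<close>, two under \<open>(c,b,f)\<close>, one under \<open>(c,c,e)\<close>. The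
  branch of \<open>(b,f,e)\<close> that arrives at the Petersen graph ends with a reference to the
  key \<open>(a,a,a)\<close>, under which nothing is ever stored and which therefore still holds
  \<open>petersen_pattern\<close>.\<close>

definition refutations3 :: "refutation list" where
  "refutations3 = [
  ((b,d,i), [(a,[b,c,d],[]), (c,[e,g],[]), (d,[e,f],[]), (e,[j],[]), (f,[i,j],[]), (h,[i],[])],Split
  b j (Split b g (Ref a g h (Vec f a i j d e b g c h)) (Win [(a,f,c,f), (a,i,c,h), (a,i,a,f)]))
  (Split g h (Win [(a,i,c,f), (e,h,e,i), (c,h,a,h), (c,h,a,i), (c,h,e,h)]) (Split b g (Win
  [(f,g,d,g), (g,i,g,f), (c,i,g,i), (c,f,g,i), (e,i,c,f), (e,i,c,i)]) (Win [(d,h,a,i), (c,f,a,i),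
  (e,i,c,f), (e,i,d,h)])))),
  ((b,d,j), [(a,[b,c,d],[]), (c,[g,j],[]), (d,[e,f],[]), (e,[i,j],[]), (f,[i,j],[]),
  (h,[i],[])],Split b g (Win [(b,e,b,i), (a,e,d,e), (b,e,b,j), (a,e,b,e)]) (Ref a i c (Vec a b e c d
  g j i f h))),
  ((b,e,a), [(a,[b,c,d],[]), (c,[g],[]), (d,[e,f],[]), (e,[h,j],[]), (f,[i],[]), (h,[i],[]),
  (i,[j],[])],Split b g (Win [(a,i,d,i), (f,g,d,g), (g,i,g,f), (b,i,a,i), (g,i,b,i)]) (Ref a g h
  (Vec a f c d b h e j i g))),
  ((b,e,b), [(a,[b,c],[]), (b,[h],[]), (c,[g],[]), (d,[e,f],[]), (e,[h,j],[]), (f,[i,j],[]),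
  (h,[i],[])],Split b g (Ref b e a (Vec b g a h e i c d f j)) (Win [(a,f,c,f), (b,f,h,f),
  (a,f,b,f)])),
  ((b,e,c), [(a,[b,c,d],[]), (b,[],[e]), (c,[g,j],[]), (d,[e,f],[]), (e,[j],[h,i]), (f,[i,j],[]),
  (h,[i],[])],Split b g (Win [(b,j,a,j), (b,f,b,j), (b,f,b,i)]) (Win [(c,i,a,i), (c,f,c,d),
  (c,i,c,f)])),
  ((b,e,d), [(a,[b,c,d],[]), (b,[],[e,j]), (c,[],[e,j]), (d,[e,f],[]), (e,[j],[]), (f,[i,j],[]),
  (g,[h],[]), (h,[i],[])],Win [(d,h,a,h), (e,h,e,i), (e,h,d,h)]),
  ((b,e,e), [(a,[b,c,d],[]), (c,[g],[]), (d,[e,f],[]), (e,[j],[]), (f,[i,j],[]), (h,[i],[])],Split c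
  e (Ref b d i (Vec a b c d e f g h i j)) (Split e i (Split c j (Ref b d j (Vec a b c d e f g h i
  j)) (Split b j (Split b g (Ref b d j (Vec a c b d e f g h i j)) (Ref a g h (Vec a e b c d f g h i
  j))) (Split c h (Win [(c,d,c,a), (f,h,f,i), (c,f,h,f), (c,f,c,d)]) (Split g h (Win [(d,h,a,h),
  (f,h,f,i), (d,h,f,h)]) (Split b g (Win [(d,g,a,g), (b,f,g,d), (a,i,b,f), (a,f,b,f), (d,i,a,i),
  (d,i,a,f), (d,f,a,f), (d,f,a,i), (e,i,d,f), (e,i,d,i)]) (Win [(a,e,c,e), (d,i,a,i), (d,e,a,i),
  (d,i,a,e), (d,e,a,e), (f,i,d,e), (f,i,d,i)])))))) (Split b e (Split b g (Ref b d i (Vec a c b d e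
  f g h i j)) (Split b j (Win [(a,i,b,f), (a,i,c,h)]) (Split h j (Ref b d i (Vec f i j d e a h g c
  b)) (Win [(a,i,b,f), (c,f,a,j), (a,i,c,f), (c,i,a,i), (c,i,c,f)])))) (Split e h (Split c h (Ref b
  e a (Vec c g a h e i b d f j)) (Split b h (Ref b e b (Vec a b c d e f g h i j)) (Split g h (Ref b
  e b (Vec c g a d e f b h i j)) (Split b g (Win [(f,g,d,g), (d,f,e,f), (a,f,d,f), (b,f,g,f),
  (b,f,a,f)]) (Win [(d,f,e,f), (a,f,c,f), (d,f,a,f)]))))) (Split c j (Ref b e c (Vec a b c d e f g h
  i j)) (Split b j (Split b g (Ref b e c (Vec a c b d e f g h i j)) (Win [(c,j,a,j), (f,g,j,c),
  (a,f,c,j), (c,i,a,f), (a,i,a,f), (c,i,g,f), (a,i,c,i)])) (Split g h (Ref b e d (Vec a b c d e f g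
  h i j)) (Split b g (Win [(f,g,d,g), (b,j,a,j), (g,j,b,j), (f,g,j,g), (b,f,g,j), (g,i,g,f),
  (b,f,g,i), (a,f,b,f), (a,i,b,f), (d,f,a,i), (d,i,a,i), (d,i,a,f), (d,f,a,f), (e,i,d,f),
  (e,i,d,i)]) (Win [(c,j,a,j), (c,f,c,j), (a,f,c,f), (a,i,c,f), (d,f,a,f), (d,f,a,i), (d,i,a,i),
  (d,i,a,f), (e,i,d,i), (e,i,d,f)]))))))))),
  ((b,e,f), [(a,[c],[]), (b,[e],[f,i]), (c,[g,h],[]), (d,[e],[f,i]), (e,[j],[]), (f,[i,j],[])],Win
  [(c,j,c,e), (c,j,c,f)]),
  ((b,e,g), [(a,[b,c,d],[]), (b,[e],[]), (c,[g],[]), (d,[e],[f]), (e,[j],[]), (f,[i,j],[]),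
  (h,[i],[])],Split b f (Ref b e e (Vec a d c b e f g h i j)) (Split b i (Ref b e e (Vec i h f b e a
  j g c d)) (Split d i (Ref b e e (Vec i h f d e a j g c b)) (Split c h (Ref b e f (Vec a b c d e f
  g h i j)) (Split g h (Win [(g,j,g,f), (e,g,e,c), (e,g,j,g)]) (Split b h (Win [(d,i,d,h),
  (d,f,e,i), (d,f,d,i), (a,j,d,f), (a,f,d,f), (c,f,a,f), (c,j,a,f), (a,j,c,f), (c,j,c,f), (c,e,c,j),
  (c,e,a,j)]) (Win [(d,f,e,i), (a,j,d,f), (a,f,d,f), (c,j,a,f), (c,f,a,f), (a,j,c,f), (c,j,c,f),
  (c,e,a,j), (c,e,c,j)]))))))),
  ((b,e,h), [(a,[b,c,d],[]), (b,[j],[]), (c,[d,g],[]), (d,[e],[]), (e,[j],[g]), (f,[i,j],[]),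
  (h,[i],[])],Split b g (Ref b e g (Vec c g d a b f e h i j)) (Win [(e,f,d,j), (a,f,c,i), (d,i,c,i),
  (b,f,a,j), (e,i,d,i), (e,f,d,i), (b,f,a,f), (i,j,i,e), (i,j,f,e), (i,j,f,b)])),
  ((b,e,i), [(a,[b,c,d],[]), (b,[],[e]), (c,[d,g],[]), (d,[e],[]), (e,[j],[]), (f,[i,j],[]),
  (h,[i],[])],Split e g (Ref b e g (Vec c g a d e f b h i j)) (Split b j (Ref b e h (Vec a b c d e f
  g h i j)) (Split g j (Ref b e h (Vec c g a d e f b h i j)) (Split b g (Win [(b,e,b,d), (d,i,e,i),
  (b,j,b,e), (c,i,d,i), (b,f,b,j), (g,i,c,i), (b,f,g,i)]) (Win [(d,i,c,i), (d,i,e,i),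
  (d,i,a,i)]))))),
  ((b,e,j), [(a,[b,c,d],[]), (c,[g],[]), (d,[e],[f]), (e,[j],[]), (f,[i,j],[]), (h,[i,j],[])],Split
  b i (Ref b e g (Vec j h e f i a d g c b)) (Split c i (Ref b e g (Vec i h c f j d g b a e)) (Split
  d h (Ref b e e (Vec a b c d e h g f i j)) (Split d i (Ref b e a (Vec a b c d i e g f j h)) (Split
  g i (Ref b e g (Vec i h g f j d c b a e)) (Split b g (Win [(e,j,j,h), (e,g,d,g), (g,j,g,e),
  (d,j,e,j), (a,j,d,j), (b,j,g,j), (a,j,b,j)]) (Win [(c,e,a,j), (e,j,j,h), (c,j,c,e), (d,j,e,j),
  (a,j,d,j), (a,j,c,j)]))))))),
  ((b,f,a), [(a,[b,c,d],[]), (b,[],[e]), (c,[g,h],[]), (d,[e,g],[]), (e,[j],[g]), (f,[i,j],[]),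
  (h,[i],[j])],Split b g (Win [(h,j,c,e), (a,h,a,c), (c,j,c,e), (a,i,a,h), (c,f,h,j), (c,f,c,j),
  (a,f,c,f), (a,i,c,f), (a,f,a,i)]) (Win [(c,j,c,e), (h,j,c,e), (c,f,c,j), (c,f,h,j), (a,i,c,f),
  (a,f,c,f), (a,f,a,i)])),
  ((b,f,b), [(a,[b,c,d],[]), (b,[],[f,i]), (c,[g],[h,j]), (d,[e,g],[]), (e,[j],[g]), (f,[i,j],[]),
  (g,[],[j]), (h,[i],[j])],Split e i (Split b g (Ref b e j (Vec i h f e d b j c g a)) (Win
  [(c,i,c,e), (a,i,c,i), (d,e,a,i), (a,e,a,i), (d,i,a,i), (d,e,a,e), (d,i,a,e), (e,i,d,e),
  (e,i,d,i)])) (Split b h (Split e h (Split b g (Ref b f a (Vec a c b d e f g h i j)) (Win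
  [(c,j,c,e), (c,f,c,j), (a,j,c,f), (a,f,c,f), (b,f,a,f), (b,j,a,j), (b,j,a,f), (b,f,b,j)])) (Win
  [(c,j,c,e), (a,f,a,j), (b,f,a,j), (c,f,a,j), (a,i,b,f), (a,i,a,f), (c,f,c,j), (c,i,a,i),
  (c,h,a,i), (c,i,c,f), (c,i,c,h)])) (Win [(f,g,i,d), (d,f,d,i), (g,j,d,f), (g,j,g,f), (c,e,g,j),
  (a,e,c,e), (a,d,c,e), (a,d,a,e)]))),
  ((b,f,c), [(a,[b,c,d],[]), (b,[],[e]), (c,[g],[]), (d,[e,g],[]), (e,[j],[]), (f,[i,j],[]),
  (h,[i],[j])],Split b f (Ref b e j (Vec f b i j e a h g c d)) (Split e g (Win [(a,j,c,e),
  (a,f,a,i), (a,f,a,j)]) (Split c j (Split b g (Win [(b,j,b,e), (d,f,d,j), (d,i,d,f), (b,f,b,j),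
  (a,i,d,i), (a,i,b,f)]) (Win [(d,i,a,i), (d,f,d,j), (d,f,d,i)])) (Split g j (Split c e (Ref b e f
  (Vec b e a g j i c d h f)) (Win [(c,f,a,j), (d,i,d,f), (a,i,d,i), (a,i,c,f)])) (Split c h (Ref b f
  a (Vec a b c d e f g h i j)) (Split b i (Win [(g,i,g,b), (d,i,e,i), (f,g,i,d), (d,f,d,i),
  (g,i,d,i), (f,g,i,g), (d,f,g,i), (g,j,g,f), (g,j,d,f)]) (Ref b f b (Vec a b c d e f g h i
  j)))))))),
  ((b,f,d), [(a,[b,c,d],[]), (b,[],[e]), (c,[g,j],[]), (d,[e],[]), (e,[j],[]), (f,[i,j],[]),
  (g,[i],[]), (h,[i],[])],Win [(d,i,a,i), (d,g,a,i), (e,i,d,g), (e,g,d,g), (e,i,d,i), (e,i,e,g)]),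
  ((b,f,e), [(a,[b,c,d],[]), (c,[g],[]), (d,[e],[]), (e,[j],[]), (f,[i,j],[]), (h,[i],[])],Split d f
  (Ref b e e (Vec a b c d e f g h i j)) (Split b e (Ref b e g (Vec a b c d e f g h i j)) (Split c d
  (Ref b e i (Vec a b c d e f g h i j)) (Split d j (Split g i (Split c e (Ref b e f (Vec b g a h i j
  c d e f)) (Ref b e f (Vec f b i c a e g h j d))) (Split b g (Split e h (Win [(a,i,d,i), (e,g,d,g),
  (b,i,a,i), (g,h,g,e), (g,i,b,i), (g,i,g,h)]) (Split c e (Ref b e g (Vec a d b c e f g h i j)) (Win
  [(g,j,g,d), (f,g,i,g), (f,g,j,g), (b,j,g,f), (b,f,g,f), (a,f,b,f), (a,f,b,j), (a,j,b,j),
  (a,j,b,f), (d,f,a,f), (d,f,a,j)]))) (Split e h (Win [(a,i,d,i), (a,i,c,i)]) (Split c e (Win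
  [(a,i,c,i), (c,f,c,j), (c,f,a,i)]) (Win [(c,i,a,i), (c,f,c,i), (a,f,c,i), (c,j,c,f), (a,j,c,f),
  (a,j,c,j), (a,f,c,j), (d,f,a,j), (d,f,a,f)]))))) (Split h j (Ref b e j (Vec a b c d e f g h i j))
  (Split d g (Ref b f c (Vec a b c d e f g h i j)) (Split e f (Split b g (Ref b e j (Vec f j i e d b
  h c g a)) (Split b j (Win [(a,i,c,i), (a,i,a,f)]) (Win [(c,i,a,f), (c,i,g,f), (a,i,d,f),
  (a,i,c,i)]))) (Split c e (Split b g (Ref b e g (Vec a d b c e f g h i j)) (Split b h (Ref b f c
  (Vec c g e a b i d j f h)) (Win [(c,i,a,f), (a,f,a,j), (c,f,a,f), (a,i,a,f), (c,i,c,f),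
  (a,i,c,i)]))) (Split e i (Split b h (Ref b e j (Vec a d c b h e g f j i)) (Split b g (Ref b e j
  (Vec i h f e d b j c g a)) (Win [(c,f,a,i), (a,f,d,f), (c,i,a,i), (c,f,a,f), (c,f,c,i)]))) (Split
  g i (Split c j (Ref b f d (Vec a b c d e f g h i j)) (Split b j (Split b h (Ref b f d (Vec a c b d
  e f h g i j)) (Win [(b,i,a,i), (d,i,a,i), (e,g,d,i), (i,j,i,b), (e,g,j,i), (c,j,g,e), (c,e,g,e),
  (c,e,c,j), (a,j,c,j), (a,j,c,e)])) (Ref b e f (Vec f b i c a e g h j d)))) (Split b j (Split c h
  (Split b i (Win [(j,c,j,h), (j,c,e,c)]) (Win [(h,j,c,j), (e,h,j,h), (b,h,j,h), (a,c,b,h),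
  (c,j,h,e), (a,h,b,h), (c,d,h,e), (a,b,c,j), (a,e,c,j), (c,d,a,e), (a,d,a,e), (a,h,d,c), (a,c,d,c),
  (a,c,a,h), (a,b,c,a), (a,d,c,a), (a,b,d,a)])) (Split g h (Split b g (Ref b e g (Vec a c d b g i e
  j f h)) (Split b h (Split c f (Split d i (Split e g (Ref a a a (Vec a b h g c d j i e f)) (Win
  [(f,i,f,d), (c,i,f,d), (c,h,f,i), (c,h,c,i), (f,h,f,i), (c,h,f,h)])) (Win [(b,j,a,j), (b,f,a,j),
  (f,h,f,b), (h,j,b,j), (f,h,j,b), (h,j,h,f)])) (Win [(d,h,a,h), (e,h,j,h), (e,h,d,h)])) (Win
  [(d,i,a,f), (d,f,a,f), (a,i,d,f), (d,i,d,f), (a,h,d,i), (d,h,d,i), (a,h,d,h), (a,i,d,h),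
  (c,i,a,h), (c,i,a,i)]))) (Split b h (Win [(a,j,c,j), (a,f,c,j), (d,f,a,j), (d,f,a,f), (d,i,d,f),
  (e,i,d,f), (d,h,d,i), (e,h,e,i), (e,h,d,i), (d,h,e,h)]) (Win [(a,f,d,i), (a,j,c,j), (d,f,d,i),
  (a,j,a,f), (d,f,a,j)])))) (Split b g (Split b d (Ref b e i (Vec a c b d e f g h i j)) (Split b f
  (Ref b e e (Vec f j i b g a h e d c)) (Split b i (Ref b e e (Vec i h f b g a j e d c)) (Split c h
  (Win [(c,d,c,a), (c,e,c,d), (e,h,d,c), (h,j,h,e), (c,j,c,e), (h,j,c,e), (h,j,c,j)]) (Split c i
  (Ref b e e (Vec i h f c g a j e d b)) (Split g h (Ref b e g (Vec a c d b g i e j f h)) (Split b h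
  (Ref b f b (Vec a d c b h f g e j i)) (Win [(d,f,e,i), (e,g,d,g), (a,j,d,f), (a,f,d,f), (g,j,g,e),
  (a,j,a,f), (c,j,a,j), (f,g,j,c), (g,j,c,j), (g,j,g,f)])))))))) (Split c h (Win [(d,h,a,i),
  (h,j,c,j), (d,i,a,i), (e,h,j,c), (e,h,d,h), (e,i,d,h), (e,i,d,i), (e,i,j,h), (e,h,e,i)]) (Split g
  h (Split b c (Win [(d,h,a,h), (d,i,a,i), (d,h,a,i), (d,i,a,h), (e,h,d,h), (e,i,d,i), (e,h,d,i),
  (e,i,d,h), (h,j,h,e), (h,j,i,e)]) (Split b f (Win [(d,h,a,i), (d,i,a,i), (e,i,d,i), (e,h,d,i),
  (d,h,e,i), (e,h,e,i), (d,g,d,h), (e,g,d,h), (e,g,d,g), (e,h,d,g), (h,j,g,e), (g,j,h,e), (h,j,h,e),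
  (g,j,g,e), (f,g,j,h), (f,g,j,g)]) (Win [(d,h,a,h), (d,g,a,h), (e,g,d,g), (e,h,d,g), (e,h,d,h),
  (e,g,d,h), (g,j,g,e), (h,j,h,e), (h,j,g,e), (g,j,h,e), (f,g,j,g), (f,g,j,h)]))) (Win [(d,i,a,i),
  (d,f,a,i), (a,f,c,j), (a,j,c,j), (d,i,a,f), (d,f,a,j), (d,f,a,f), (e,i,d,i),
  (e,i,d,f)]))))))))))))))),
  ((b,f,f), [(a,[b,c,d],[]), (b,[],[e,h]), (c,[i],[]), (d,[],[e,h]), (e,[j],[]), (f,[g,i,j],[]),
  (h,[i],[])],Split e g (Win [(c,e,a,e), (c,e,i,e)]) (Win [(f,i,j,i), (c,f,a,f), (c,f,i,f)])),
  ((b,f,g), [(a,[b,c,d],[]), (b,[],[e,h]), (c,[g],[e,h]), (d,[g],[h]), (e,[g,j],[]), (f,[i,j],[]),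
  (h,[i],[])],Win [(f,g,i,e), (a,j,a,e), (d,f,g,f), (a,f,a,j), (d,f,a,f)]),
  ((b,f,h), [(a,[b,c,d],[]), (b,[],[h]), (c,[g],[h]), (d,[g],[h]), (e,[j],[]), (f,[i,j],[]),
  (g,[i],[]), (h,[i],[])],Win [(g,j,i,j), (a,f,a,i), (c,j,g,j), (a,j,a,f), (a,j,c,j)]),
  ((b,f,i), [(a,[b,c,d],[]), (b,[i],[]), (c,[g],[h]), (d,[],[h]), (e,[j],[g]), (f,[i,j],[g]),
  (g,[],[h,j]), (h,[i],[])],Win [(a,b,c,a), (b,j,i,e), (a,j,b,j), (a,i,a,b), (a,f,a,i), (a,f,a,j)]),
  ((b,f,j), [(a,[b,c,d],[]), (b,[],[h,i]), (c,[f,g],[]), (d,[],[e,h]), (e,[j],[g]), (f,[i,j],[]),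
  (g,[],[h,i,j]), (h,[i],[])],Win [(f,j,i,j), (a,f,a,c), (c,j,a,f), (a,j,a,f), (c,f,a,f), (c,f,a,j),
  (c,j,a,j), (f,j,c,f), (f,j,c,j)]),
  ((b,g,a), [(a,[b,c,d],[]), (b,[],[e,f,h,i,j]), (c,[g],[e,f,h,i,j]), (d,[],[e,f,h,i]), (e,[j],[g]),
  (f,[i,j],[g]), (g,[],[h,i,j]), (h,[i],[])],Split d j (Ref b f i (Vec a d c b h f g e j i)) (Cut
  [a,b,c,d,g])),
  ((b,g,b), [(a,[b,c,d],[]), (b,[],[e,h]), (c,[g],[]), (d,[g],[e,h]), (e,[j],[]), (f,[i,j],[g]),
  (h,[i],[])],Split c e (Ref b f e (Vec a b d c e f g h i j)) (Split c h (Ref b f e (Vec a b d c h f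
  g e j i)) (Split e g (Ref b f g (Vec a b c d e f g h i j)) (Split g h (Ref b f g (Vec a b c d h f
  g e j i)) (Split b f (Win [(f,g,b,g), (f,i,j,i), (d,f,g,f), (b,f,f,i), (a,f,d,f), (a,f,b,f)])
  (Split g i (Ref b f h (Vec a b c d e f g h i j)) (Split g j (Ref b f h (Vec a b c d h f g e j i))
  (Split b i (Ref b f i (Vec a b c d e f g h i j)) (Split b j (Ref b f i (Vec a b c d h f g e j i))
  (Split c f (Ref b f j (Vec a b c d e f g h i j)) (Split d f (Ref b f j (Vec a b d c e f g h i j))
  (Split c i (Ref b f i (Vec a c d b e f g h i j)) (Split d i (Ref b f i (Vec a d c b e f g h i j))
  (Split c j (Ref b f i (Vec a c d b h f g e j i)) (Ref b g a (Vec a b c d e f g h i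
  j)))))))))))))))),
  ((b,g,c), [(a,[b,c,d],[]), (b,[],[e,g,h]), (c,[f,g],[]), (d,[],[e,g,h]), (e,[g,j],[]),
  (f,[i,j],[]), (h,[i],[])],Win [(c,f,a,f), (f,g,i,e), (f,g,f,c)]),
  ((b,g,d), [(a,[b,c,d],[]), (b,[],[g,h]), (c,[g,i],[]), (d,[],[g,h]), (e,[j],[]), (f,[i,j],[]),
  (h,[i],[])],Split g h (Ref b e d (Vec a b d c g i e j f h)) (Win [(c,j,i,j), (a,j,c,j)])),
  ((b,g,e), [(a,[b,c,d],[]), (b,[],[e,g,h]), (c,[g],[j]), (d,[],[e,g,h]), (e,[g,j],[]),
  (f,[i,j],[]), (h,[i],[])],Win [(c,f,a,f), (f,g,f,c), (g,i,c,f), (e,i,g,f), (e,i,g,i)]),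
  ((b,g,f), [(a,[b,c,d],[]), (b,[],[e,g,h]), (c,[e,g],[]), (d,[],[e,g,h]), (e,[j],[]), (f,[i,j],[]),
  (g,[],[h]), (h,[i],[])],Win [(c,f,e,i), (c,f,a,f)]),
  ((b,g,g), [(a,[b,c,d],[]), (b,[i],[g]), (c,[g],[h]), (d,[],[g,h]), (e,[j],[]), (f,[i,j],[]),
  (g,[],[h]), (h,[i],[])],Win [(b,j,i,j), (a,j,c,j), (b,j,a,j)]),
  ((b,g,h), [(a,[b,c,d],[]), (b,[f],[e]), (c,[g],[e,j]), (d,[],[e,g,h]), (e,[j],[g]), (f,[i,j],[]),
  (g,[],[h]), (h,[i],[])],Win [(f,i,j,h), (a,f,c,f), (a,i,c,f), (b,f,a,f), (b,i,a,f), (b,i,a,i),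
  (b,f,a,i), (f,i,b,i), (f,i,b,f)]),
  ((b,g,i), [(a,[b,c,d],[]), (b,[],[g,h]), (c,[g],[h]), (d,[],[g,h]), (e,[j],[]), (f,[i,j],[]),
  (g,[i],[]), (h,[i],[])],Win [(g,j,i,e), (c,j,a,j), (c,j,g,j)]),
  ((b,g,j), [(a,[b,c,d],[]), (c,[g],[]), (e,[j],[]), (f,[i,j],[]), (h,[i],[])],Split d e (Ref b f e
  (Vec a b c d e f g h i j)) (Split b e (Ref b f e (Vec a d c b e f g h i j)) (Split b h (Ref b f e
  (Vec a d c b h f g e j i)) (Split d h (Ref b f e (Vec a b c d h f g e j i)) (Split f g (Split c j
  (Ref b f f (Vec a b c d h f g e j i)) (Split e g (Ref b f f (Vec a b c d h f j e g i)) (Split c e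
  (Win [(c,f,a,f), (e,f,c,f), (i,j,f,e), (f,j,f,e), (f,i,j,f), (f,i,j,i)]) (Win [(c,f,a,f),
  (f,i,j,h), (g,i,c,f), (f,g,f,c), (f,i,g,f), (f,i,g,i)])))) (Split d g (Ref b g b (Vec a b c d e f
  g h i j)) (Split b g (Ref b g b (Vec a d c b e f g h i j)) (Split c f (Split e g (Ref b g c (Vec a
  b c d e f g h i j)) (Split g h (Ref b g c (Vec a b c d h f g e j i)) (Win [(f,i,j,i), (c,f,a,f),
  (f,i,c,f)]))) (Split c i (Ref b g d (Vec a b c d e f g h i j)) (Split c j (Ref b g d (Vec a b c d
  h f g e j i)) (Split e g (Ref b g e (Vec a b c d e f g h i j)) (Split g h (Ref b g e (Vec a b c d
  h f g e j i)) (Split c e (Ref b g f (Vec a b c d e f g h i j)) (Split c h (Ref b g f (Vec a b c d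
  h f g e j i)) (Split b i (Ref b g g (Vec a b c d e f g h i j)) (Split b j (Ref b g g (Vec a b c d
  h f g e j i)) (Split b f (Ref b g h (Vec a b c d e f g h i j)) (Split d i (Ref b g g (Vec a d c b
  e f g h i j)) (Split g i (Ref b g i (Vec a b c d e f g h i j)) (Split g j (Ref b g i (Vec a b c d
  h f g e j i)) (Split d f (Ref b g h (Vec a d c b h f g e j i)) (Ref b g a (Vec a b c d e f g h i
  j))))))))))))))))))))))),
  ((b,h,a), [(a,[b,c,d],[]), (b,[],[h,i]), (c,[g,h],[]), (d,[],[h,i]), (e,[g,j],[]), (f,[g,j],[]),
  (h,[i],[])],Win [(c,j,h,j), (c,j,a,j)]),
  ((b,h,b), [(a,[b,c,d],[]), (c,[g],[]), (e,[g,j],[i]), (f,[g,j],[i]), (h,[i,j],[])],Win [(a,j,a,h),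
  (a,j,c,j)]),
  ((b,h,c), [(a,[c,d],[]), (b,[h,j],[]), (c,[g],[]), (d,[],[g,h,i]), (e,[j],[h,i]), (f,[j],[h,i]),
  (h,[i],[])],Win [(c,j,a,j), (b,c,h,c), (c,j,c,b)]),
  ((b,h,d), [(a,[b,d],[h,i]), (b,[j],[h,i]), (c,[g],[h,i]), (d,[],[h,i]), (e,[j],[h,i]),
  (f,[g],[h,i]), (h,[i],[j]), (i,[],[j])],Split g h (Ref b g j (Vec g c h f e b i d a j)) (Split g i
  (Ref b g j (Vec g c i f e b h d a j)) (Cut [a,b,c,d,e,f,g,j]))),
  ((b,h,e), [(a,[b,c,d],[]), (b,[g,h],[]), (c,[g],[]), (e,[j],[h,i]), (f,[g,j],[h,i]), (h,[i],[j]),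
  (i,[],[j])],Win [(a,b,a,h), (a,f,a,j), (d,g,a,b), (d,g,a,f)]),
  ((b,h,f), [(a,[b,c,d],[]), (b,[],[h,i]), (c,[],[h,i]), (e,[j],[g,h,i]), (f,[g,j],[h,i]),
  (g,[],[h,i]), (h,[i],[j]), (i,[],[j])],Split d h (Ref b h c (Vec j d f e b c g h i a)) (Split d i
  (Ref b h c (Vec j d f e b c g i h a)) (Cut [a,b,c,d,e,f,g,j]))),
  ((b,h,g), [(a,[b,c,d],[]), (b,[g],[]), (c,[g],[]), (e,[j],[h,i]), (f,[g,j],[h,i]),
  (h,[i],[])],Split h j (Ref b g j (Vec j e h f c b i d a g)) (Split i j (Ref b g j (Vec j e i f c b
  h d a g)) (Split b h (Ref b h e (Vec a b c d e f g h i j)) (Split b i (Ref b h e (Vec a b c d e f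
  g i h j)) (Split c h (Ref b h e (Vec a c b d e f g h i j)) (Split c i (Ref b h e (Vec a c b d e f
  g i h j)) (Ref b h f (Vec a b c d e f g h i j)))))))),
  ((b,h,h), [(a,[b,c,d],[]), (b,[],[g]), (c,[g],[]), (d,[],[g]), (e,[j],[i]), (f,[j],[i]),
  (g,[],[i]), (h,[i,j],[])],Win [(a,j,a,h), (a,j,c,j)]),
  ((b,h,i), [(a,[b,c,d],[]), (b,[],[g]), (c,[g],[]), (d,[],[g]), (e,[j],[h,i]), (f,[g,j],[i]),
  (h,[i,j],[])],Split g i (Split b h (Ref b g j (Vec a c b d e f h i g j)) (Split d h (Ref b g j
  (Vec a b d c e f h i g j)) (Win [(a,f,a,j), (c,f,g,j), (f,g,j,g), (c,f,a,j), (a,g,c,f), (c,g,g,f),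
  (c,g,c,f), (a,g,a,f), (c,g,a,g)]))) (Ref b h h (Vec a b c d e f g h i j))),
  ((b,h,j), [(a,[b,c,d],[]), (b,[],[g]), (c,[g,h],[]), (d,[],[g]), (e,[j],[g,h,i]), (f,[g,j],[h,i]),
  (h,[i],[j]), (i,[],[j])],Win [(a,f,a,j), (a,g,a,f), (a,c,a,g), (c,h,a,c), (a,h,a,c), (c,h,a,h)]),
  ((b,i,a), [(a,[b,c,d],[]), (c,[g],[]), (e,[j],[h,i]), (f,[g,j],[i]), (g,[h],[]), (h,[i],[j]),
  (i,[],[j])],Win [(a,f,a,j), (a,g,a,h), (a,f,a,g)]),
  ((b,i,b), [(a,[b,c,d],[]), (b,[h],[]), (c,[g],[]), (e,[j],[g,h,i]), (f,[g,j],[h,i]), (g,[],[h,i]),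
  (h,[i],[j]), (i,[],[j])],Win [(a,b,a,h), (a,f,a,j), (a,g,a,f), (a,c,b,a), (a,g,a,c)]),
  ((b,i,c), [(a,[b,c,d],[]), (c,[g],[]), (e,[j],[h,i]), (f,[g,j],[h,i]), (h,[i],[])],Split e g
  (Split b h (Ref b g j (Vec g c e f i b j d a h)) (Split b i (Ref b g j (Vec g c e f h b j d a i))
  (Split d h (Ref b g j (Vec g c e f i d j b a h)) (Split d i (Ref b g j (Vec g c e f h d j b a i))
  (Split c h (Ref b h a (Vec a b c d e f g h i j)) (Split c i (Ref b h a (Vec a b c d e f g i h j))
  (Split h j (Ref b h b (Vec a b c d e f g h i j)) (Split i j (Ref b h b (Vec a b c d e f g i h j))
  (Cut [a,b,c,d,e,f,g,j]))))))))) (Split b g (Ref b h g (Vec a b c d e f g h i j)) (Split d g (Ref b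
  h g (Vec a c d b e f g h i j)) (Split h j (Ref b h i (Vec a b c d e f g h i j)) (Split i j (Ref b
  h i (Vec a b c d e f g i h j)) (Split c h (Ref b h j (Vec a b c d e f g h i j)) (Split c i (Ref b
  h j (Vec a b c d e f g i h j)) (Split g h (Ref b i a (Vec a b c d e f g h i j)) (Split g i (Ref b
  i a (Vec a b c d e f g i h j)) (Split b h (Ref b i b (Vec a b c d e f g h i j)) (Split b i (Ref b
  i b (Vec a b c d e f g i h j)) (Ref b h f (Vec a b c d e f g h i j))))))))))))),
  ((b,i,d), [(a,[b,c,d],[]), (b,[j],[]), (c,[g],[]), (e,[j],[g,h,i]), (f,[j],[g,h,i]), (g,[h],[]),
  (h,[i],[])],Win [(a,b,a,j), (a,g,a,h), (a,c,b,a), (a,c,a,g)]),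
  ((b,i,e), [(a,[b,c,d],[]), (b,[h,j],[]), (c,[g],[]), (d,[],[e]), (e,[j],[h,i]), (f,[j],[g,h,i]),
  (g,[],[h,i]), (h,[i],[])],Win [(a,b,c,j), (b,c,j,c), (b,c,j,a), (a,b,a,h), (a,b,a,j), (a,c,b,a),
  (a,c,b,c)]),
  ((b,i,f), [(a,[b,c,d],[]), (b,[j],[]), (c,[g],[h,i]), (d,[h],[f]), (e,[j],[g]), (f,[j],[]),
  (g,[],[h,i]), (h,[i],[])],Win [(d,j,h,j), (a,j,d,j), (b,c,j,a), (a,b,a,j), (c,j,a,j), (b,c,j,c),
  (a,b,c,j), (a,c,b,c), (a,c,b,a)]),
  ((b,i,g), [(a,[b,c,d],[]), (b,[j],[]), (c,[g],[]), (e,[j],[g,h,i]), (f,[j],[g,h,i]),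
  (h,[i],[])],Split g h (Ref b i d (Vec a b c d e f g h i j)) (Split g i (Ref b i d (Vec a b c d e f
  g i h j)) (Split d e (Ref b i c (Vec j b e f g a d h i c)) (Split d f (Ref b i c (Vec j b f e g a
  d h i c)) (Split b h (Ref b i e (Vec a b c d e f g h i j)) (Split b i (Ref b i e (Vec a b c d e f
  g i h j)) (Split c h (Ref b f f (Vec j e b f i c g d a h)) (Split c i (Ref b f f (Vec j e b f h c
  g d a i)) (Split d h (Ref b i f (Vec a b c d e f g h i j)) (Split d i (Ref b i f (Vec a b c d e f
  g i h j)) (Cut [a,b,c,d,e,f,g,j]))))))))))),
  ((b,i,h), [(a,[b,c,d],[]), (c,[g,j],[]), (e,[j],[g,h,i]), (f,[j],[g,h,i]), (g,[h],[]),
  (h,[i],[])],Win [(a,c,a,j), (a,g,a,h), (a,g,a,c)]),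
  ((b,i,i), [(a,[b,c,d],[]), (c,[g],[]), (e,[j],[g,h]), (f,[j],[g,h]), (h,[i],[]), (i,[j],[])],Split
  g h (Ref b e f (Vec b e a f j h c d g i)) (Split b g (Ref b g j (Vec j e i f c b h d a g)) (Split
  d g (Ref b g j (Vec j e i f d c h b a g)) (Ref b h h (Vec a b c d e f g i h j))))),
  ((b,i,j), [(a,[b,c,d],[]), (b,[e],[]), (c,[g],[]), (e,[j],[g,h,i]), (f,[j],[g,h,i]), (g,[i],[j]),
  (h,[i],[j]), (i,[],[j])],Win [(a,e,a,j), (a,g,a,i), (a,b,a,e), (a,c,a,g), (a,b,c,a)]),
  ((b,j,a), [(a,[b,c,d],[]), (b,[],[e,f,j]), (c,[e,g],[]), (d,[],[e,f,j]), (e,[j],[]), (f,[j],[]),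
  (g,[i],[]), (h,[i],[])],Win [(c,h,a,i), (e,i,j,i), (e,i,c,h)]),
  ((b,j,b), [(a,[b,c,d],[]), (b,[],[j]), (c,[g],[j]), (d,[],[j]), (e,[j],[g,h,i]), (f,[j],[g,h,i]),
  (g,[i],[j]), (h,[i],[j]), (i,[],[j])],Split b e (Ref b i j (Vec a b c d e f g h i j)) (Split b f
  (Ref b i j (Vec a b c d f e g h i j)) (Split d e (Ref b i j (Vec a c d b g h e f j i)) (Split d f
  (Ref b i j (Vec a c d b g h f e j i)) (Split c e (Ref b j a (Vec a b c d e f g h i j)) (Split c f
  (Ref b j a (Vec a b c d f e g h i j)) (Cut [a,b,c,d,g,h,i]))))))),
  ((b,j,c), [(a,[b,c,d],[]), (b,[h],[]), (c,[f,g],[]), (d,[],[j]), (e,[j],[g,h,i]), (f,[j],[h,i]),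
  (g,[],[h,i,j]), (h,[i],[]), (i,[],[j])],Win [(a,f,a,j), (b,f,a,j), (a,b,a,h), (a,c,a,f),
  (b,c,b,f), (a,c,b,f), (b,c,a,f), (a,b,c,a), (a,b,c,b)]),
  ((b,j,d), [(a,[b,c,d],[]), (b,[],[j]), (c,[f,g],[]), (d,[],[j]), (e,[j],[g,h,i]), (f,[j],[h,i]),
  (g,[],[h,i,j]), (h,[i],[j]), (i,[],[j])],Split b h (Ref b j c (Vec a b c d e f g h i j)) (Split b
  i (Ref b j c (Vec a b c d e f g i h j)) (Split d h (Ref b j c (Vec a d c b e f g h i j)) (Split d
  i (Ref b j c (Vec a d c b e f g i h j)) (Cut [a,b,c,d,e,f,g,j]))))),
  ((b,j,e), [(a,[b,c,d],[]), (b,[h],[]), (c,[g],[e,f,j]), (d,[e],[]), (e,[j],[g]), (f,[j],[g,h,i]),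
  (g,[],[h,i,j]), (h,[i],[])],Win [(b,e,a,j), (a,b,c,a), (a,h,a,b), (e,h,e,b), (d,h,a,h),
  (d,h,e,h)]),
  ((b,j,f), [(a,[b,c,d],[]), (b,[],[h,i]), (c,[g,h],[]), (d,[e],[]), (e,[j],[g]), (f,[j],[g,h,i]),
  (g,[],[i,j]), (h,[i],[])],Win [(a,d,c,a), (c,e,h,e), (a,e,a,j), (a,e,c,e), (a,d,c,e), (a,d,a,e)]),
  ((b,j,g), [(a,[b,c,d],[]), (b,[],[h,i,j]), (c,[g],[h,i]), (d,[e,h],[]), (e,[j],[g]), (f,[j],[g]),
  (g,[],[h,i]), (h,[i],[])],Win [(d,f,h,j), (a,j,d,f), (c,e,a,j), (a,e,a,j), (a,d,c,e), (c,d,a,e),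
  (a,d,a,e), (c,d,c,e), (a,c,d,a), (a,c,d,c)]),
  ((b,j,h), [(a,[b,c,d],[]), (b,[],[j]), (c,[g],[e,f,j]), (d,[e],[]), (e,[j],[g,h,i]),
  (f,[j],[g,h,i]), (g,[],[h,i,j]), (h,[i],[j]), (i,[],[j])],Split b h (Ref b j e (Vec a b c d e f g
  h i j)) (Split b i (Ref b j e (Vec a b c d e f g i h j)) (Split c h (Ref b j f (Vec a b c d e f g
  h i j)) (Split c i (Ref b j f (Vec a b c d e f g i h j)) (Split d h (Ref b j g (Vec a b c d e f g
  h i j)) (Split d i (Ref b j g (Vec a b c d e f g i h j)) (Cut [a,b,c,d,e,f,g,j]))))))),
  ((b,j,i), [(a,[b,c,d],[]), (c,[g],[]), (e,[j],[]), (f,[j],[]), (h,[i],[])],Split f i (Ref b g j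
  (Vec a b c d e f g h i j)) (Split e h (Ref b g j (Vec a b c d f e g i h j)) (Split e i (Ref b g j
  (Vec a b c d f e g h i j)) (Split f h (Ref b g j (Vec a b c d e f g i h j)) (Split g j (Split b h
  (Ref b g j (Vec j e g f i b c d a h)) (Split b i (Ref b g j (Vec j e g f h b c d a i)) (Split d h
  (Ref b g j (Vec j e g f i d c b a h)) (Split d i (Ref b g j (Vec j e g f h d c b a i)) (Split c h
  (Ref b e f (Vec e b j d a h f g i c)) (Split c i (Ref b e f (Vec e b j d a i f g h c)) (Split g h
  (Ref b e f (Vec b e a f j h c d i g)) (Split g i (Ref b e f (Vec b e a f j i c d h g)) (Cut
  [a,b,c,d,e,f,g,j]))))))))) (Split f g (Ref b i c (Vec a b c d e f g h i j)) (Split e g (Ref b i c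
  (Vec a b c d f e g h i j)) (Split b j (Ref b i g (Vec a b c d e f g h i j)) (Split d j (Ref b i g
  (Vec a d c b e f g h i j)) (Split c j (Split b h (Ref b g j (Vec j e c f i b g d a h)) (Split b i
  (Ref b g j (Vec j e c f h b g d a i)) (Split d h (Ref b g j (Vec j e c f i d g b a h)) (Split d i
  (Ref b g j (Vec j e c f h d g b a i)) (Split g h (Ref b i h (Vec a b c d e f g h i j)) (Split g i
  (Ref b i h (Vec a b c d e f g i h j)) (Cut [a,b,c,d,e,f,g,j]))))))) (Split i j (Ref b i i (Vec a b
  c d e f g h i j)) (Split h j (Ref b i i (Vec a b c d e f g i h j)) (Split g i (Ref b j b (Vec a b
  c d e f g h i j)) (Split g h (Ref b j b (Vec a b c d e f g i h j)) (Split c f (Ref b j d (Vec a b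
  c d e f g h i j)) (Split c e (Ref b j d (Vec a b c d f e g h i j)) (Split d e (Ref b j h (Vec a b
  c d e f g h i j)) (Split b e (Ref b j h (Vec a d c b e f g h i j)) (Split b f (Ref b j h (Vec a d
  c b f e g h i j)) (Split d f (Ref b j h (Vec a b c d f e g h i j)) (Cut
  [a,b,c,d,g,h,i]))))))))))))))))))))),
  ((b,j,j), [(a,[b,c,d],[]), (b,[h],[]), (c,[e,g],[]), (e,[j],[f,h,i]), (f,[g],[h,i,j]),
  (g,[],[h,i,j]), (h,[i],[j]), (i,[],[j])],Win [(a,b,a,h), (a,c,a,e), (a,c,a,g), (a,b,c,a)]),
  ((c,a,a), [(a,[b,c,d],[]), (c,[e,g],[]), (e,[j],[f]), (f,[g],[h,i,j]), (g,[],[h,i,j]),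
  (h,[i],[])],Split e h (Ref b j i (Vec e c h j b d i f g a)) (Split e i (Ref b j i (Vec e c i j b d
  h f g a)) (Split h j (Ref b j i (Vec a b c d i j e f g h)) (Split i j (Ref b j i (Vec a b c d h j
  e f g i)) (Split b h (Ref b j j (Vec a b c d e f g h i j)) (Split b i (Ref b j j (Vec a b c d e f
  g i h j)) (Split d h (Ref b j j (Vec a d c b e f g h i j)) (Split d i (Ref b j j (Vec a d c b e f
  g i h j)) (Cut [a,b,c,d,e,f,g,j]))))))))),
  ((c,a,b), [(a,[b,c,d],[]), (b,[e],[]), (c,[g],[e,j]), (d,[h],[]), (e,[j],[f,g]), (f,[g],[h,i,j]),
  (g,[],[h,i,j]), (h,[i],[])],Win [(a,c,a,g), (b,h,e,h), (a,d,c,a), (a,h,b,h), (a,d,a,h)]),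
  ((c,a,c), [(a,[b,c,d],[]), (b,[],[e,g,j]), (c,[g],[e,j]), (d,[e,h],[]), (e,[j],[f]),
  (f,[g],[h,i,j]), (g,[],[i,j]), (h,[i],[])],Win [(a,c,a,g), (c,d,g,a), (d,h,e,i), (a,d,c,a),
  (a,d,c,d), (d,h,a,d), (a,h,a,d), (a,h,d,h)]),
  ((c,a,d), [(a,[b,c,d],[]), (c,[g],[e,h,i,j]), (d,[h],[]), (e,[j],[f,g]), (f,[g],[h,i,j]),
  (g,[],[h,i,j]), (h,[i],[])],Split b g (Ref b j i (Vec g c b f d i a e j h)) (Split b e (Ref c a b
  (Vec a b c d e f g h i j)) (Split b j (Ref c a b (Vec a d c b h f g j e i)) (Split d e (Ref c a c
  (Vec a b c d e f g h i j)) (Split d j (Ref c a c (Vec a b c d j f g h i e)) (Split e i (Ref b j i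
  (Vec a b d c i j h f g e)) (Split i j (Ref b j i (Vec a b d c e i h f g j)) (Ref b h d (Vec a c d
  b f i h e j g))))))))),
  ((c,a,e), [(a,[b,c,d],[]), (c,[g],[]), (e,[j],[f]), (f,[g],[h,i,j]), (h,[i],[])],Split e g (Ref b
  j i (Vec g c e f b d j h i a)) (Split g h (Ref b j i (Vec g c h f b d i e j a)) (Split g i (Ref b
  j i (Vec g c i f b d h e j a)) (Split g j (Ref b j i (Vec g c j f b d e h i a)) (Split c e (Ref c
  a a (Vec a b c d e f g h i j)) (Split c h (Ref c a a (Vec a b c d h f g e j i)) (Split c i (Ref c
  a a (Vec a b c d i f g e j h)) (Split c j (Ref c a a (Vec a b c d j f g h i e)) (Split d h (Ref c
  a d (Vec a b c d e f g h i j)) (Split b e (Ref c a d (Vec a d c b h f g e j i)) (Split b h (Ref c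
  a d (Vec a d c b e f g h i j)) (Split b i (Ref c a d (Vec a d c b e f g i h j)) (Split b j (Ref c
  a d (Vec a d c b h f g j e i)) (Split d e (Ref c a d (Vec a b c d h f g e j i)) (Split d i (Ref c
  a d (Vec a b c d e f g i h j)) (Split d j (Ref c a d (Vec a b c d h f g j e i)) (Cut
  [a,b,c,d,f,g]))))))))))))))))),
  ((c,a,f), [(a,[b,c,d],[]), (b,[f,h],[]), (c,[g,j],[]), (d,[],[e,f,h,i]), (e,[j],[g]),
  (f,[],[g,i]), (h,[i],[])],Win [(b,c,a,c), (h,j,b,j), (c,h,j,h), (c,h,c,b)]),
  ((c,a,g), [(a,[b,c,d],[]), (b,[f],[]), (c,[g,j],[]), (e,[j],[f,g]), (f,[],[g,h,i,j]),
  (g,[],[h,i]), (h,[i],[])],Split d f (Ref b j i (Vec c a j g b d e h i f)) (Split b e (Ref b j i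
  (Vec b e a f g j d h i c)) (Split d e (Ref c a e (Vec c g a j d f b h i e)) (Split b g (Ref b j i
  (Vec b f a g c e d h i j)) (Split d h (Ref b j i (Vec c a j g d i e b f h)) (Split d i (Ref b j i
  (Vec c a j g d h e b f i)) (Split d j (Ref b j i (Vec j d c e a f g h i b)) (Split b h (Ref c a f
  (Vec a b c d e f g h i j)) (Split b i (Ref c a f (Vec a b c d e f g i h j)) (Split e h (Ref b j i
  (Vec c g a j e i d b f h)) (Split e i (Ref b j i (Vec c g a j e h d b f i)) (Split b j (Cut
  [a,b,c,d,e,f,g,j]) (Split d g (Ref b h d (Vec b a c f g e j h i d)) (Win [(a,i,b,h), (c,i,j,h),
  (a,i,c,i)])))))))))))))),
  ((c,a,h), [(a,[b,c,d],[]), (b,[f],[e,j]), (c,[g],[e,j]), (d,[j],[]), (e,[j],[f,g]),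
  (f,[],[g,h,i,j]), (g,[],[h,i,j]), (h,[i],[])],Split d f (Ref c a g (Vec a c d b e g f h i j))
  (Split d g (Ref c a g (Vec a b d c e f g h i j)) (Split b g (Ref b j i (Vec b f a g d e c h i j))
  (Split c f (Ref b j i (Vec c f a g d e b h i j)) (Win [(d,i,j,i), (a,h,c,i), (a,h,b,h),
  (a,h,d,i)]))))),
  ((c,a,i), [(a,[b,c,d],[]), (b,[f],[]), (c,[g],[]), (e,[j],[f]), (f,[],[g,h,i,j]),
  (h,[i],[])],Split e g (Ref b j i (Vec a c b d g j f h i e)) (Split g h (Ref b j i (Vec a c b d g i
  f e j h)) (Split g i (Ref b j i (Vec a c b d g h f e j i)) (Split g j (Ref b j i (Vec a c b d e g
  f h i j)) (Split c j (Ref c a g (Vec a b c d e f g h i j)) (Split b e (Ref c a g (Vec a c b d j g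
  f h i e)) (Split b h (Ref c a g (Vec a c b d i g f e j h)) (Split b i (Ref c a g (Vec a c b d h g
  f e j i)) (Split b j (Ref c a g (Vec a c b d e g f h i j)) (Split c e (Ref c a g (Vec a b c d j f
  g h i e)) (Split c h (Ref c a g (Vec a b c d i f g e j h)) (Split c i (Ref c a g (Vec a b c d h f
  g e j i)) (Split d j (Ref c a h (Vec a b c d e f g h i j)) (Split d e (Ref c a h (Vec a b c d j f
  g h i e)) (Split d h (Ref c a h (Vec a b c d i f g e j h)) (Split d i (Ref c a h (Vec a b c d h f
  g e j i)) (Cut [a,b,c,d,f,g]))))))))))))))))),
  ((c,a,j), [(a,[b,c,d],[]), (c,[g],[]), (e,[j],[]), (h,[i],[])],Split f j (Ref b j i (Vec a b c d e
  f g h i j)) (Split e f (Ref b j i (Vec a b c d f j g h i e)) (Split f h (Ref b j i (Vec a b c d f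
  i g e j h)) (Split f i (Ref b j i (Vec a b c d f h g e j i)) (Split f g (Ref c a e (Vec a b c d e
  f g h i j)) (Split b f (Ref c a i (Vec a b c d e f g h i j)) (Split d f (Ref c a i (Vec a d c b e
  f g h i j)) (Split c f (Split b e (Ref b j i (Vec c f a g b j d h i e)) (Split b j (Ref b j i (Vec
  c f a g b e d h i j)) (Split b h (Ref b j i (Vec c f a g b i d e j h)) (Split b i (Ref b j i (Vec
  c f a g b h d e j i)) (Split d e (Ref b j i (Vec c f a g d j b h i e)) (Split d j (Ref b j i (Vec
  c f a g d e b h i j)) (Split d h (Ref b j i (Vec c f a g d i b e j h)) (Split d i (Ref b j i (Vec
  c f a g d h b e j i)) (Split e g (Ref b j i (Vec a b c d g j f h i e)) (Split g j (Ref b j i (Vec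
  a b c d e g f h i j)) (Split g h (Ref b j i (Vec a b c d g i f e j h)) (Split g i (Ref b j i (Vec
  a b c d g h f e j i)) (Cut [a,b,c,d,f,g]))))))))))))) (Cut [a,b,c,d,e,g,h,i,j]))))))))),
  ((c,b,a), [(a,[b,c,d],[]), (b,[i],[]), (c,[],[g,h]), (d,[],[g,h]), (e,[f,j],[]), (g,[i],[]),
  (h,[i],[])],Win [(b,e,a,e), (b,e,i,e)]),
  ((c,b,b), [(a,[b,c,d],[]), (b,[i],[f]), (c,[],[f,g,h]), (d,[],[f,g,h]), (e,[j],[]), (g,[i],[]),
  (h,[i],[])],Split f g (Ref c a j (Vec a c b d e h i f g j)) (Split f h (Ref c a j (Vec a c b d e g
  i f h j)) (Split e f (Ref c b a (Vec a b c d e f g h i j)) (Split f j (Ref c b a (Vec a b c d j e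
  g h i f)) (Cut [a,b,c,d,e,g,h,i,j]))))),
  ((c,b,c), [(a,[d],[f]), (b,[],[f,g,h]), (c,[j],[f,h]), (d,[],[f]), (e,[j],[f,h]), (f,[],[g,h]),
  (g,[i,j],[]), (h,[i],[])],Split f i (Ref c b b (Vec i g f h a b c e j d)) (Cut
  [a,b,c,d,e,g,h,i,j])),
  ((c,b,d), [(a,[b,c,d],[]), (b,[],[f,g,h,i]), (c,[j],[f,g,h,i]), (d,[],[f,g,h,i]), (e,[j],[]),
  (g,[i],[]), (h,[i],[])],Split f g (Ref c a j (Vec a b c d f e j h i g)) (Split f h (Ref c a j (Vec
  a b c d f e j g i h)) (Split e g (Ref c a j (Vec a b c d e f j h i g)) (Split e h (Ref c a j (Vec
  a b c d e f j g i h)) (Split e f (Ref c a j (Vec a b c d e h j g i f)) (Split i j (Cut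
  [a,b,c,d,e,g,h,i,j]) (Split g j (Ref c b c (Vec a b c d e f g h i j)) (Split h j (Ref c b c (Vec a
  b c d e f h g i j)) (Split e i (Split f j (Ref c b a (Vec i e g h a b c f j d)) (Cut
  [a,b,c,d,e,g,h,i,j])) (Split f j (Split f i (Ref c b b (Vec i f g h a b c e j d)) (Cut
  [a,b,c,d,e,f,j])) (Cut [a,b,c,d,e,j]))))))))))),
  ((c,b,e), [(a,[b,c,d],[]), (b,[],[f,g]), (c,[],[f,g]), (d,[],[f,g]), (e,[j],[]), (g,[i],[]),
  (h,[i],[])],Split b h (Ref c a j (Vec a c b d e f h g i j)) (Split c h (Ref c a j (Vec a b c d e f
  h g i j)) (Split d h (Ref c a j (Vec a b d c e f h g i j)) (Split b i (Ref c b b (Vec a b c d e f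
  g h i j)) (Split c i (Ref c b b (Vec a c b d e f g h i j)) (Split d i (Ref c b b (Vec a d b c e f
  g h i j)) (Split c j (Ref c b d (Vec a b c d e f g h i j)) (Split c e (Ref c b d (Vec a b c d j f
  g h i e)) (Split b e (Ref c b d (Vec a c b d j f g h i e)) (Split b j (Ref c b d (Vec a c b d e f
  g h i j)) (Split d e (Ref c b d (Vec a b d c j f g h i e)) (Split d j (Ref c b d (Vec a b d c e f
  g h i j)) (Cut [a,b,c,d]))))))))))))),
  ((c,b,f), [(a,[b,c,d],[]), (e,[j],[]), (h,[i],[])],Split c g (Ref c a j (Vec a b c d e f g h i j))
  (Split b f (Ref c a j (Vec a c b d e g f h i j)) (Split b g (Ref c a j (Vec a c b d e f g h i j))
  (Split c f (Ref c a j (Vec a b c d e g f h i j)) (Split d f (Ref c a j (Vec a b d c e g f h i j))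
  (Split d g (Ref c a j (Vec a b d c e f g h i j)) (Split e f (Ref c b e (Vec a b c d h g f j e i))
  (Split f h (Ref c b e (Vec a b c d e g f i h j)) (Split f i (Ref c b e (Vec a b c d e g f h i j))
  (Split f j (Ref c b e (Vec a b c d h g f e j i)) (Split f g (Split b e (Ref c a j (Vec a c b d f j
  e h i g)) (Split b j (Ref c a j (Vec a c b d f e j h i g)) (Split b h (Ref c a j (Vec a c b d e i
  h f g j)) (Split b i (Ref c a j (Vec a c b d e h i f g j)) (Split c e (Ref c a j (Vec a b c d f j
  e h i g)) (Split c j (Ref c a j (Vec a b c d f e j h i g)) (Split c h (Ref c a j (Vec a b c d e i
  h f g j)) (Split c i (Ref c a j (Vec a b c d e h i f g j)) (Split d e (Ref c a j (Vec a b d c f j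
  e h i g)) (Split d j (Ref c a j (Vec a b d c f e j h i g)) (Split d h (Ref c a j (Vec a b d c e i
  h f g j)) (Split d i (Ref c a j (Vec a b d c e h i f g j)) (Cut [a,b,c,d]))))))))))))) (Cut
  [a,b,c,d,e,g,h,i,j])))))))))))),
  ((c,b,g), [(a,[b],[g]), (b,[],[g]), (e,[i],[g]), (f,[i],[g]), (g,[],[h,j]), (h,[i],[])],Split c g
  (Ref c b f (Vec i e f h a d j c g b)) (Split d g (Ref c b f (Vec i e f h a c j d g b)) (Cut
  [a,b,c,d,e,f,h,i,j]))),
  ((c,b,h), [(a,[b,c],[g]), (e,[i],[g]), (f,[i],[g]), (g,[],[h,j]), (h,[i],[])],Split b g (Ref c b f
  (Vec i e f h a d j b g c)) (Ref c b g (Vec a b c d e f g h i j))),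
  ((c,b,i), [(a,[b,d],[e,f,g]), (b,[j],[]), (c,[h],[e,g]), (e,[],[f,g,h,i,j]), (f,[],[g,h,j]),
  (g,[],[h,i,j]), (h,[i],[])],Split b e (Ref c b h (Vec h c i d a e f j b g)) (Split d e (Split d g
  (Ref c b h (Vec h c i b a e f g d j)) (Split b g (Ref c b h (Vec h c i d a g e j b f)) (Cut
  [a,b,c,d,e,f,h,i,j]))) (Cut [a,b,c,d,f,g,h,i,j]))),
  ((c,b,j), [(a,[b,d],[e,f,g,j]), (c,[h],[e,g,j]), (e,[],[f,g,h,i,j]), (f,[],[g,j]), (g,[],[h,i,j]),
  (h,[i],[j]), (i,[],[j])],Split f h (Ref c b h (Vec a b d j c f e i h g)) (Split b j (Ref c b i
  (Vec a b c d e f g h i j)) (Split d j (Ref c b i (Vec a d c b e f g h i j)) (Cut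
  [a,b,c,d,e,f,g,h,i])))),
  ((c,c,a), [(a,[b,c,d],[]), (c,[h],[]), (e,[],[f,g,h,i,j]), (f,[i],[g,j]), (g,[],[h,i,j]),
  (h,[i],[j]), (i,[],[j])],Split c e (Ref c b g (Vec f i b d a e g h c j)) (Split c g (Ref c b g
  (Vec f i b d a g e h c j)) (Split c j (Ref c b g (Vec f i b d a h e j c g)) (Ref c b j (Vec a b c
  d e f g h i j))))),
  ((c,c,b), [(a,[b,c,d],[]), (d,[i],[]), (e,[],[f,g,h]), (f,[i],[g]), (g,[],[h]), (h,[i],[])],Split
  d e (Ref c b h (Vec a b c j d f g h i e)) (Ref c b h (Vec a b c j d f e h i g))),
  ((c,c,c), [(a,[b,c,d],[]), (e,[],[f,g,j]), (f,[i],[g,j]), (g,[],[j]), (h,[i],[])],Split e h (Ref c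
  b f (Vec a b c d e g j f i h)) (Split g h (Ref c b f (Vec a b c d f e j g h i)) (Split h j (Ref c
  b f (Vec a b c d f e g h j i)) (Split e i (Ref c b h (Vec a b c d e f g h i j)) (Split g i (Ref c
  b h (Vec a b c d f g e h i j)) (Split i j (Ref c b h (Vec a b c d f h e j i g)) (Split c h (Ref c
  c a (Vec a b c d e f g h i j)) (Split b f (Ref c c a (Vec a c b d e h g f i j)) (Split b h (Ref c
  c a (Vec a c b d e f g h i j)) (Split d h (Ref c c a (Vec a b d c e f g h i j)) (Split c f (Ref c
  c a (Vec a b c d e h g f i j)) (Split d f (Ref c c a (Vec a b d c e h g f i j)) (Split d i (Ref c
  c b (Vec a b c d e f g h i j)) (Split b i (Ref c c b (Vec a c d b e f g h i j)) (Split c i (Ref c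
  c b (Vec a b d c e f g h i j)) (Cut [a,b,c,d,e,g,j])))))))))))))))),
  ((c,c,d), [(a,[b,c,d],[]), (c,[h],[]), (e,[],[f,g,h,i,j]), (f,[],[g,h,i,j]), (g,[],[h,i,j]),
  (h,[i],[j]), (i,[],[j])],Split c e (Ref c b j (Vec a b c d f e g h i j)) (Split c f (Ref c b j
  (Vec a b c d e f g h i j)) (Split c g (Ref c b j (Vec a b c d e g f h i j)) (Ref c b j (Vec a b c
  d e j f h i g))))),
  ((c,c,e), [(a,[b,c,d],[]), (h,[i],[])],Split e j (Ref c b f (Vec a b c d e f g h i j)) (Split e f
  (Ref c b f (Vec a b c d e g j h i f)) (Split e g (Ref c b f (Vec a b c d e f j h i g)) (Split f g
  (Ref c b f (Vec a b c d f e j h i g)) (Split f j (Ref c b f (Vec a b c d f e g h i j)) (Split g j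
  (Ref c b f (Vec a b c d g e f h i j)) (Split f i (Ref c c c (Vec a b c d e f g h i j)) (Split e h
  (Ref c c c (Vec a b c d f e g i h j)) (Split e i (Ref c c c (Vec a b c d f e g h i j)) (Split f h
  (Ref c c c (Vec a b c d e f g i h j)) (Split g h (Ref c c c (Vec a b c d e g f i h j)) (Split g i
  (Ref c c c (Vec a b c d e g f h i j)) (Split h j (Ref c c c (Vec a b c d e i f j h g)) (Split i j
  (Ref c c c (Vec a b c d e h f j i g)) (Split c h (Ref c c d (Vec a b c d e f g h i j)) (Split b h
  (Ref c c d (Vec a c b d e f g h i j)) (Split b i (Ref c c d (Vec a c b d e f g i h j)) (Split c i
  (Ref c c d (Vec a b c d e f g i h j)) (Split d h (Ref c c d (Vec a b d c e f g h i j)) (Split d i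
  (Ref c c d (Vec a b d c e f g i h j)) (Cut [a,b,c,d,e,f,g,j]))))))))))))))))))))),
  ((c,c,f), [(a,[c,d],[f,h,i,j]), (b,[g],[f,h,i,j]), (c,[e],[]), (e,[],[f,h,i,j]), (f,[],[g,h,i,j]),
  (g,[],[h,i,j]), (h,[],[i,j]), (i,[],[j])],Split c f (Ref c c e (Vec c a e f d h i b g j)) (Split d
  f (Ref b d e (Vec a c d b g h i e f j)) (Cut [a,b,c,d,e,g,h,i,j]))),
  ((c,c,g), [(a,[b,c,d],[]), (b,[g],[]), (e,[],[f,g,h,i,j]), (f,[],[g,h,i,j]), (g,[],[h,i,j]),
  (h,[],[i,j]), (i,[],[j])],Split b e (Ref c b j (Vec a c e d f j h b g i)) (Split b f (Ref c b j
  (Vec a c f d e j h b g i)) (Split b h (Ref c b j (Vec a c g d e j f b h i)) (Split b i (Ref c b j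
  (Vec a c g d e j f b i h)) (Split b j (Ref c b j (Vec a c g d e i f b j h)) (Split c e (Ref c c f
  (Vec a b c d e f g h i j)) (Split d e (Ref c c f (Vec a b d c e f g h i j)) (Cut
  [a,b,c,d,f,g,h,i,j])))))))),
  ((c,c,h), [(a,[b,c,d],[])],Split h i (Ref c c e (Vec a b c d e f g h i j)) (Split e f (Ref c c e
  (Vec a b c d g h i e f j)) (Split e g (Ref c c e (Vec a b c d f h i e g j)) (Split e h (Ref c c e
  (Vec a b c d f g i e h j)) (Split e i (Ref c c e (Vec a b c d f g h e i j)) (Split e j (Ref c c e
  (Vec a b c d f g h e j i)) (Split f g (Ref c c e (Vec a b c d e h i f g j)) (Split f h (Ref c c e
  (Vec a b c d e g i f h j)) (Split f i (Ref c c e (Vec a b c d e g h f i j)) (Split f j (Ref c c e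
  (Vec a b c d e g h f j i)) (Split g h (Ref c c e (Vec a b c d e f i g h j)) (Split g i (Ref c c e
  (Vec a b c d e f h g i j)) (Split g j (Ref c c e (Vec a b c d e f h g j i)) (Split h j (Ref c c e
  (Vec a b c d e f g h j i)) (Split i j (Ref c c e (Vec a b c d e f g i j h)) (Split b e (Ref c c g
  (Vec a b c d f g e h i j)) (Split c e (Ref c c g (Vec a c b d f g e h i j)) (Split d e (Ref c c g
  (Vec a d b c f g e h i j)) (Cut [a,b,c,d,f,g,h,i,j])))))))))))))))))))]"

definition table3 :: table where
  "table3 = fold store refutations3 table4"

lemma check_refutations3: "check_all 3 table4 refutations3"
  by code_simp

lemma last_refutations3: "refutations3 \<noteq> [] \<and> fst (snd (last refutations3)) = star (Suc 2)"
  by code_simp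

text \<open>Connected graphs with degrees at most 2 are paths and cycles. The main patterns
  prescribe a matching, of five edges under \<open>(a,a,e)\<close>, then four under
  \<open>(a,a,j)\<close>, three under \<open>(a,b,d)\<close>, two under \<open>(a,b,g)\<close> and
  one under \<open>(a,b,i)\<close>. The final pattern is empty and so prescribes nothing.\<close>

definition refutations2 :: "refutation list" where
  "refutations2 = [
  ((a,a,b), [(a,[i],[]), (b,[h,i],[]), (c,[h,j],[]), (d,[g,j],[]), (e,[f],[])],Split a g (Cut
  [a,b,c,d,g,h,i,j]) (Win [(b,f,i,e), (f,j,e,d), (e,h,f,b), (c,f,j,f), (e,h,f,c)])),
  ((a,a,c), [(a,[i],[]), (b,[h,i],[]), (c,[h,j],[]), (d,[g],[]), (e,[f],[])],Split d j (Ref a a b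
  (Vec a b c d e f g h i j)) (Split g j (Ref a a b (Vec a b c g e f d h i j)) (Split a d (Ref a a b
  (Vec g a b c e f j i d h)) (Split a g (Ref a a b (Vec d a b c e f j i g h)) (Split a e (Ref a a b
  (Vec f a b c d g j i e h)) (Split a f (Ref a a b (Vec e a b c d g j i f h)) (Split e j (Ref a a b
  (Vec a b c e d g f h i j)) (Split f j (Ref a a b (Vec a b c f d g e h i j)) (Cut
  [a,b,c,h,i,j]))))))))),
  ((a,a,d), [(a,[i],[]), (b,[h],[]), (c,[h,j],[]), (d,[g],[]), (e,[f],[])],Split b i (Ref a a c (Vec
  a b c d e f g h i j)) (Split a b (Ref a a c (Vec i b c d e f g h a j)) (Split a j (Ref a a c (Vec
  b c a d e f g j h i)) (Split b d (Ref a a c (Vec g b c a e f i h d j)) (Split b g (Ref a a c (Vec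
  d b c a e f i h g j)) (Split b e (Ref a a c (Vec f b c a d g i h e j)) (Split b f (Ref a a c (Vec
  e b c a d g i h f j)) (Split d j (Ref a a c (Vec b c d a e f i j h g)) (Split e j (Ref a a c (Vec
  b c e a d g i j h f)) (Split f j (Ref a a c (Vec b c f a d g i j h e)) (Split g j (Ref a a c (Vec
  b c g a e f i j h d)) (Split i j (Ref a a c (Vec b c i d e f g j h a)) (Cut
  [a,d,e,f,g,i]))))))))))))),
  ((a,a,e), [(a,[i],[]), (b,[h],[]), (c,[j],[]), (d,[g],[]), (e,[f],[])],Split c h (Ref a a d (Vec a
  b c d e f g h i j)) (Split a b (Ref a a d (Vec c h a d e f g b j i)) (Split a c (Ref a a d (Vec b
  j a d e f g c h i)) (Split a d (Ref a a d (Vec b g a c e f j d h i)) (Split a e (Ref a a d (Vec b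
  f a c d g j e h i)) (Split a f (Ref a a d (Vec b e a c d g j f h i)) (Split a g (Ref a a d (Vec b
  d a c e f j g h i)) (Split a h (Ref a a d (Vec c b a d e f g h j i)) (Split a j (Ref a a d (Vec b
  c a d e f g j h i)) (Split b c (Ref a a d (Vec a j b d e f g c i h)) (Split b d (Ref a a d (Vec a
  g b c e f j d i h)) (Split b e (Ref a a d (Vec a f b c d g j e i h)) (Split b f (Ref a a d (Vec a
  e b c d g j f i h)) (Split b g (Ref a a d (Vec a d b c e f j g i h)) (Split b i (Ref a a d (Vec c
  a b d e f g i j h)) (Split b j (Ref a a d (Vec a c b d e f g j i h)) (Split c d (Ref a a d (Vec a
  g c b e f h d i j)) (Split c e (Ref a a d (Vec a f c b d g h e i j)) (Split c f (Ref a a d (Vec a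
  e c b d g h f i j)) (Split c g (Ref a a d (Vec a d c b e f h g i j)) (Split c i (Ref a a d (Vec b
  a c d e f g i h j)) (Split d e (Ref a a d (Vec a f d b c j h e i g)) (Split d f (Ref a a d (Vec a
  e d b c j h f i g)) (Split d h (Ref a a d (Vec a b d c e f j h i g)) (Split d i (Ref a a d (Vec b
  a d c e f j i h g)) (Split d j (Ref a a d (Vec a c d b e f h j i g)) (Split e g (Ref a a d (Vec a
  d e b c j h g i f)) (Split e h (Ref a a d (Vec a b e c d g j h i f)) (Split e i (Ref a a d (Vec b
  a e c d g j i h f)) (Split e j (Ref a a d (Vec a c e b d g h j i f)) (Split f g (Cut
  [a,b,c,h,i,j]) (Split f h (Cut [a,c,d,g,i,j]) (Split f i (Cut [a,e,f,i]) (Split f j (Cut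
  [a,b,d,g,h,i]) (Cut [a,b,c,d,g,h,i,j]))))))))))))))))))))))))))))))))))),
  ((a,a,f), [(a,[f],[c]), (b,[e,h],[]), (c,[j],[]), (d,[g,i],[]), (e,[f],[]), (h,[j],[])],Win
  [(d,h,d,j), (d,e,d,f), (b,d,e,d), (b,d,h,d)]),
  ((a,a,g), [(a,[f],[i]), (b,[e,h],[]), (c,[j],[]), (d,[g],[]), (e,[f],[]), (h,[j],[])],Split a c
  (Cut [a,b,c,e,f,h,j]) (Split c i (Ref a a e (Vec a b c d h j g e f i)) (Split d i (Ref a a f (Vec
  a b c d e f g h i j)) (Split g i (Ref a a f (Vec a b c g e f d h i j)) (Cut
  [a,b,c,d,e,f,g,h,j]))))),
  ((a,a,h), [(a,[f],[i]), (b,[e,h],[]), (c,[j],[]), (d,[g],[]), (e,[f],[])],Split h i (Ref a a e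
  (Vec a b c d h i g e f j)) (Split h j (Ref a a g (Vec a b c d e f g h i j)) (Split c h (Ref a a g
  (Vec a b j d e f g h i c)) (Split a c (Ref a a g (Vec h f j d e b g a i c)) (Split a j (Ref a a g
  (Vec h f c d e b g a i j)) (Split a d (Ref a a g (Vec h f g c e b j a i d)) (Split a g (Ref a a g
  (Vec h f d c e b j a i g)) (Split d h (Ref a a g (Vec a b g c e f j h i d)) (Split g h (Ref a a g
  (Vec a b d c e f j h i g)) (Cut [a,b,e,f,h])))))))))),
  ((a,a,i), [(a,[f],[i]), (b,[h],[]), (c,[j],[]), (d,[g],[]), (e,[f],[])],Split e i (Ref a a e (Vec
  a b c d e i g h f j)) (Split b e (Ref a a h (Vec a b c d e f g h i j)) (Split a b (Ref a a h (Vec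
  e b c d a f g h i j)) (Split a c (Ref a a h (Vec e c b d a f g j i h)) (Split a d (Ref a a h (Vec
  e d b c a f j g i h)) (Split a g (Ref a a h (Vec e g b c a f j d i h)) (Split a h (Ref a a h (Vec
  e h c d a f g b i j)) (Split a j (Ref a a h (Vec e j b d a f g c i h)) (Split c e (Ref a a h (Vec
  a c b d e f g j i h)) (Split d e (Ref a a h (Vec a d b c e f j g i h)) (Split e g (Ref a a h (Vec
  a g b c e f j d i h)) (Split e h (Ref a a h (Vec a h c d e f g b i j)) (Split e j (Ref a a h (Vec
  a j b d e f g c i h)) (Cut [a,e,f])))))))))))))),
  ((a,a,j), [(b,[h],[]), (c,[j],[]), (d,[g],[]), (e,[f],[])],Split a i (Ref a a e (Vec a b c d e f g
  h i j)) (Split a f (Ref a a i (Vec a b c d e f g h i j)) (Split a b (Ref a a i (Vec a c d e h b f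
  j i g)) (Split a c (Ref a a i (Vec a b d e j c f h i g)) (Split a d (Ref a a i (Vec a b c e g d f
  h i j)) (Split a e (Ref a a i (Vec a b c d f e g h i j)) (Split a g (Ref a a i (Vec a b c e d g f
  h i j)) (Split a h (Ref a a i (Vec a c d e b h f j i g)) (Split a j (Ref a a i (Vec a b d e c j f
  h i g)) (Cut [a])))))))))),
  ((a,b,a), [(a,[],[c,d,e,f,g,i,j]), (b,[h],[c,d,e,f,g,i,j]), (c,[],[j]), (d,[],[j]), (e,[],[j]),
  (f,[],[h,j]), (g,[],[h,j]), (i,[],[j])],Split h j (Cut [a,b,h,j]) (Cut [a,b,c,d,e,f,g,h,i])),
  ((a,b,b), [(a,[],[c,d,f,g,i,j]), (b,[h],[f,g]), (c,[f],[j]), (d,[g],[j]), (f,[],[h,j]),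
  (g,[],[h,j]), (i,[],[j])],Split a e (Ref a a j (Vec i a b c d g f e j h)) (Split e j (Ref a a j
  (Vec a b c d e j g h i f)) (Split a b (Ref a b a (Vec a b c d e f g h i j)) (Split a h (Ref a b a
  (Vec a h c d e f g b i j)) (Cut [a]))))),
  ((a,b,c), [(a,[],[c,i,j]), (b,[h],[]), (c,[],[i,j]), (d,[g],[]), (e,[f],[]), (g,[i],[]),
  (i,[],[j])],Split a d (Ref a a j (Vec c a b e g i f d j h)) (Split c d (Ref a a j (Vec a b c e g i
  f h j d)) (Split d j (Ref a a j (Vec a b d e g i f h c j)) (Split c f (Ref a b b (Vec a b c d e f
  g h i j)) (Split a b (Ref a b b (Vec c e a d h b g f i j)) (Split a e (Ref a b b (Vec c b a d f e
  g h i j)) (Split a f (Ref a b b (Vec c b a d e f g h i j)) (Split a h (Ref a b b (Vec c e h d b a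
  g f i j)) (Cut [a]))))))))),
  ((a,b,d), [(b,[h],[]), (d,[g],[]), (e,[f],[])],Split c j (Ref a a j (Vec a b c d e f g h i j))
  (Split a c (Ref a a j (Vec i a b d e f g c j h)) (Split a i (Ref a a j (Vec c a b d e f g i j h))
  (Split a j (Ref a a j (Vec c a b d e f g j i h)) (Split c i (Ref a a j (Vec a b c d e f g h j i))
  (Split i j (Ref a a j (Vec a b d e i j f h c g)) (Split a b (Ref a b c (Vec c d i h e f b g a j))
  (Split a d (Ref a b c (Vec c b i g e f d h a j)) (Split a e (Ref a b c (Vec c b i f d g e h a j))
  (Split a f (Ref a b c (Vec c b i e d g f h a j)) (Split a g (Ref a b c (Vec c b i d e f g h a j))
  (Split a h (Ref a b c (Vec c d i b e f h g a j)) (Cut [a]))))))))))))),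
  ((a,b,e), [(a,[],[b,c,d,e,f,h,i,j]), (b,[],[c,d,g]), (c,[],[e,f,h,i,j]),
  (d,[g],[e,f,h,i,j])],Split a g (Cut [a,c,d,g]) (Cut [a])),
  ((a,b,f), [(a,[],[b,c,e,f,i,j]), (b,[e],[c,d,g]), (c,[],[e,f,i,j]), (d,[g],[])],Split a h (Ref a b
  d (Vec c a f b d g e h i j)) (Split c h (Ref a b d (Vec a b f c d g h e i j)) (Split c d (Ref a b
  e (Vec a b c d e f g h i j)) (Split c g (Ref a b e (Vec a b c g e f d h i j)) (Cut
  [a,b,d,e,f,g,h,i,j]))))),
  ((a,b,g), [(b,[h],[]), (d,[g],[])],Split e f (Ref a b d (Vec a b c d e f g h i j)) (Split a c (Ref
  a b d (Vec e a f b d g h c i j)) (Split a e (Ref a b d (Vec c a f b d g h e i j)) (Split a f (Ref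
  a b d (Vec c a e b d g h f i j)) (Split a i (Ref a b d (Vec c a e b d g h i f j)) (Split a j (Ref
  a b d (Vec c a e b d g h j f i)) (Split c e (Ref a b d (Vec a b f c d g e h i j)) (Split c f (Ref
  a b d (Vec a b e c d g f h i j)) (Split c i (Ref a b d (Vec a b e c d g i h f j)) (Split c j (Ref
  a b d (Vec a b e c d g j h f i)) (Split e i (Ref a b d (Vec a b c d e i g h f j)) (Split e j (Ref
  a b d (Vec a b c d e j g h f i)) (Split b e (Ref a b f (Vec a b c d e f g h i j)) (Split a b (Ref
  a b f (Vec c b e d a f g h i j)) (Split a d (Ref a b f (Vec c d e b a f h g i j)) (Split a g (Ref
  a b f (Vec c g e b a f h d i j)) (Split a h (Ref a b f (Vec c a e d h f g b i j)) (Cut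
  [a])))))))))))))))))),
  ((a,b,h), [(a,[],[b,c,d,e,f,g,i,j]), (b,[h],[c,d,e,f,g,j]), (c,[],[i]), (d,[],[i]), (e,[],[i]),
  (f,[],[i]), (g,[],[i]), (i,[],[j])],Split a h (Cut [a,b,h,i]) (Cut [a])),
  ((a,b,i), [(b,[h],[])],Split a c (Ref a b g (Vec d a e b f g h c i j)) (Split a d (Ref a b g (Vec
  c a e b f g h d i j)) (Split a e (Ref a b g (Vec c a d b f g h e i j)) (Split a f (Ref a b g (Vec
  c a d b e g h f i j)) (Split a g (Ref a b g (Vec c a d b e f h g i j)) (Split a i (Ref a b g (Vec
  c a d b e f h i g j)) (Split a j (Ref a b g (Vec c a d b e f h j g i)) (Split c i (Ref a b g (Vec
  a b d c e f i h g j)) (Split d i (Ref a b g (Vec a b c d e f i h g j)) (Split e i (Ref a b g (Vec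
  a b c e d f i h g j)) (Split f i (Ref a b g (Vec a b c f d e i h g j)) (Split g i (Ref a b g (Vec
  a b c g d e i h f j)) (Split i j (Ref a b g (Vec a b c i d e j h f g)) (Split b i (Ref a b h (Vec
  a b c d e f g h i j)) (Split h i (Ref a b h (Vec a h c d e f g b i j)) (Cut
  [a,b,c,d,e,f,g,h,j])))))))))))))))),
  ((a,b,j), [],Split a b (Ref a b i (Vec c a d e f g h b i j)) (Split a c (Ref a b i (Vec b a d e f
  g h c i j)) (Split a d (Ref a b i (Vec b a c e f g h d i j)) (Split a e (Ref a b i (Vec b a c d f
  g h e i j)) (Split a f (Ref a b i (Vec b a c d e g h f i j)) (Split a g (Ref a b i (Vec b a c d e
  f h g i j)) (Split a h (Ref a b i (Vec b a c d e f g h i j)) (Split a i (Ref a b i (Vec b a c d e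
  f g i h j)) (Split a j (Ref a b i (Vec b a c d e f g j h i)) (Cut [a]))))))))))]"

definition table2 :: table where
  "table2 = fold store refutations2 table3"

lemma check_refutations2: "check_all 2 table3 refutations2"
  by code_simp

lemma last_refutations2: "refutations2 \<noteq> [] \<and> fst (snd (last refutations2)) = []"
  by code_simp

section \<open>The theorem\<close>

text \<open>The exclusion of the Petersen graph is used once, to make the initial table sound. The
  stages then refute the empty pattern, which every labelling matches.\<close>

lemma (in evasive_graph) petersen_labelling_exists:
  assumes card: "card (pverts G) = 10"
  shows "\<exists>\<phi>. petersen_labelling G \<phi>"
proof (rule ccontr)
  assume "\<nexists>\<phi>. petersen_labelling G \<phi>"
  then have "refuted G petersen_pattern"
    using matches_petersen_pattern by (auto simp: refuted_def)
  then have table: "refuted_table G petersen_table"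
    by (simp add: refuted_table_def petersen_table_def entry_def)
  \<comment> \<open>The descent starts from the trivial bound: a closed neighbourhood has at most
    ten elements.\<close>
  have deg: "degrees_le G 9"
    unfolding degrees_le_def
  proof
    fix v
    have "{w. legal_move G v w} \<subseteq> pverts G \<or> {w. legal_move G v w} = {v}"
      by (auto simp: legal_move_def dest: in_arcsD1 in_arcsD2)
    then show "card {w. legal_move G v w} \<le> Suc 9"
      using card card_mono[OF pair_finite_verts] by fastforce
  qed
  note stage = lower_degree_bound[OF card]
  note 9 = stage[OF conjI[OF deg table] check_refutations9 last_refutations9, folded table9_def]
  note 7 = stage[OF 9 check_refutations7 last_refutations7, folded table7_def]
  note 6 = stage[OF 7 check_refutations6 last_refutations6, folded table6_def]
  note 5 = stage[OF 6 check_refutations5 last_refutations5, folded table5_def]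
  note 4 = stage[OF 5 check_refutations4 last_refutations4, folded table4_def]
  note 3 = stage[OF 4 check_refutations3 last_refutations3, folded table3_def]
  have "refuted G []"
    using check_all_sound(2)[OF 3 check_refutations2] last_refutations2 last_in_set by metis
  \<comment> \<open>Ten vertices can be labelled at all, and a single labelling already contradicts
    the refutation of the empty pattern.\<close>
  moreover obtain \<phi> where "labelling G \<phi>"
    using labelling_exists[OF pair_finite_verts card, of "[]"] by auto
  ultimately show False
    by (simp add: refuted_def matches_def)
qed

hide_const (open) a b c d e f g h i j

theorem theorem2:
  shows "(pair_graph petersen \<and> Digraph_Component.connected (with_proj petersen)
      \<and> card (pverts petersen) = 10 \<and> cop_number petersen = 3)
    \<and> (\<forall>G :: 'a pair_pre_digraph.
        pair_graph G \<and> Digraph_Component.connected (with_proj G) \<and> card (pverts G) = 10 \<longrightarrow>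
          (cop_number G = 3 \<longleftrightarrow> digraph_iso (with_proj G) (with_proj petersen))
          \<and> (\<not> digraph_iso (with_proj G) (with_proj petersen) \<longrightarrow> cop_number G \<le> 2))"
proof (intro conjI allI impI)
  show "pair_graph petersen" by (rule pair_graph_petersen)
  show "Digraph_Component.connected (with_proj petersen)" by (rule connected_petersen)
  show "card (pverts petersen) = 10" by (rule card_verts_petersen)
  show "cop_number petersen = 3"
    by (rule petersen_labelling_cop_number[OF pair_graph_petersen petersen_labelling_petersen])
next
  fix G :: "'a pair_pre_digraph"
  assume "pair_graph G \<and> Digraph_Component.connected (with_proj G) \<and> card (pverts G) = 10"
  then have G: "pair_graph G" "Digraph_Component.connected (with_proj G)" "card (pverts G) = 10"
    by auto
  show le: "cop_number G \<le> 2" if "\<not> digraph_iso (with_proj G) (with_proj petersen)"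
  proof -
    have "\<exists>\<sigma>. winning_cop_strategy G 2 \<sigma>"
    proof (rule ccontr)
      assume "\<nexists>\<sigma>. winning_cop_strategy G 2 \<sigma>"
      \<comment> \<open>The failure of every strategy for two cops is exactly the extra assumption
        under which certificates cannot pass, so the Petersen graph is forced.\<close>
      then interpret evasive_graph G
        using G by (intro evasive_graph.intro evasive_graph_axioms.intro) auto
      show False
        using petersen_labelling_exists[OF G(3)] that digraph_iso_petersen_iff[OF G(1)] by blast
    qed
    then show ?thesis unfolding cop_number_def by (rule Least_le)
  qed
  show "cop_number G = 3 \<longleftrightarrow> digraph_iso (with_proj G) (with_proj petersen)"
  proof
    assume "cop_number G = 3"
    then show "digraph_iso (with_proj G) (with_proj petersen)" using le by fastforce
  next
    assume "digraph_iso (with_proj G) (with_proj petersen)"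
    then show "cop_number G = 3"
      using petersen_labelling_cop_number[OF G(1)] digraph_iso_petersen_iff[OF G(1)] by blast
  qed
qed

end
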